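(* Let $\mathfrak{g}=(G,\mathfrak{g}_2,s,t)$ be a small connected groupoidal computad. If the Euler characteristic $\chi\big(\mathcal{F}^{\mathrm{Gr}}_{\mathrm{Top}_2}(\mathfrak{g})\big)$ is an integer strictly less than $1$, then the groupoid $\mathcal{P}_{(1,0)}(\mathfrak{g})$ presented by $\mathfrak{g}$ is not thin.
   Context: A small graph $G$ consists of a set of objects, a set of arrows, and domain and codomain maps. $\mathcal{L}_1\mathcal{F}_1(G)$ is the free groupoid on $G$; its morphisms are reduced words in arrows and their formal inverses. A small groupoidal computad $\mathfrak{g}=(G,\mathfrak{g}_2,s,t)$ is a small graph $G$, a set $\mathfrak{g}_2$, and for each $\alpha\in\mathfrak{g}_2$ two parallel morphisms $s(\alpha),t(\alpha)$ of $\mathcal{L}_1\mathcal{F}_1(G)$. It is connected if $G$ is connected. $\mathcal{P}_{(1,0)}(\mathfrak{g})$ is the quotient groupoid of $\mathcal{L}_1\mathcal{F}_1(G)$ by the relations $s(\alpha)=t(\alpha)$. $\mathcal{F}^{\mathrm{Gr}}_{\mathrm{Top}_2}(\mathfrak{g})$ is the $2$-dimensional CW-complex constructed as follows: - Start from the topological realization of $G$: vertices, with a copy of $[0,1]$ for each arrow, glued at $0$ to its domain and at $1$ to its codomain. - For each $\alpha$, attach a disc $B^2$. The upper boundary semicircle is mapped along the concatenated path of $s(\alpha)$, and the lower boundary semicircle along that of $t(\alpha)$. - A word $a_{m-1}\cdots a_0$ gives the path traversing $a_n$ on $[n/m,(n+1)/m]$, forwards for arrows and backwards for formal inverses; identities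 give constant paths. The Euler characteristic of a space $X$ is $\chi(X)=\sum_i(-1)^i\dim_{\mathbb{R}}H^i(X;\mathbb{R})$, where $H^i$ is ordinary cohomology; it is defined when all but finitely many terms vanish and the remaining dimensions are finite. A groupoid is thin if it has at most one morphism between any two objects. *)

theory Defs
  imports "HOL-Analysis.Analysis" "HOL-Homology.Homology"
begin

section \<open>Small graphs and groupoidal computads\<close>

text \<open>A small groupoidal computad: a graph (objects, arrows, domain and codomain maps),
  a set of 2-cells, and for each 2-cell a source and target morphism of the free groupoid.
  A morphism of the free groupoid is a triple (x, w, y): source object x, a reduced word w
  and target object y.  A word is a list of letters listed in the order of traversal
  (i.e. the word a_{m-1}...a_0 is the list [a_0, ..., a_{m-1}]); a letter (a, True) is the
  arrow a, and (a, False) its formal inverse.\<close>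

record ('o, 'a, 'c) computad =
  Obj   :: "'o set"
  Arr   :: "'a set"
  gdom  :: "'a \<Rightarrow> 'o"
  gcod  :: "'a \<Rightarrow> 'o"
  Cells :: "'c set"
  csrc  :: "'c \<Rightarrow> 'o \<times> ('a \<times> bool) list \<times> 'o"
  ctgt  :: "'c \<Rightarrow> 'o \<times> ('a \<times> bool) list \<times> 'o"

type_synonym ('o, 'a) fmor = "'o \<times> ('a \<times> bool) list \<times> 'o"

definition letter_start :: "('o, 'a, 'c) computad \<Rightarrow> 'a \<times> bool \<Rightarrow> 'o" where
  "letter_start g l = (if snd l then gdom g (fst l) else gcod g (fst l))"

definition letter_end :: "('o, 'a, 'c) computad \<Rightarrow> 'a \<times> bool \<Rightarrow> 'o" where
  "letter_end g l = (if snd l then gcod g (fst l) else gdom g (fst l))"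

definition linv :: "'a \<times> bool \<Rightarrow> 'a \<times> bool" where
  "linv l = (fst l, \<not> snd l)"

definition reduced_word :: "('a \<times> bool) list \<Rightarrow> bool" where
  "reduced_word w \<longleftrightarrow> (\<forall>i. Suc i < length w \<longrightarrow> w ! Suc i \<noteq> linv (w ! i))"

text \<open>Morphisms of the free groupoid \<open>L_1 F_1(G)\<close>.\<close>
definition fg_mor :: "('o, 'a, 'c) computad \<Rightarrow> ('o, 'a) fmor \<Rightarrow> bool" where
  "fg_mor g f \<longleftrightarrow> (case f of (x, w, y) \<Rightarrow>
      x \<in> Obj g \<and> y \<in> Obj g \<and>
      (\<forall>l\<in>set w. fst l \<in> Arr g) \<and>
      (w = [] \<longrightarrow> x = y) \<and>
      (w \<noteq> [] \<longrightarrow> letter_start g (hd w) = x \<and> letter_end g (last w) = y) \<and>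
      (\<forall>i. Suc i < length w \<longrightarrow> letter_end g (w ! i) = letter_start g (w ! Suc i)) \<and>
      reduced_word w)"

fun reduce :: "('a \<times> bool) list \<Rightarrow> ('a \<times> bool) list" where
  "reduce [] = []"
| "reduce (l # w) = (case reduce w of
       [] \<Rightarrow> [l]
     | l' # w' \<Rightarrow> (if l' = linv l then w' else l # l' # w'))"

definition fsrc :: "('o, 'a) fmor \<Rightarrow> 'o" where "fsrc f = fst f"
definition ftgt :: "('o, 'a) fmor \<Rightarrow> 'o" where "ftgt f = snd (snd f)"

text \<open>Composition in the free groupoid: \<open>fg_comp h f\<close> is "h after f" (f: x \<rightarrow> y, h: y \<rightarrow> z).\<close>
definition fg_comp :: "('o, 'a) fmor \<Rightarrow> ('o, 'a) fmor \<Rightarrow> ('o, 'a) fmor" where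
  "fg_comp h f = (fsrc f, reduce (fst (snd f) @ fst (snd h)), ftgt h)"

definition groupoidal_computad :: "('o, 'a, 'c) computad \<Rightarrow> bool" where
  "groupoidal_computad g \<longleftrightarrow>
     (\<forall>a\<in>Arr g. gdom g a \<in> Obj g \<and> gcod g a \<in> Obj g) \<and>
     (\<forall>\<alpha>\<in>Cells g. fg_mor g (csrc g \<alpha>) \<and> fg_mor g (ctgt g \<alpha>) \<and>
        fsrc (csrc g \<alpha>) = fsrc (ctgt g \<alpha>) \<and> ftgt (csrc g \<alpha>) = ftgt (ctgt g \<alpha>))"

text \<open>Connectedness of the underlying graph (nonempty, any two objects joined by a zigzag).\<close>
definition connected_computad :: "('o, 'a, 'c) computad \<Rightarrow> bool" where
  "connected_computad g \<longleftrightarrow> Obj g \<noteq> {} \<and>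
     (let E = {(gdom g a, gcod g a) | a. a \<in> Arr g} in
       \<forall>x\<in>Obj g. \<forall>y\<in>Obj g. (x, y) \<in> (E \<union> E\<inverse>)\<^sup>*)"

section \<open>The presented groupoid \<open>P_(1,0)\<close>\<close>

text \<open>The congruence on the free groupoid generated by the relations \<open>s(\<alpha>) = t(\<alpha>)\<close>:
  the smallest equivalence relation on morphisms containing these pairs and closed under
  pre- and post-composition.  The morphisms of \<open>P_(1,0)(g)\<close> are its classes.\<close>
inductive pcong :: "('o, 'a, 'c) computad \<Rightarrow> ('o, 'a) fmor \<Rightarrow> ('o, 'a) fmor \<Rightarrow> bool"
  for g where
  gen: "\<alpha> \<in> Cells g \<Longrightarrow> pcong g (csrc g \<alpha>) (ctgt g \<alpha>)"
| refl: "fg_mor g f \<Longrightarrow> pcong g f f"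
| sym: "pcong g f f' \<Longrightarrow> pcong g f' f"
| trans: "pcong g f f' \<Longrightarrow> pcong g f' f'' \<Longrightarrow> pcong g f f''"
| postcomp: "pcong g f f' \<Longrightarrow> fg_mor g h \<Longrightarrow> fsrc h = ftgt f \<Longrightarrow>
             pcong g (fg_comp h f) (fg_comp h f')"
| precomp: "pcong g f f' \<Longrightarrow> fg_mor g h \<Longrightarrow> ftgt h = fsrc f \<Longrightarrow>
             pcong g (fg_comp f h) (fg_comp f' h)"

text \<open>\<open>P_(1,0)(g)\<close> is thin: at most one morphism between any two objects, i.e. any two
  parallel morphisms of the free groupoid become equal in the quotient.\<close>
definition presented_groupoid_thin :: "('o, 'a, 'c) computad \<Rightarrow> bool" where
  "presented_groupoid_thin g \<longleftrightarrow>
     (\<forall>f f'. fg_mor g f \<and> fg_mor g f' \<and> fsrc f = fsrc f' \<and> ftgt f = ftgt f'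
        \<longrightarrow> pcong g f f')"

section \<open>The CW-complex \<open>F^Gr_Top2(g)\<close>\<close>

datatype ('o, 'a, 'c) precell = Vert 'o | EdgePt 'a real | DiscPt 'c "real \<times> real"

definition pre_carrier :: "('o, 'a, 'c) computad \<Rightarrow> ('o, 'a, 'c) precell set" where
  "pre_carrier g = Vert ` Obj g \<union> {EdgePt a p | a p. a \<in> Arr g \<and> p \<in> {0..1}}
                   \<union> {DiscPt \<alpha> z | \<alpha> z. \<alpha> \<in> Cells g \<and> z \<in> cball 0 1}"

text \<open>The disjoint union of the discrete vertex set, a copy of [0,1] per arrow and a closed
  unit disc per 2-cell.\<close>
definition pre_open :: "('o, 'a, 'c) computad \<Rightarrow> ('o, 'a, 'c) precell set \<Rightarrow> bool" where
  "pre_open g U \<longleftrightarrow> U \<subseteq> pre_carrier g \<and>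
     (\<forall>a\<in>Arr g. openin (subtopology euclideanreal {0..1}) {p \<in> {0..1}. EdgePt a p \<in> U}) \<and>
     (\<forall>\<alpha>\<in>Cells g. openin (subtopology euclidean (cball (0::real\<times>real) 1))
                          {z \<in> cball 0 1. DiscPt \<alpha> z \<in> U})"

lemma istopology_pre_open: "istopology (pre_open (g :: ('o, 'a, 'c) computad))"
  unfolding istopology_def
proof (intro conjI allI impI ballI)
  fix S T :: "('o, 'a, 'c) precell set"
  assume S: "pre_open g S" and T: "pre_open g T"
  have e2: "{p \<in> {0..1}. EdgePt a p \<in> S \<inter> T} = {p \<in> {0..1}. EdgePt a p \<in> S} \<inter> {p \<in> {0..1}. EdgePt a p \<in> T}"
    for a by auto
  have d2: "{z \<in> cball 0 1. DiscPt a z \<in> S \<inter> T} = {z \<in> cball 0 1. DiscPt a z \<in> S} \<inter> {z \<in> cball 0 1. DiscPt a z \<in> T}"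
    for a by auto
  show "pre_open g (S \<inter> T)"
    using S T unfolding pre_open_def e2 d2 by (auto intro!: openin_Int)
next
  fix K :: "('o, 'a, 'c) precell set set"
  assume K: "\<forall>S\<in>K. pre_open g S"
  have e: "{p \<in> {0..1}. EdgePt a p \<in> \<Union>K} = \<Union>((\<lambda>U. {p \<in> {0..1}. EdgePt a p \<in> U}) ` K)"
    for a by auto
  have d: "{z \<in> cball 0 1. DiscPt a z \<in> \<Union>K} = \<Union>((\<lambda>U. {z \<in> cball 0 1. DiscPt a z \<in> U}) ` K)"
    for a by auto
  show "pre_open g (\<Union>K)"
    using K unfolding pre_open_def e d by (auto intro!: openin_Union)
qed

definition pre_top :: "('o, 'a, 'c) computad \<Rightarrow> ('o, 'a, 'c) precell topology" where
  "pre_top g = topology (pre_open g)"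

text \<open>The path of a word starting at object x, as a map [0,1] \<rightarrow> pre-space: on
  [n/m, (n+1)/m] it traverses the n-th letter (forwards for arrows, backwards for inverses);
  the empty word gives the constant path at x.\<close>
definition word_path :: "'o \<Rightarrow> ('a \<times> bool) list \<Rightarrow> real \<Rightarrow> ('o, 'a, 'c) precell" where
  "word_path x w \<tau> =
     (if w = [] then Vert x
      else let m = length w; n = min (nat \<lfloor>real m * \<tau>\<rfloor>) (m - 1);
               u = real m * \<tau> - real n; l = w ! n
           in EdgePt (fst l) (if snd l then u else 1 - u))"

text \<open>Gluing relation: edge endpoints to their domain/codomain; the upper boundary semicircle
  of the disc of \<alpha>, traversed from (-1,0) to (1,0), along the path of \<open>s(\<alpha>)\<close>, the lower one
  along the path of \<open>t(\<alpha>)\<close>.  The point (x, y) of the unit circle corresponds to the path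
  parameter \<open>arccos(-x)/\<pi>\<close>.\<close>
definition glue :: "('o, 'a, 'c) computad \<Rightarrow> (('o, 'a, 'c) precell \<times> ('o, 'a, 'c) precell) set" where
  "glue g =
     {(EdgePt a 0, Vert (gdom g a)) | a. a \<in> Arr g} \<union>
     {(EdgePt a 1, Vert (gcod g a)) | a. a \<in> Arr g} \<union>
     {(DiscPt \<alpha> (x, y), word_path (fsrc (csrc g \<alpha>)) (fst (snd (csrc g \<alpha>))) (arccos (- x) / pi))
        | \<alpha> x y. \<alpha> \<in> Cells g \<and> norm (x, y) = 1 \<and> y \<ge> 0} \<union>
     {(DiscPt \<alpha> (x, y), word_path (fsrc (ctgt g \<alpha>)) (fst (snd (ctgt g \<alpha>))) (arccos (- x) / pi))
        | \<alpha> x y. \<alpha> \<in> Cells g \<and> norm (x, y) = 1 \<and> y \<le> 0}"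

text \<open>Quotient topology of X by an equivalence relation R (points are the equivalence classes).\<close>
definition quot_open :: "'x topology \<Rightarrow> ('x \<times> 'x) set \<Rightarrow> 'x set set \<Rightarrow> bool" where
  "quot_open X R U \<longleftrightarrow> U \<subseteq> (\<lambda>x. R `` {x}) ` topspace X \<and>
      openin X {x \<in> topspace X. R `` {x} \<in> U}"

lemma istopology_quot_open: "istopology (quot_open X R)"
  unfolding istopology_def
proof (intro conjI allI impI ballI)
  fix S T assume S: "quot_open X R S" and T: "quot_open X R T"
  have i: "{x \<in> topspace X. R `` {x} \<in> S \<inter> T} =
           {x \<in> topspace X. R `` {x} \<in> S} \<inter> {x \<in> topspace X. R `` {x} \<in> T}" by auto
  show "quot_open X R (S \<inter> T)"
    using S T unfolding quot_open_def i by (auto intro!: openin_Int)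
next
  fix K assume K: "\<forall>S\<in>K. quot_open X R S"
  have u: "{x \<in> topspace X. R `` {x} \<in> \<Union>K} = \<Union>((\<lambda>U. {x \<in> topspace X. R `` {x} \<in> U}) ` K)"
    by auto
  show "quot_open X R (\<Union>K)"
    using K unfolding quot_open_def u by (auto intro!: openin_Union)
qed

definition quot_top :: "'x topology \<Rightarrow> ('x \<times> 'x) set \<Rightarrow> 'x set topology" where
  "quot_top X R = topology (quot_open X R)"

text \<open>The 2-dimensional CW-complex \<open>F^Gr_Top2(g)\<close>: quotient of the disjoint union by the
  equivalence relation generated by the gluing.\<close>
definition realization :: "('o, 'a, 'c) computad \<Rightarrow> ('o, 'a, 'c) precell set topology" where
  "realization g = quot_top (pre_top g) ((glue g \<union> (glue g)\<inverse>)\<^sup>*)"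

section \<open>Real singular cohomology and Euler characteristic\<close>

type_synonym 'x cochain = "((nat \<Rightarrow> real) \<Rightarrow> 'x) \<Rightarrow> real"

definition cochains :: "nat \<Rightarrow> 'x topology \<Rightarrow> 'x cochain set" where
  "cochains p X = {\<phi>. \<forall>\<sigma>. \<not> singular_simplex p X \<sigma> \<longrightarrow> \<phi> \<sigma> = 0}"

definition coboundary :: "nat \<Rightarrow> 'x topology \<Rightarrow> 'x cochain \<Rightarrow> 'x cochain" where
  "coboundary p X \<phi> = (\<lambda>\<sigma>. if singular_simplex (Suc p) X \<sigma>
       then (\<Sum>k\<le>Suc p. (-1) ^ k * \<phi> (singular_face (Suc p) k \<sigma>)) else 0)"

definition cocycles :: "nat \<Rightarrow> 'x topology \<Rightarrow> 'x cochain set" where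
  "cocycles p X = {\<phi> \<in> cochains p X. coboundary p X \<phi> = (\<lambda>_. 0)}"

definition coboundaries :: "nat \<Rightarrow> 'x topology \<Rightarrow> 'x cochain set" where
  "coboundaries p X = (if p = 0 then {\<lambda>_. 0}
                       else coboundary (p - 1) X ` cochains (p - 1) X)"

text \<open>\<open>dim_R H^p(X;R) = n\<close>: the quotient vector space cocycles/coboundaries has a basis of
  n elements.\<close>
definition cohom_dim :: "'x topology \<Rightarrow> nat \<Rightarrow> nat \<Rightarrow> bool" where
  "cohom_dim X p n \<longleftrightarrow> (\<exists>v :: nat \<Rightarrow> 'x cochain.
      (\<forall>i<n. v i \<in> cocycles p X) \<and>
      (\<forall>c :: nat \<Rightarrow> real. (\<lambda>\<sigma>. \<Sum>i<n. c i * v i \<sigma>) \<in> coboundaries p X \<longrightarrow> (\<forall>i<n. c i = 0)) \<and>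
      (\<forall>z \<in> cocycles p X. \<exists>c :: nat \<Rightarrow> real.
          (\<lambda>\<sigma>. z \<sigma> - (\<Sum>i<n. c i * v i \<sigma>)) \<in> coboundaries p X))"

text \<open>The Euler characteristic of X is defined and equals c.\<close>
definition euler_char :: "'x topology \<Rightarrow> int \<Rightarrow> bool" where
  "euler_char X c \<longleftrightarrow> (\<exists>N (d :: nat \<Rightarrow> nat).
      (\<forall>i. cohom_dim X i (d i)) \<and> (\<forall>i>N. d i = 0) \<and>
      c = (\<Sum>i\<le>N. (-1) ^ i * int (d i)))"

end

theory Submission
  imports Defs
begin

text \<open>If the presented groupoid is thin, then the realization \<open>X\<close> has \<open>H^i(X; R) = 0\<close> for all odd \<open>i\<close>,
  so its Euler characteristic is at least \<open>dim H^0 \<ge> 1\<close>.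

  For \<open>i \<ge> 3\<close>, cover \<open>X\<close> by the open discs and the complement of the disc centres; the latter
  retracts radially onto the graph, which in turn is covered by the open edges and the complement of
  the edge midpoints, and that complement retracts onto the vertices.  Mayer-Vietoris gives
  \<open>H_i(X; Z) = 0\<close>, and real cohomology vanishes with it because the reals are a divisible group.

  For \<open>i = 1\<close>, integrating a cocycle along edges defines a functor from the free groupoid to the reals.
  The discs make it factor through the presented groupoid, so by thinness it is the difference of a
  potential on vertices.  The potential extends to the edges and discs by integration along straight
  segments, and the same two retractions show that the cocycle is its coboundary.\<close>

section \<open>Acyclicity of spaces\<close>

text \<open>The sets of objects, arrows and cells are arbitrary, so cells cannot simply be counted:
  the Euler characteristic is bounded through odd cohomology alone, since \<open>H^2\<close> can
  only raise it. The complex carries a quotient topology and need not be locally finite, so every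
  deformation is first written on the disjoint union and then descends. The graph is treated as a
  computad without 2-cells, with its own realization, because an open edge need not be open in the
  complex: boundaries of discs may run through it. A retraction onto this graph and a map back
  suffice, so the graph never has to be shown to embed.

  In degree 1, thinness is a statement about words, not about singular cycles; this is why the
  cocycle is integrated directly along words. A 0-cochain is an arbitrary function on points, so
  continuity of the potential is no issue: only its increments along paths matter. They are checked
  locally and added up by bisecting the parameter interval.\<close>

definition acyclic_in :: "nat \<Rightarrow> 'x topology \<Rightarrow> bool" where
  "acyclic_in n X \<longleftrightarrow> (\<forall>c. singular_relcycle n X {} c \<longrightarrow> singular_relboundary n X {} c)"

lemma acyclic_in_empty: "topspace X = {} \<Longrightarrow> acyclic_in n X"
  by (auto simp: acyclic_in_def singular_cycle singular_chain_empty)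

text \<open>One composite suffices: a cycle \<open>c\<close> is homologous to its image under
  \<open>g \<circ> f\<close>, and that image bounds because it is pushed forward from a cycle of
  \<open>Y\<close>.\<close>

lemma acyclic_in_dominated:
  assumes f: "continuous_map X Y f" and g: "continuous_map Y X g"
    and hom: "homotopic_with (\<lambda>_. True) X X (g \<circ> f) id"
    and Y: "acyclic_in n Y"
  shows "acyclic_in n X"
  unfolding acyclic_in_def
proof (intro allI impI)
  fix c assume c: "singular_relcycle n X {} c"
  have "singular_relcycle n Y {} (chain_map n f c)"
    using singular_relcycle_chain_map[OF c f] by auto
  then have "singular_relboundary n Y {} (chain_map n f c)"
    using Y by (auto simp: acyclic_in_def)
  then have "singular_relboundary n X {} (chain_map n g (chain_map n f c))"
    using singular_relboundary_chain_map[OF _ g] by fastforce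
  then have 1: "singular_relboundary n X {} (chain_map n (g \<circ> f) c)"
    by (simp add: chain_map_compose)
  have "homologous_rel n X {} (chain_map n (g \<circ> f) c) (chain_map n id c)"
    by (rule homotopic_imp_homologous_rel_chain_maps[OF _ c]) (use hom in auto)
  moreover have "chain_map n id c = c"
    using c by (auto simp: singular_cycle chain_map_ident)
  ultimately have "singular_relboundary n X {} (chain_map n (g \<circ> f) c - c)"
    by (simp add: homologous_rel_def)
  from singular_relboundary_diff[OF 1 this]
  show "singular_relboundary n X {} c" by simp
qed

lemma acyclic_in_singleton:
  assumes "topspace X = {a}" "1 \<le> n"
  shows "acyclic_in n X"
  using singular_boundary_eq_cycle_singleton[OF assms] by (auto simp: acyclic_in_def)

lemma acyclic_in_homeomorphic:
  assumes "X homeomorphic_space Y" "acyclic_in n Y"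
  shows "acyclic_in n X"
proof -
  obtain f g where fg: "homeomorphic_maps X Y f g"
    using assms homeomorphic_space_def by blast
  have "homotopic_with (\<lambda>_. True) X X (g \<circ> f) id"
  proof (rule homotopic_with_equal)
    show "continuous_map X X (g \<circ> f)"
      using fg by (meson continuous_map_compose homeomorphic_maps_def)
  qed (use fg in \<open>auto simp: homeomorphic_maps_def\<close>)
  with fg assms(2) show ?thesis
    by (intro acyclic_in_dominated[of X Y f g]) (auto simp: homeomorphic_maps_def)
qed

lemma acyclic_in_starlike:
  fixes S :: "'a::real_normed_vector set"
  assumes "starlike S" "1 \<le> n"
  shows "acyclic_in n (top_of_set S)"
proof -
  have "contractible S" by (simp add: assms(1) starlike_imp_contractible)
  then obtain a where a: "homotopic_with_canon (\<lambda>_. True) S S id (\<lambda>_. a)"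
    by (auto simp: contractible_def)
  have "S \<noteq> {}" using assms(1) by (auto simp: starlike_def)
  then have aS: "a \<in> S"
    using homotopic_with_imp_subset2[OF a] by auto
  show ?thesis
  proof (rule acyclic_in_dominated)
    show "continuous_map (top_of_set S) (top_of_set {a}) (\<lambda>_. a)" by simp
    show "continuous_map (top_of_set {a}) (top_of_set S) (\<lambda>_. a)" using aS by simp
    show "homotopic_with (\<lambda>_. True) (top_of_set S) (top_of_set S) ((\<lambda>_. a) \<circ> (\<lambda>_. a)) id"
      using a by (simp add: homotopic_with_symD comp_def)
    show "acyclic_in n (top_of_set {a})"
      by (rule acyclic_in_singleton[OF _ assms(2)]) auto
  qed
qed

section \<open>Mayer-Vietoris and disjoint unions\<close>

lemma chain_split:
  assumes "singular_chain n X c"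
    and "\<And>f. f \<in> Poly_Mapping.keys c \<Longrightarrow> f ` standard_simplex n \<subseteq> A \<or> f ` standard_simplex n \<subseteq> B"
  obtains a b where "c = a + b" "singular_chain n (subtopology X A) a" "singular_chain n (subtopology X B) b"
proof -
  have split: "\<exists>a b. c = a + b \<and> singular_chain n (subtopology X A) a \<and> singular_chain n (subtopology X B) b"
    if "Poly_Mapping.keys c \<subseteq> {f. singular_simplex n X f \<and>
          (f ` standard_simplex n \<subseteq> A \<or> f ` standard_simplex n \<subseteq> B)}" for c
    using that
  proof (induction c rule: frag_induction)
    case zero
    then show ?case by (metis add_0 singular_chain_0)
  next
    case (one x)
    then show ?case
      by (metis (no_types, lifting) add.right_neutral add_0 mem_Collect_eq singular_chain_0
          singular_chain_of singular_simplex_subtopology)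
  next
    case (diff a b)
    then obtain a1 a2 b1 b2 where "a = a1 + a2" "b = b1 + b2"
      "singular_chain n (subtopology X A) a1" "singular_chain n (subtopology X B) a2"
      "singular_chain n (subtopology X A) b1" "singular_chain n (subtopology X B) b2"
      by metis
    then show ?case
      by (intro exI[of _ "a1 - b1"] exI[of _ "a2 - b2"]) (auto simp: singular_chain_diff)
  qed
  have "Poly_Mapping.keys c \<subseteq> {f. singular_simplex n X f \<and>
          (f ` standard_simplex n \<subseteq> A \<or> f ` standard_simplex n \<subseteq> B)}"
    using assms(2) assms(1)[unfolded singular_chain_def] by fast
  from split[OF this] show thesis
    using that by metis
qed

text \<open>The segment of the Mayer-Vietoris sequence around \<open>H_n(X)\<close>, done on chains.
  Homology here is unreduced, so for \<open>n = 1\<close> the hypothesis on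
  \<open>A \<inter> B\<close> in degree 0 amounts to \<open>A \<inter> B\<close> being
  empty.\<close>

lemma acyclic_in_Mayer_Vietoris:
  assumes A: "openin X A" and B: "openin X B" and AB: "topspace X = A \<union> B"
    and acA: "acyclic_in n (subtopology X A)" and acB: "acyclic_in n (subtopology X B)"
    and acAB: "acyclic_in (n - 1) (subtopology X (A \<inter> B))" and n: "1 \<le> n"
  shows "acyclic_in n X"
  unfolding acyclic_in_def
proof (intro allI impI)
  fix c assume c: "singular_relcycle n X {} c"
  \<comment> \<open>Subdivision: a homologous cycle whose simplices each lie in \<open>A\<close> or
    in \<open>B\<close>.\<close>
  obtain c' where c': "singular_relcycle n X {} c'" "homologous_rel n X {} c c'"
     "\<And>f. f \<in> Poly_Mapping.keys c' \<Longrightarrow> \<exists>V \<in> {A,B}. f \<in> (standard_simplex n) \<rightarrow> V"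
    by (rule small_homologous_rel_relcycle_exists[of "{A,B}" X n "{}" c])
      (use A B AB c in auto)
  obtain a b where ab: "c' = a + b" and a: "singular_chain n (subtopology X A) a"
    and b: "singular_chain n (subtopology X B) b"
    by (rule chain_split[of n X c' A B]) (use c' in \<open>force simp: singular_cycle\<close>)+
  have ab0: "chain_boundary n a + chain_boundary n b = 0"
    using c'(1) by (simp add: singular_cycle ab chain_boundary_add)
  have ba: "singular_chain (n-1) (subtopology X A) (chain_boundary n a)"
    using singular_chain_boundary[OF a] by simp
  have bb: "singular_chain (n-1) (subtopology X B) (chain_boundary n b)"
    using singular_chain_boundary[OF b] by simp
  have "chain_boundary n a = - chain_boundary n b"
    using ab0 by (simp add: eq_neg_iff_add_eq_0)
  then have "singular_chain (n-1) (subtopology X B) (chain_boundary n a)"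
    using bb singular_chain_minus by metis
  with ba have "singular_chain (n-1) (subtopology X (A \<inter> B)) (chain_boundary n a)"
    by (auto simp: singular_chain_subtopology)
  moreover have "chain_boundary (n-1) (chain_boundary n a) = 0"
    using chain_boundary_boundary[OF a] by simp
  ultimately have "singular_relcycle (n-1) (subtopology X (A \<inter> B)) {} (chain_boundary n a)"
    by (simp add: singular_cycle)
  then have "singular_relboundary (n-1) (subtopology X (A \<inter> B)) {} (chain_boundary n a)"
    using acAB by (auto simp: acyclic_in_def)
  \<comment> \<open>\<open>e\<close> fills the common boundary of \<open>a\<close> and
    \<open>- b\<close> inside the intersection, so \<open>a - e\<close> and \<open>b + e\<close> are
    cycles in \<open>A\<close> and \<open>B\<close> with sum \<open>c'\<close>.\<close>
  then obtain e where e: "singular_chain n (subtopology X (A \<inter> B)) e" "chain_boundary n e = chain_boundary n a"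
    using n by (auto simp: singular_boundary)
  have eA: "singular_chain n (subtopology X A) e" and eB: "singular_chain n (subtopology X B) e"
    using e(1) by (auto simp: singular_chain_subtopology)
  have "singular_relboundary n (subtopology X A) {} (a - e)"
    using acA a eA e(2) by (simp add: acyclic_in_def singular_cycle chain_boundary_diff singular_chain_diff)
  then have 1: "singular_relboundary n X {} (a - e)"
    using singular_boundary_mono[of A "topspace X"] by (metis AB subtopology_topspace sup_ge1)
  have "singular_relboundary n (subtopology X B) {} (b + e)"
    using acB b eB e(2) ab0
    by (simp add: acyclic_in_def singular_cycle chain_boundary_add singular_chain_add add.commute)
  then have 2: "singular_relboundary n X {} (b + e)"
    using singular_boundary_mono[of B "topspace X"] by (metis AB subtopology_topspace sup_ge2)
  have "singular_relboundary n X {} c'"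
    using singular_relboundary_add[OF 1 2] by (simp add: ab)
  from singular_relboundary_add[OF this] c'(2) show "singular_relboundary n X {} c"
    by (fastforce simp: homologous_rel_def)
qed

text \<open>Induction by Mayer-Vietoris; the intersections are empty and hence acyclic in every
  degree, including 0.\<close>

lemma acyclic_in_finite_disjoint_Union:
  assumes "finite \<U>" "\<And>U. U \<in> \<U> \<Longrightarrow> openin X U" "pairwise disjnt \<U>"
    "\<And>U. U \<in> \<U> \<Longrightarrow> acyclic_in n (subtopology X U)" "1 \<le> n"
  shows "acyclic_in n (subtopology X (\<Union>\<U>))"
  using assms(1-4)
proof (induction \<U> rule: finite_induct)
  case empty
  then show ?case by (simp add: acyclic_in_empty)
next
  case (insert U \<U>)
  have sub: "subtopology (subtopology X (\<Union>(insert U \<U>))) V = subtopology X V"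
    if "V \<subseteq> \<Union>(insert U \<U>)" for V
    using that by (simp add: inf.absorb2 subtopology_subtopology)
  have op: "openin (subtopology X (\<Union>(insert U \<U>))) V" if "openin X V" "V \<subseteq> \<Union>(insert U \<U>)" for V
    using that by (metis inf.absorb1 openin_subtopology)
  show ?case
  proof (rule acyclic_in_Mayer_Vietoris[of _ U "\<Union>\<U>"])
    show "openin (subtopology X (\<Union>(insert U \<U>))) U"
      "openin (subtopology X (\<Union>(insert U \<U>))) (\<Union>\<U>)"
      using insert.prems(1) by (blast intro: op)+
    show "topspace (subtopology X (\<Union> (insert U \<U>))) = U \<union> \<Union> \<U>"
      using insert.prems(1) openin_subset by fastforce
    have dU: "disjnt U V" if "V \<in> \<U>" for V
      using insert.prems(2) insert.hyps(2) that by (metis insertCI pairwiseD)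
    then have "U \<inter> \<Union>\<U> = {}"
      unfolding disjnt_def by blast
    then show "acyclic_in (n-1) (subtopology (subtopology X (\<Union> (insert U \<U>))) (U \<inter> \<Union> \<U>))"
      by (simp add: acyclic_in_empty)
    show "acyclic_in n (subtopology (subtopology X (\<Union> (insert U \<U>))) U)"
      using insert.prems(3) by (subst sub) simp_all
    have "pairwise disjnt \<U>"
      using insert.prems(2) by (meson pairwise_subset subset_insertI)
    then have "acyclic_in n (subtopology X (\<Union>\<U>))"
      using insert.IH insert.prems(1,3) by blast
    then show "acyclic_in n (subtopology (subtopology X (\<Union> (insert U \<U>))) (\<Union> \<U>))"
      by (subst sub) simp_all
  qed (use assms in auto)
qed

text \<open>A chain has finitely many simplices, and each of them has connected image and so lies in
  a single piece. This reduces any cycle to a finite subfamily.\<close>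

lemma acyclic_in_disjoint_Union:
  assumes op: "\<And>U. U \<in> \<U> \<Longrightarrow> openin X U" and disj: "pairwise disjnt \<U>"
    and ac: "\<And>U. U \<in> \<U> \<Longrightarrow> acyclic_in n (subtopology X U)" and n: "1 \<le> n"
  shows "acyclic_in n (subtopology X (\<Union>\<U>))"
  unfolding acyclic_in_def
proof (intro allI impI)
  fix c assume "singular_relcycle n (subtopology X (\<Union>\<U>)) {} c"
  then have c: "singular_chain n (subtopology X (\<Union>\<U>)) c" "chain_boundary n c = 0"
    by (auto simp: singular_cycle)
  have ex: "\<exists>U\<in>\<U>. f ` standard_simplex n \<subseteq> U" if f: "f \<in> Poly_Mapping.keys c" for f
  proof -
    have s: "singular_simplex n (subtopology X (\<Union>\<U>)) f"
      using c(1) f by (auto simp: singular_chain_def)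
    then have fsub: "f ` standard_simplex n \<subseteq> \<Union>\<U>" and
      cf: "continuous_map (subtopology (powertop_real UNIV) (standard_simplex n)) X f"
      unfolding singular_simplex_subtopology by (auto simp: singular_simplex_def)
    have conn: "connectedin X (f ` standard_simplex n)"
      by (rule connectedin_continuous_map_image[OF cf])
        (simp add: connectedin_subtopology connectedin_standard_simplex)
    obtain p where p: "p \<in> standard_simplex n" using nonempty_standard_simplex by blast
    with fsub obtain U where U: "U \<in> \<U>" "f p \<in> U" by blast
    \<comment> \<open>\<open>U\<close> and the union \<open>?W\<close> of all other pieces would
      separate the connected image of the simplex.\<close>
    let ?W = "\<Union>(\<U> - {U})"
    have "f ` standard_simplex n \<subseteq> U"
    proof (rule ccontr)
      assume "\<not> ?thesis"
      then have "?W \<inter> f ` standard_simplex n \<noteq> {}" using fsub by blast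
      moreover have "U \<inter> f ` standard_simplex n \<noteq> {}" using U p by blast
      moreover have "f ` standard_simplex n \<subseteq> U \<union> ?W" using fsub U by blast
      moreover have "U \<inter> ?W \<inter> f ` standard_simplex n = {}"
        using disj U by (auto simp: pairwise_def disjnt_def)
      moreover have "openin X U" "openin X ?W" using op U by auto
      ultimately show False using conn unfolding connectedin by blast
    qed
    with U show ?thesis by blast
  qed
  then obtain u where u: "\<And>f. f \<in> Poly_Mapping.keys c \<Longrightarrow> u f \<in> \<U> \<and> f ` standard_simplex n \<subseteq> u f"
    by metis
  let ?F = "u ` Poly_Mapping.keys c"
  have sub: "?F \<subseteq> \<U>" using u by blast
  have "singular_chain n (subtopology X (\<Union>?F)) c"
    using c(1) u by (fastforce simp: singular_chain_subtopology)
  then have "singular_relcycle n (subtopology X (\<Union>?F)) {} c"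
    using c(2) by (simp add: singular_cycle)
  moreover have "acyclic_in n (subtopology X (\<Union>?F))"
    by (rule acyclic_in_finite_disjoint_Union)
      (use op disj ac n sub in \<open>auto intro: pairwise_subset\<close>)
  ultimately have "singular_relboundary n (subtopology X (\<Union>?F)) {} c"
    by (auto simp: acyclic_in_def)
  then show "singular_relboundary n (subtopology X (\<Union>\<U>)) {} c"
    using singular_boundary_mono[OF Union_mono[OF sub]] by blast
qed

section \<open>Vanishing of real cohomology\<close>

text \<open>The Kronecker pairing: a real cochain extended additively to integral chains.\<close>

definition cpair :: "('b \<Rightarrow> real) \<Rightarrow> ('b \<Rightarrow>\<^sub>0 int) \<Rightarrow> real" where
  "cpair \<phi> c = (\<Sum>\<sigma>\<in>Poly_Mapping.keys c. of_int (Poly_Mapping.lookup c \<sigma>) * \<phi> \<sigma>)"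

lemma cpair_superset:
  assumes "finite K" "Poly_Mapping.keys c \<subseteq> K"
  shows "cpair \<phi> c = (\<Sum>\<sigma>\<in>K. of_int (Poly_Mapping.lookup c \<sigma>) * \<phi> \<sigma>)"
  unfolding cpair_def
  by (rule sum.mono_neutral_left) (use assms in \<open>auto simp: in_keys_iff\<close>)

lemma cpair_0 [simp]: "cpair \<phi> 0 = 0"
  by (simp add: cpair_def)

lemma cpair_of [simp]: "cpair \<phi> (frag_of \<sigma>) = \<phi> \<sigma>"
  by (simp add: cpair_def)

lemma cpair_add: "cpair \<phi> (a + b) = cpair \<phi> a + cpair \<phi> b"
proof -
  let ?K = "Poly_Mapping.keys a \<union> Poly_Mapping.keys b"
  have "Poly_Mapping.keys (a + b) \<subseteq> ?K" by (rule keys_add)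
  then show ?thesis
    by (simp add: cpair_superset[of ?K] lookup_add distrib_right sum.distrib)
qed

lemma additive_cpair: "Modules.additive (cpair \<phi>)"
  by (simp add: Modules.additive_def cpair_add)

lemmas cpair_diff = Modules.additive.diff[OF additive_cpair]
  and cpair_sum = Modules.additive.sum[OF additive_cpair]

lemma additive_frag_cmul:
  fixes h :: "('b \<Rightarrow>\<^sub>0 int) \<Rightarrow> real"
  assumes "Modules.additive h"
  shows "h (frag_cmul k c) = of_int k * h c"
proof -
  have N: "h (frag_cmul (int n) c) = real n * h c" for n
    by (induction n)
      (simp_all add: frag_cmul_distrib Modules.additive.add[OF assms] Modules.additive.zero[OF assms] distrib_right)
  show ?thesis
  proof (cases "k \<ge> 0")
    case True
    then show ?thesis using N[of "nat k"] by simp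
  next
    case False
    then have eq: "frag_cmul k c = - frag_cmul (int (nat (- k))) c" by simp
    show ?thesis unfolding eq
      using False N[of "nat (-k)"] by (simp only: Modules.additive.minus[OF assms]) simp
  qed
qed

text \<open>The reals are a divisible, hence injective, abelian group.\<close>

lemma additive_extension:
  fixes S :: "(('b \<Rightarrow>\<^sub>0 int) \<times> real) set"
  assumes S0: "0 \<in> S" and Sd: "\<And>x y. x \<in> S \<Longrightarrow> y \<in> S \<Longrightarrow> x - y \<in> S"
    and fn: "\<And>r. (0, r) \<in> S \<Longrightarrow> r = 0"
  obtains h where "Modules.additive h" "\<And>a r. (a, r) \<in> S \<Longrightarrow> h a = r"
proof -
  \<comment> \<open>Subgroups of the product containing \<open>S\<close> that are graphs of partial
    homomorphisms: single-valuedness of a subgroup only has to be asked at 0. Zorn's lemma yields a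
    maximal one, \<open>M\<close>.\<close>
  define \<A> where "\<A> = {M. S \<subseteq> M \<and> (\<forall>x\<in>M. \<forall>y\<in>M. x - y \<in> M) \<and> (\<forall>r. (0, r) \<in> M \<longrightarrow> r = 0)}"
  have "\<exists>M\<in>\<A>. \<forall>X\<in>\<A>. M \<subseteq> X \<longrightarrow> X = M"
  proof (rule subset_Zorn_nonempty)
    have "S \<in> \<A>" using assms by (auto simp: \<A>_def)
    then show "\<A> \<noteq> {}" by blast
  next
    fix \<C> assume ne: "\<C> \<noteq> {}" and ch: "subset.chain \<A> \<C>"
    have sub: "\<C> \<subseteq> \<A>" using ch by (auto simp: subset.chain_def)
    have "x - y \<in> \<Union>\<C>" if x: "x \<in> \<Union>\<C>" and y: "y \<in> \<Union>\<C>" for x y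
    proof -
      obtain A B where AB: "A \<in> \<C>" "x \<in> A" "B \<in> \<C>" "y \<in> B" using x y by blast
      then have "A \<subseteq> B \<or> B \<subseteq> A" using ch by (auto simp: subset_chain_def)
      then obtain C where "C \<in> \<C>" "x \<in> C" "y \<in> C" using AB by blast
      then show ?thesis using sub by (auto simp: \<A>_def)
    qed
    moreover have "S \<subseteq> \<Union>\<C>" using ne sub by (fastforce simp: \<A>_def)
    moreover have "r = 0" if "(0, r) \<in> \<Union>\<C>" for r using that sub by (auto simp: \<A>_def)
    ultimately show "\<Union>\<C> \<in> \<A>" by (simp add: \<A>_def)
  qed
  then obtain M where M: "M \<in> \<A>" and max: "\<And>X. X \<in> \<A> \<Longrightarrow> M \<subseteq> X \<Longrightarrow> X = M" by blast
  have MS: "S \<subseteq> M" and Md: "\<And>x y. x \<in> M \<Longrightarrow> y \<in> M \<Longrightarrow> x - y \<in> M"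
    and Mf: "\<And>r. (0, r) \<in> M \<Longrightarrow> r = 0" using M by (auto simp: \<A>_def)
  have M0: "(0,0) \<in> M" using MS S0 by (auto simp: zero_prod_def)
  have Mm: "- x \<in> M" if "x \<in> M" for x using Md[OF M0 that] by (cases x) simp
  have Ma: "x + y \<in> M" if "x \<in> M" "y \<in> M" for x y
    using Md[OF that(1) Mm[OF that(2)]] by simp
  have MN: "(frag_cmul (int n) a, real n * r) \<in> M" if "(a, r) \<in> M" for n a r
    by (induction n) (use M0 Ma[OF that] in \<open>auto simp: frag_cmul_distrib distrib_right\<close>)
  have MZ: "(frag_cmul k a, of_int k * r) \<in> M" if "(a, r) \<in> M" for k a r
  proof (cases "k \<ge> 0")
    case True
    then show ?thesis using MN[OF that, of "nat k"] by simp
  next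
    case False
    then show ?thesis using Mm[OF MN[OF that, of "nat (-k)"]] by simp
  qed
  have Mu: "r = s" if "(a, r) \<in> M" "(a, s) \<in> M" for a r s
    using Mf[of "r - s"] Md[OF that] by simp
  have tot: "\<exists>r. (a, r) \<in> M" for a
  proof -
    \<comment> \<open>\<open>v\<close> is a value for \<open>a\<close> compatible with
      \<open>M\<close>. If some nonzero multiple \<open>n\<close> of \<open>a\<close> already has a
      value \<open>r\<close>, then \<open>v\<close> is \<open>r / n\<close>, which is where
      divisibility enters; otherwise 0 will do.\<close>
    have "\<exists>v. \<forall>n r. (frag_cmul n a, r) \<in> M \<longrightarrow> r = of_int n * v"
    proof (cases "\<exists>n r. n \<noteq> 0 \<and> (frag_cmul n a, r) \<in> M")
      case True
      then obtain n r where nr: "n \<noteq> 0" "(frag_cmul n a, r) \<in> M" by blast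
      have "s = of_int m * (r / of_int n)" if ms: "(frag_cmul m a, s) \<in> M" for m s
      proof -
        have "(frag_cmul (m * n) a, of_int m * r) \<in> M" using MZ[OF nr(2), of m] by simp
        moreover have "(frag_cmul (m * n) a, of_int n * s) \<in> M"
          using MZ[OF ms, of n] by (simp add: mult.commute)
        ultimately have "of_int m * r = of_int n * s" by (rule Mu)
        then show ?thesis using nr(1) by (simp add: field_simps)
      qed
      then show ?thesis by blast
    next
      case False
      then have "n = 0" if "(frag_cmul n a, r) \<in> M" for n r using that by blast
      then show ?thesis using Mf by (intro exI[of _ 0]) force
    qed
    then obtain v where v: "\<And>n r. (frag_cmul n a, r) \<in> M \<Longrightarrow> r = of_int n * v" by blast
    \<comment> \<open>The subgroup generated by \<open>M\<close> and \<open>(a, v)\<close>. The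
      choice of \<open>v\<close> keeps it single-valued, so maximality puts \<open>(a, v)\<close>
      into \<open>M\<close>.\<close>
    define N where "N = {(b + frag_cmul k a, s + of_int k * v) | b s k. (b, s) \<in> M}"
    have MN': "M \<subseteq> N"
    proof
      fix x assume "x \<in> M"
      then show "x \<in> N" unfolding N_def
        by (cases x) (force intro: exI[of _ 0])
    qed
    have "x - y \<in> N" if x: "x \<in> N" and y: "y \<in> N" for x y
    proof -
      obtain b s k where 1: "x = (b + frag_cmul k a, s + of_int k * v)" "(b, s) \<in> M"
        using x by (auto simp: N_def)
      obtain b' s' k' where 2: "y = (b' + frag_cmul k' a, s' + of_int k' * v)" "(b', s') \<in> M"
        using y by (auto simp: N_def)
      have "frag_cmul (k - k') a + frag_cmul k' a = frag_cmul k a"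
        by (simp flip: frag_cmul_distrib)
      then have "x - y = ((b - b') + frag_cmul (k - k') a, (s - s') + of_int (k - k') * v)"
        by (simp add: 1 2 algebra_simps)
      moreover have "(b - b', s - s') \<in> M" using Md[OF 1(2) 2(2)] by simp
      ultimately show ?thesis unfolding N_def by blast
    qed
    moreover have "r = 0" if r: "(0, r) \<in> N" for r
    proof -
      obtain b s k where bs: "(0, r) = (b + frag_cmul k a, s + of_int k * v)" "(b, s) \<in> M"
        using r unfolding N_def by blast
      then have 1: "b + frag_cmul k a = 0" "r = s + of_int k * v" "(b, s) \<in> M"
        by simp_all
      then have "b = - frag_cmul k a" by (simp only: eq_neg_iff_add_eq_0)
      then have "(frag_cmul (- k) a, s) \<in> M" using 1 by simp
      from v[OF this] show ?thesis using 1 by simp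
    qed
    ultimately have "N \<in> \<A>" using MN' MS by (auto simp: \<A>_def)
    from max[OF this MN'] have "N = M" .
    moreover have "(0 + frag_cmul 1 a, 0 + of_int 1 * v) \<in> N"
      unfolding N_def using M0 by blast
    ultimately show ?thesis by auto
  qed
  then obtain h where h: "\<And>a. (a, h a) \<in> M" by metis
  have "Modules.additive h"
  proof
    fix x y show "h (x + y) = h x + h y"
      using Mu[OF h[of "x+y"]] Ma[OF h[of x] h[of y]] by simp
  qed
  moreover have "h a = r" if "(a, r) \<in> S" for a r
    using Mu h MS that by blast
  ultimately show thesis using that by blast
qed

section \<open>From integral homology to real cohomology\<close>

lemma coboundary_eq_cpair:
  assumes "singular_simplex (Suc p) X \<sigma>"
  shows "coboundary p X \<phi> \<sigma> = cpair \<phi> (chain_boundary (Suc p) (frag_of \<sigma>))"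
  using assms
  by (simp add: coboundary_def chain_boundary_of cpair_sum additive_frag_cmul[OF additive_cpair]
      del: sum.atMost_Suc)

lemma cocycle_cpair_boundary:
  assumes \<phi>: "\<phi> \<in> cocycles p X" and d: "singular_chain (Suc p) X d"
  shows "cpair \<phi> (chain_boundary (Suc p) d) = 0"
  using d unfolding singular_chain_def
proof (induction d rule: frag_induction)
  case (one \<sigma>)
  then have "cpair \<phi> (chain_boundary (Suc p) (frag_of \<sigma>)) = coboundary p X \<phi> \<sigma>"
    by (simp add: coboundary_eq_cpair)
  then show ?case using \<phi> by (simp add: cocycles_def)
qed (auto simp: chain_boundary_diff cpair_diff)

text \<open>Sending the boundary of \<open>c\<close> to the value of \<open>\<phi>\<close> on
  \<open>c\<close> is well defined on boundaries: two fillings differ by a cycle, which bounds by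
  acyclicity, and a cocycle kills boundaries. Extending this homomorphism to all chains gives the
  primitive. This is the universal coefficient argument with vanishing \<open>Ext\<close>.\<close>

lemma acyclic_imp_cocycle_coboundary:
  assumes ac: "acyclic_in p X" and p: "1 \<le> p" and \<phi>: "\<phi> \<in> cocycles p X"
  shows "\<phi> \<in> coboundaries p X"
proof -
  define S where "S = {(chain_boundary p c, cpair \<phi> c) | c. singular_chain p X c}"
  have "\<exists>h. Modules.additive h \<and> (\<forall>a r. (a, r) \<in> S \<longrightarrow> h a = r)"
  proof (rule additive_extension[of S])
    show "0 \<in> S" unfolding S_def zero_prod_def
      by (rule CollectI, rule exI[of _ 0]) simp
  next
    fix x y assume "x \<in> S" "y \<in> S"
    then obtain c d where "singular_chain p X c" "singular_chain p X d"
      "x = (chain_boundary p c, cpair \<phi> c)" "y = (chain_boundary p d, cpair \<phi> d)"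
      by (auto simp: S_def)
    then show "x - y \<in> S" unfolding S_def
      by (intro CollectI exI[of _ "c - d"]) (simp add: chain_boundary_diff cpair_diff singular_chain_diff)
  next
    fix r assume "(0, r) \<in> S"
    then obtain c where c: "singular_chain p X c" "chain_boundary p c = 0" "r = cpair \<phi> c"
      by (auto simp: S_def)
    then have "singular_relboundary p X {} c"
      using ac by (simp add: acyclic_in_def singular_cycle)
    then obtain d where "singular_chain (Suc p) X d" "chain_boundary (Suc p) d = c"
      by (auto simp: singular_boundary)
    with cocycle_cpair_boundary[OF \<phi>] c show "r = 0" by auto
  qed blast
  then obtain h where h: "Modules.additive h" and hS: "\<And>a r. (a, r) \<in> S \<Longrightarrow> h a = r" by blast
  \<comment> \<open>The extension \<open>h\<close> lives on the free group over all functions,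
    whereas a cochain must vanish off singular simplices.\<close>
  define \<eta> where "\<eta> = (\<lambda>\<tau>. if singular_simplex (p - 1) X \<tau> then h (frag_of \<tau>) else 0)"
  have "coboundary (p - 1) X \<eta> \<sigma> = \<phi> \<sigma>" for \<sigma>
  proof (cases "singular_simplex p X \<sigma>")
    case True
    have "h (chain_boundary p (frag_of \<sigma>)) = (\<Sum>k\<le>p. (-1) ^ k * h (frag_of (singular_face p k \<sigma>)))"
      using p by (simp add: chain_boundary_of Modules.additive.sum[OF h] additive_frag_cmul[OF h])
    also have "\<dots> = (\<Sum>k\<le>p. (-1) ^ k * \<eta> (singular_face p k \<sigma>))"
      using True p singular_simplex_singular_face[of p X \<sigma>]
      by (intro sum.cong) (auto simp: \<eta>_def)
    also have "\<dots> = coboundary (p - 1) X \<eta> \<sigma>"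
      using True p by (simp add: coboundary_def del: sum.atMost_Suc)
    finally have 1: "h (chain_boundary p (frag_of \<sigma>)) = coboundary (p - 1) X \<eta> \<sigma>" .
    have "(chain_boundary p (frag_of \<sigma>), cpair \<phi> (frag_of \<sigma>)) \<in> S"
      using True unfolding S_def by (metis (mono_tags, lifting) CollectI singular_chain_of)
    from hS[OF this] show ?thesis using 1 by simp
  next
    case False
    then show ?thesis using \<phi> p by (auto simp: coboundary_def cocycles_def cochains_def)
  qed
  then have "coboundary (p - 1) X \<eta> = \<phi>" by blast
  moreover have "\<eta> \<in> cochains (p - 1) X" by (auto simp: cochains_def \<eta>_def)
  ultimately show ?thesis using p by (auto simp: coboundaries_def)
qed

lemma cohom_dim_eq_0:
  assumes "cohom_dim X p n" "cocycles p X \<subseteq> coboundaries p X"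
  shows "n = 0"
proof (rule ccontr)
  assume "n \<noteq> 0"
  obtain v where v: "\<And>i. i < n \<Longrightarrow> v i \<in> cocycles p X"
    and ind: "\<And>c::nat \<Rightarrow> real. (\<lambda>\<sigma>. \<Sum>i<n. c i * v i \<sigma>) \<in> coboundaries p X \<Longrightarrow> \<forall>i<n. c i = 0"
    using assms(1) unfolding cohom_dim_def by metis
  \<comment> \<open>These coefficients single out \<open>v 0\<close>, which would be an independent
    class and a coboundary at once.\<close>
  have "(\<Sum>i<n. (if i = 0 then 1 else 0) * v i \<sigma>) = v 0 \<sigma>" for \<sigma>
    using \<open>n \<noteq> 0\<close> by (simp add: if_distrib[of "\<lambda>x. x * _"] cong: if_cong)
  then have "(\<lambda>\<sigma>. \<Sum>i<n. (if i = 0 then 1 else 0) * v i \<sigma>) = v 0" by blast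
  then have "(\<lambda>\<sigma>. \<Sum>i<n. (if i = 0 then 1 else 0) * v i \<sigma>) \<in> coboundaries p X"
    using v[of 0] assms(2) \<open>n \<noteq> 0\<close> by auto
  from ind[OF this] show False using \<open>n \<noteq> 0\<close> by auto
qed

text \<open>The constant cochain 1 is a cocycle, its two face terms cancelling on every 1-simplex.
  In degree 0 the only coboundary is zero, so on a nonempty space this is a nontrivial
  class.\<close>

lemma cohom_dim_0_pos:
  assumes "cohom_dim X 0 n" "topspace X \<noteq> {}"
  shows "n \<ge> 1"
proof (rule ccontr)
  assume "\<not> n \<ge> 1"
  then have n: "n = 0" by simp
  define \<phi> where "\<phi> = (\<lambda>\<sigma>. if singular_simplex 0 X \<sigma> then 1 else (0::real))"
  have "coboundary 0 X \<phi> \<sigma> = 0" for \<sigma>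
    using singular_simplex_singular_face[of 1 X \<sigma>]
    by (auto simp: coboundary_def \<phi>_def)
  then have "\<phi> \<in> cocycles 0 X" by (auto simp: cocycles_def cochains_def \<phi>_def)
  then have "\<phi> \<in> coboundaries 0 X" using assms(1) n by (auto simp: cohom_dim_def)
  then have "\<phi> \<sigma> = 0" for \<sigma> by (auto simp: coboundaries_def)
  moreover obtain x where x: "x \<in> topspace X" using assms(2) by blast
  have "singular_simplex 0 X (restrict (\<lambda>_. x) (standard_simplex 0))"
    using x by (auto simp: singular_simplex_def)
  ultimately show False by (metis \<phi>_def zero_neq_one)
qed

text \<open>With the odd terms gone, the alternating sum has only nonnegative terms, so it is at
  least its term in degree 0.\<close>

lemma euler_char_ge_1:
  assumes "euler_char X c" "topspace X \<noteq> {}"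
    and "\<And>p. odd p \<Longrightarrow> cocycles p X \<subseteq> coboundaries p X"
  shows "c \<ge> 1"
proof -
  obtain N d where d: "\<And>i. cohom_dim X i (d i)" and c: "c = (\<Sum>i\<le>N. (-1) ^ i * int (d i))"
    using assms(1) by (auto simp: euler_char_def)
  have "(-1) ^ i * int (d i) \<ge> 0" for i
    using cohom_dim_eq_0[OF d assms(3), of i] by (cases "even i") auto
  then have "(\<Sum>i\<in>{0}. (-1) ^ i * int (d i)) \<le> c" unfolding c
    by (intro sum_mono2) auto
  then show ?thesis using cohom_dim_0_pos[OF d assms(2)] by simp
qed

section \<open>Discrete spaces, open cells and punctured cells\<close>

lemma acyclic_in_discrete:
  assumes "1 \<le> n"
  shows "acyclic_in n (discrete_topology D)"
proof -
  have "acyclic_in n (subtopology (discrete_topology D) (\<Union>((\<lambda>x. {x}) ` D)))"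
  proof (rule acyclic_in_disjoint_Union)
    fix U assume "U \<in> (\<lambda>x. {x}) ` D"
    then obtain x where "x \<in> D" "U = {x}" by blast
    then show "openin (discrete_topology D) U" "acyclic_in n (subtopology (discrete_topology D) U)"
      using assms by (auto intro: acyclic_in_singleton)
  qed (use assms in \<open>auto simp: pairwise_def\<close>)
  then show ?thesis by simp
qed

text \<open>Serves edges and discs alike: a characteristic map is an embedding of the open cell once
  it is known to be open there.\<close>

lemma homeomorphic_map_open_cell:
  fixes e :: "'b::topological_space \<Rightarrow> 'x"
  assumes cont: "continuous_map (top_of_set D) X e" and inj: "inj_on e D" and D: "open D"
    and op: "\<And>W. open W \<Longrightarrow> W \<subseteq> D \<Longrightarrow> openin X (e ` W)"
  shows "homeomorphic_map (top_of_set D) (subtopology X (e ` D)) e"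
proof (rule bijective_open_imp_homeomorphic_map)
  show "continuous_map (top_of_set D) (subtopology X (e ` D)) e"
    using cont by (simp add: continuous_map_in_subtopology image_subset_iff_funcset[symmetric])
  show "open_map (top_of_set D) (subtopology X (e ` D)) e"
    unfolding open_map_def
  proof (intro allI impI)
    fix W assume "openin (top_of_set D) W"
    then have "open W" "W \<subseteq> D" using D by (auto simp: openin_open_eq)
    then show "openin (subtopology X (e ` D)) (e ` W)"
      using op by (meson image_mono openin_subset_topspace_eq openin_subtopology_Int2 inf.absorb2
          openin_open_subtopology D order_refl)
  qed
  have "e ` D \<subseteq> topspace X" using op[OF D] openin_subset by blast
  then show "e ` topspace (top_of_set D) = topspace (subtopology X (e ` D))" by auto
qed (use inj in auto)

text \<open>\<open>D\<close> is the open cell or the punctured open cell; the two choices give the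
  first Mayer-Vietoris piece and its intersection with the second.\<close>

lemma acyclic_in_open_cells:
  fixes e :: "'i \<Rightarrow> 'b::topological_space \<Rightarrow> 'x"
  assumes cont: "\<And>i. i \<in> I \<Longrightarrow> continuous_map (top_of_set D) X (e i)"
    and inj: "\<And>i j a b. i \<in> I \<Longrightarrow> j \<in> I \<Longrightarrow> a \<in> D \<Longrightarrow> b \<in> D \<Longrightarrow> e i a = e j b \<Longrightarrow> i = j \<and> a = b"
    and op: "\<And>i W. i \<in> I \<Longrightarrow> open W \<Longrightarrow> W \<subseteq> D \<Longrightarrow> openin X (e i ` W)"
    and D: "open D" "acyclic_in n (top_of_set D)" and n: "1 \<le> n"
  shows "acyclic_in n (subtopology X (\<Union>i\<in>I. e i ` D))"
proof (rule acyclic_in_disjoint_Union)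
  fix U assume "U \<in> (\<lambda>i. e i ` D) ` I"
  then obtain i where i: "i \<in> I" "U = e i ` D" by blast
  show "openin X U" using op D i by auto
  have "inj_on (e i) D" using inj i by (auto simp: inj_on_def)
  then have "homeomorphic_map (top_of_set D) (subtopology X U) (e i)"
    unfolding i(2) using homeomorphic_map_open_cell cont op D(1) i(1) by blast
  then have "subtopology X U homeomorphic_space top_of_set D"
    using homeomorphic_map_imp_homeomorphic_space homeomorphic_space_sym by blast
  then show "acyclic_in n (subtopology X U)"
    using acyclic_in_homeomorphic D(2) by blast
next
  show "pairwise disjnt ((\<lambda>i. e i ` D) ` I)"
    unfolding pairwise_def disjnt_def using inj by blast
qed (rule n)

lemma acyclic_in_punctured_interval:
  assumes "1 \<le> n"
  shows "acyclic_in n (top_of_set ({0<..<1} - {1/2 :: real}))"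
proof -
  let ?D = "{0<..<1} - {1/2 :: real}"
  have D: "?D = \<Union>{{0<..<1/2}, {1/2<..<1}}" by auto
  have "acyclic_in n (subtopology (top_of_set ?D) (\<Union>{{0<..<1/2}, {1/2<..<1}}))"
  proof (rule acyclic_in_finite_disjoint_Union)
    fix U :: "real set" assume U: "U \<in> {{0<..<1/2}, {1/2<..<1}}"
    then have sub: "U \<subseteq> ?D" by auto
    then show "openin (top_of_set ?D) U"
      using U by (intro open_subset) auto
    have "starlike U" using U
      by (intro convex_imp_starlike) (auto intro: exI[of _ "1/4"] exI[of _ "3/4"] simp: greaterThanLessThan_empty_iff)
    then show "acyclic_in n (subtopology (top_of_set ?D) U)"
      using sub assms by (simp add: subtopology_subtopology inf.absorb2 acyclic_in_starlike)
  next
    show "pairwise disjnt {{0<..<1/2}, {1/2<..<1::real}}"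
      by (auto simp: pairwise_def disjnt_def)
  qed (use assms in auto)
  then show ?thesis unfolding D[symmetric] subtopology_subtopology Int_absorb .
qed

text \<open>Degree 2 is the first possible one, as the punctured disc is a circle up to homotopy. It
  is covered by two slit discs, starlike about \<open>(1/2, 0)\<close> and \<open>(-1/2, 0)\<close>,
  which meet in the two open half-discs.\<close>

lemma acyclic_in_punctured_disc:
  assumes "2 \<le> n"
  shows "acyclic_in n (top_of_set (ball 0 1 - {0 :: real \<times> real}))"
proof -
  let ?D = "ball 0 1 - {0 :: real \<times> real}"
  \<comment> \<open>The open disc slit along the closed half of the horizontal axis on which
    \<open>s * fst z\<close> is at most 0.\<close>
  define A where "A s = ball 0 1 \<inter> {z :: real \<times> real. snd z \<noteq> 0 \<or> s * fst z > 0}" for s :: real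
  have sub: "A s \<subseteq> ?D" for s by (auto simp: A_def)
  have opA: "open (A s)" for s
  proof -
    have "A s = ball 0 1 \<inter> ({z. snd z \<noteq> 0} \<union> {z. 0 < s * fst z})" by (auto simp: A_def)
    then show ?thesis by (auto intro!: open_Int open_Un open_Collect_neq open_Collect_less continuous_intros)
  qed
  have star: "starlike (A s)" if s: "s \<in> {1, -1}" for s
    unfolding starlike_def
  proof (intro bexI ballI subsetI)
    let ?c = "(s / 2, 0)"
    show c: "?c \<in> A s" using s by (auto simp: A_def norm_Pair)
    fix z y assume z: "z \<in> A s" and y: "y \<in> closed_segment ?c z"
    have "y \<in> ball 0 1"
      using y z c closed_segment_subset[of ?c "ball 0 1" z] by (auto simp: A_def)
    moreover obtain u where u: "0 \<le> u" "u \<le> 1" "y = (1 - u) *\<^sub>R ?c + u *\<^sub>R z"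
      using y by (auto simp: closed_segment_def)
    have "snd y \<noteq> 0 \<or> s * fst y > 0"
    proof (cases "u * snd z = 0")
      case False
      then show ?thesis by (simp add: u(3))
    next
      \<comment> \<open>Here \<open>y\<close> lies on the axis, and its signed coordinate is a
        convex combination of 1/2 and, unless its weight is 0, a positive number: \<open>y\<close>
        avoids the slit.\<close>
      case True
      have ss: "s * s = 1" using s by auto
      have "s * fst y = (1 - u) * (s * s) / 2 + u * (s * fst z)"
        by (simp add: u(3) algebra_simps)
      then have eq: "s * fst y = (1 - u) / 2 + u * (s * fst z)"
        by (simp add: ss)
      from True consider "u = 0" | "u > 0" "snd z = 0" using u by fastforce
      then show ?thesis
      proof cases
        case 1
        then have "s * fst y > 0" unfolding eq by simp
        then show ?thesis ..
      next
        case 2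
        then have "u * (s * fst z) > 0" using z by (simp add: A_def)
        then have "s * fst y > 0" unfolding eq using u(1,2) by (simp add: add_nonneg_pos)
        then show ?thesis ..
      qed
    qed
    ultimately show "y \<in> A s" by (simp add: A_def)
  qed
  define H where "H s = ball 0 1 \<inter> {z :: real \<times> real. s * snd z > 0}" for s :: real
  have opH: "open (H s)" for s
    unfolding H_def by (auto intro!: open_Int open_Collect_less continuous_intros)
  have starH: "starlike (H s)" if s: "s \<in> {1, -1}" for s
  proof (rule convex_imp_starlike)
    have "convex {z :: real \<times> real. s * snd z > 0}"
    proof -
      have "{z :: real \<times> real. s * snd z > 0} = {z. (0, s) \<bullet> z > 0}" by (auto simp: inner_prod_def)
      then show ?thesis by (simp add: convex_halfspace_gt)
    qed
    then show "convex (H s)" unfolding H_def by (intro convex_Int convex_ball)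
    have "(0, s/2) \<in> H s" using s by (auto simp: H_def norm_Pair)
    then show "H s \<noteq> {}" by blast
  qed
  \<comment> \<open>A point of both slit discs is off the axis, so it lies strictly above or
    strictly below it.\<close>
  have AH: "A 1 \<inter> A (-1) = \<Union>{H 1, H (-1)}" by (auto simp: A_def H_def)
  have H: "acyclic_in (n-1) (subtopology (top_of_set ?D) (\<Union>{H 1, H (-1)}))"
  proof (rule acyclic_in_finite_disjoint_Union)
    fix U assume "U \<in> {H 1, H (-1)}"
    then obtain s where s: "s \<in> {1,-1}" "U = H s" by auto
    have Usub: "U \<subseteq> ?D" using s by (auto simp: H_def)
    then show "openin (top_of_set ?D) U"
      using opH s by (intro open_subset) auto
    show "acyclic_in (n-1) (subtopology (top_of_set ?D) U)"
      using Usub starH[OF s(1)] assms s(2)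
      by (simp add: subtopology_subtopology inf.absorb2 acyclic_in_starlike)
  next
    show "pairwise disjnt {H 1, H (- 1)}"
      by (auto simp: pairwise_def disjnt_def H_def)
  qed (use assms in auto)
  show ?thesis
  proof (rule acyclic_in_Mayer_Vietoris[of _ "A 1" "A (-1)"])
    show "openin (top_of_set ?D) (A 1)" "openin (top_of_set ?D) (A (-1))"
      using opA sub by (auto intro!: open_subset)
    show "topspace (top_of_set ?D) = A 1 \<union> A (-1)"
      by (force simp: A_def prod_eq_iff)
    show "acyclic_in n (subtopology (top_of_set ?D) (A 1))"
      "acyclic_in n (subtopology (top_of_set ?D) (A (-1)))"
      using sub star assms by (simp_all add: subtopology_subtopology inf.absorb2 acyclic_in_starlike)
    show "acyclic_in (n - 1) (subtopology (top_of_set ?D) (A 1 \<inter> A (-1)))"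
      using H unfolding AH .
  qed (use assms in auto)
qed

section \<open>The realization as a quotient space\<close>

definition quo :: "('o, 'a, 'c) computad \<Rightarrow> ('o, 'a, 'c) precell \<Rightarrow> ('o, 'a, 'c) precell set" where
  "quo g x = ((glue g \<union> (glue g)\<inverse>)\<^sup>*) `` {x}"

lemma openin_pre_top: "openin (pre_top g) U \<longleftrightarrow> pre_open g U"
  by (simp add: pre_top_def istopology_pre_open topology_inverse')

lemma topspace_pre_top [simp]: "topspace (pre_top g) = pre_carrier g"
proof (rule antisym)
  have e: "{p \<in> {0..1}. EdgePt a p \<in> pre_carrier g} = {0..1}" if "a \<in> Arr g" for a
    using that by (auto simp: pre_carrier_def)
  have d: "{z \<in> cball 0 1. DiscPt \<alpha> z \<in> pre_carrier g} = cball 0 1" if "\<alpha> \<in> Cells g" for \<alpha>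
    using that by (auto simp: pre_carrier_def)
  have "openin (pre_top g) (pre_carrier g)"
    unfolding openin_pre_top pre_open_def
    by (intro conjI ballI) (simp_all only: e d openin_subtopology_self order_refl)
  then show "pre_carrier g \<subseteq> topspace (pre_top g)"
    by (rule openin_subset)
  show "topspace (pre_top g) \<subseteq> pre_carrier g"
    using openin_topspace[of "pre_top g"] unfolding openin_pre_top pre_open_def by blast
qed

lemma openin_realization:
  "openin (realization g) U \<longleftrightarrow>
     U \<subseteq> quo g ` pre_carrier g \<and> openin (pre_top g) {x \<in> pre_carrier g. quo g x \<in> U}"
  by (simp add: realization_def quot_top_def istopology_quot_open topology_inverse' quot_open_def quo_def[abs_def])

lemma topspace_realization: "topspace (realization g) = quo g ` pre_carrier g"
proof (rule antisym)
  have "{x \<in> pre_carrier g. quo g x \<in> quo g ` pre_carrier g} = topspace (pre_top g)" by auto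
  then have "openin (realization g) (quo g ` pre_carrier g)"
    unfolding openin_realization by (simp only: openin_topspace order_refl simp_thms)
  then show "quo g ` pre_carrier g \<subseteq> topspace (realization g)"
    by (rule openin_subset)
  show "topspace (realization g) \<subseteq> quo g ` pre_carrier g"
    using openin_topspace[of "realization g"] unfolding openin_realization by blast
qed

lemma quotient_map_quo: "quotient_map (pre_top g) (realization g) (quo g)"
  unfolding quotient_map_def topspace_realization openin_realization topspace_pre_top
  by simp

lemma quo_glue:
  assumes "(x, y) \<in> glue g"
  shows "quo g x = quo g y"
proof -
  let ?R = "(glue g \<union> (glue g)\<inverse>)\<^sup>*"
  have sy: "sym ?R" by (intro sym_rtrancl) (auto simp: sym_def)
  have xy: "(x, y) \<in> ?R" using assms by auto
  then have "(y, x) \<in> ?R" using sy by (auto dest: symD)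
  with xy show ?thesis unfolding quo_def by (auto intro: rtrancl_trans)
qed

text \<open>The universal property of the generated equivalence: compatibility on the generating
  pairs propagates along zigzags of gluings.\<close>

lemma quo_respects:
  assumes "\<And>x y. (x, y) \<in> glue g \<Longrightarrow> f x = f y" and "quo g x = quo g y"
  shows "f x = f y"
proof -
  have "y \<in> quo g y" by (simp add: quo_def)
  then have "(x, y) \<in> (glue g \<union> (glue g)\<inverse>)\<^sup>*" using assms(2) by (auto simp: quo_def)
  then show ?thesis
  proof (induction rule: rtrancl_induct)
    case (step y z)
    then show ?case using assms(1) by fastforce
  qed simp
qed

text \<open>A point that no gluing mentions is alone in its class. The test function is equality
  with \<open>x\<close>, which is false at both ends of every gluing pair.\<close>

lemma quo_inj:
  assumes "x \<notin> Field (glue g)" and "quo g x = quo g y"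
  shows "y = x"
proof -
  have "(x = x) = (y = x)"
    by (rule quo_respects[of g "\<lambda>z. z = x"]) (use assms in \<open>auto simp: Field_def\<close>)
  then show ?thesis by simp
qed

section \<open>Open sets and continuous maps on the pre-space and its quotient\<close>

lemma openin_pre_disc:
  assumes "\<alpha> \<in> Cells g" "open W"
  shows "openin (pre_top g) (DiscPt \<alpha> ` (W \<inter> cball 0 1))"
  unfolding openin_pre_top pre_open_def
proof (intro conjI ballI)
  fix \<beta>
  have "{z \<in> cball 0 1. (DiscPt \<beta> z :: ('b,'c,'a) precell) \<in> DiscPt \<alpha> ` (W \<inter> cball 0 1)} =
     (if \<beta> = \<alpha> then cball 0 1 \<inter> W else {})" by auto
  then show "openin (top_of_set (cball (0::real\<times>real) 1))
      {z \<in> cball 0 1. (DiscPt \<beta> z :: ('b,'c,'a) precell) \<in> DiscPt \<alpha> ` (W \<inter> cball 0 1)}"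
    using assms(2) by (auto simp: openin_open)
next
  fix a
  have "{p \<in> {0..1}. (EdgePt a p :: ('b,'c,'a) precell) \<in> DiscPt \<alpha> ` (W \<inter> cball 0 1)} = {}" by auto
  then show "openin (top_of_set {0..1}) {p \<in> {0..1}. (EdgePt a p :: ('b,'c,'a) precell) \<in> DiscPt \<alpha> ` (W \<inter> cball 0 1)}"
    by (metis openin_empty)
qed (use assms in \<open>auto simp: pre_carrier_def\<close>)

lemma openin_pre_edge:
  assumes "a \<in> Arr g" "open W"
  shows "openin (pre_top g) (EdgePt a ` (W \<inter> {0..1}))"
  unfolding openin_pre_top pre_open_def
proof (intro conjI ballI)
  fix b
  have "{p \<in> {0..1}. (EdgePt b p :: ('b,'a,'c) precell) \<in> EdgePt a ` (W \<inter> {0..1})} =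
     (if b = a then {0..1} \<inter> W else {})" by auto
  then show "openin (top_of_set {0..1}) {p \<in> {0..1}. (EdgePt b p :: ('b,'a,'c) precell) \<in> EdgePt a ` (W \<inter> {0..1})}"
    using assms(2) by (auto simp: openin_open)
next
  fix \<alpha>
  have "{z \<in> cball 0 1. (DiscPt \<alpha> z :: ('b,'a,'c) precell) \<in> EdgePt a ` (W \<inter> {0..1})} = {}" by auto
  then show "openin (top_of_set (cball (0::real\<times>real) 1))
      {z \<in> cball 0 1. (DiscPt \<alpha> z :: ('b,'a,'c) precell) \<in> EdgePt a ` (W \<inter> {0..1})}"
    by (metis openin_empty)
qed (use assms in \<open>auto simp: pre_carrier_def\<close>)

lemma openin_pre_vert:
  assumes "v \<in> Obj g"
  shows "openin (pre_top g) {Vert v}"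
  using assms by (simp add: openin_pre_top pre_open_def pre_carrier_def)

lemma continuous_map_pre_edge:
  assumes "a \<in> Arr g"
  shows "continuous_map (top_of_set {0..1}) (pre_top g) (EdgePt a)"
  unfolding continuous_map_def
  using assms by (auto simp: openin_pre_top pre_open_def pre_carrier_def)

lemma continuous_map_pre_disc:
  assumes "\<alpha> \<in> Cells g"
  shows "continuous_map (top_of_set (cball 0 1)) (pre_top g) (DiscPt \<alpha>)"
  unfolding continuous_map_def
  using assms by (auto simp: openin_pre_top pre_open_def pre_carrier_def)

lemma continuous_map_quo_edge:
  assumes "a \<in> Arr g"
  shows "continuous_map (top_of_set {0..1}) (realization g) (\<lambda>p. quo g (EdgePt a p))"
  using continuous_map_compose[OF continuous_map_pre_edge[OF assms] quotient_imp_continuous_map[OF quotient_map_quo]]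
  by (simp add: comp_def)

lemma continuous_map_quo_disc:
  assumes "\<alpha> \<in> Cells g"
  shows "continuous_map (top_of_set (cball 0 1)) (realization g) (\<lambda>z. quo g (DiscPt \<alpha> z))"
  using continuous_map_compose[OF continuous_map_pre_disc[OF assms] quotient_imp_continuous_map[OF quotient_map_quo]]
  by (simp add: comp_def)

text \<open>The pieces of the pre-space are open and a product with \<open>T\<close> distributes
  over their disjoint union, so continuity may be checked on each vertex, edge and disc. The
  restriction to \<open>S\<close> is there for the complements of cell centres.\<close>

lemma continuous_map_prod_pre:
  assumes S: "S \<subseteq> pre_carrier g"
    and v: "\<And>v. Vert v \<in> S \<Longrightarrow> continuous_map T Z (\<lambda>t. f (t, Vert v))"
    and e: "\<And>a. a \<in> Arr g \<Longrightarrow>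
      continuous_map (prod_topology T (top_of_set {p \<in> {0..1}. EdgePt a p \<in> S})) Z (\<lambda>(t, p). f (t, EdgePt a p))"
    and d: "\<And>\<alpha>. \<alpha> \<in> Cells g \<Longrightarrow>
      continuous_map (prod_topology T (top_of_set {z \<in> cball 0 1. DiscPt \<alpha> z \<in> S})) Z (\<lambda>(t, z). f (t, DiscPt \<alpha> z))"
  shows "continuous_map (prod_topology T (subtopology (pre_top g) S)) Z f"
proof -
  have loc: "f (t, x) \<in> topspace Z \<and> (\<forall>W. openin Z W \<longrightarrow> f (t, x) \<in> W \<longrightarrow> (\<exists>A B. openin T A \<and> openin (subtopology (pre_top g) S) B \<and>
      t \<in> A \<and> x \<in> B \<and> A \<times> B \<subseteq> {y \<in> topspace (prod_topology T (subtopology (pre_top g) S)). f y \<in> W}))"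
    if t: "t \<in> topspace T" and x: "x \<in> S" for t x
  proof -
    have xc: "x \<in> pre_carrier g" using x S by blast
    then consider v where "x = Vert v" "v \<in> Obj g"
      | a p where "x = EdgePt a p" "a \<in> Arr g" "p \<in> {0..1}"
      | \<alpha> z where "x = DiscPt \<alpha> z" "\<alpha> \<in> Cells g" "z \<in> cball 0 1"
      by (auto simp: pre_carrier_def)
    then show ?thesis
    proof cases
      case 1
      then have c: "continuous_map T Z (\<lambda>t. f (t, Vert v))" using x v by simp
      have o: "openin (subtopology (pre_top g) S) {Vert v}"
        using openin_pre_vert[OF 1(2)] x 1 by (metis Int_insert_left_if1 inf_bot_left openin_subtopology)
      show ?thesis
      proof (intro conjI allI impI)
        show "f (t, x) \<in> topspace Z" using c t 1 by (auto simp: continuous_map_def)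
        fix W assume "openin Z W" "f (t, x) \<in> W"
        then show "\<exists>A B. openin T A \<and> openin (subtopology (pre_top g) S) B \<and>
            t \<in> A \<and> x \<in> B \<and> A \<times> B \<subseteq> {y \<in> topspace (prod_topology T (subtopology (pre_top g) S)). f y \<in> W}"
          using 1 t x xc c o
          by (intro exI[of _ "{t \<in> topspace T. f (t, Vert v) \<in> W}"] exI[of _ "{Vert v}"])
            (auto simp: openin_continuous_map_preimage)
      qed
    next
      case 2
      let ?E = "{p \<in> {0..1}. EdgePt a p \<in> S}"
      have c: "continuous_map (prod_topology T (top_of_set ?E)) Z (\<lambda>(t, p). f (t, EdgePt a p))"
        using e 2 by simp
      have mem: "(t, p) \<in> topspace (prod_topology T (top_of_set ?E))" using t x 2 by auto
      show ?thesis
      proof (intro conjI allI impI)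
        show "f (t, x) \<in> topspace Z" using funcset_mem[OF continuous_map_funspace[OF c] mem] 2 by simp
        fix W assume W: "openin Z W" "f (t, x) \<in> W"
        let ?Q = "{y \<in> topspace (prod_topology T (top_of_set ?E)). (case y of (t, p) \<Rightarrow> f (t, EdgePt a p)) \<in> W}"
        have o: "openin (prod_topology T (top_of_set ?E)) ?Q"
          by (rule openin_continuous_map_preimage[OF c W(1)])
        have mQ: "(t, p) \<in> ?Q" using mem W(2) 2(1) by simp
        obtain A B where AB: "openin T A" "openin (top_of_set ?E) B" "t \<in> A" "p \<in> B"
          "A \<times> B \<subseteq> ?Q"
          using o[unfolded openin_prod_topology_alt, rule_format, OF mQ] by blast
        obtain B' where B': "open B'" "B = ?E \<inter> B'" using AB(2) by (auto simp: openin_open)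
        have eq: "EdgePt a ` B = EdgePt a ` (B' \<inter> {0..1}) \<inter> S" using B' by auto
        have "openin (subtopology (pre_top g) S) (EdgePt a ` B)"
          unfolding eq openin_subtopology using openin_pre_edge[OF 2(2) B'(1)] by blast
        moreover have "A \<times> EdgePt a ` B \<subseteq> {y \<in> topspace (prod_topology T (subtopology (pre_top g) S)). f y \<in> W}"
          using AB(5) S by fastforce
        ultimately show "\<exists>A B. openin T A \<and> openin (subtopology (pre_top g) S) B \<and>
            t \<in> A \<and> x \<in> B \<and> A \<times> B \<subseteq> {y \<in> topspace (prod_topology T (subtopology (pre_top g) S)). f y \<in> W}"
          using AB 2 by blast
      qed
    next
      case 3
      let ?E = "{z \<in> cball 0 1. DiscPt \<alpha> z \<in> S}"
      have c: "continuous_map (prod_topology T (top_of_set ?E)) Z (\<lambda>(t, p). f (t, DiscPt \<alpha> p))"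
        using d 3 by simp
      have mem: "(t, z) \<in> topspace (prod_topology T (top_of_set ?E))" using t x 3 by auto
      show ?thesis
      proof (intro conjI allI impI)
        show "f (t, x) \<in> topspace Z" using funcset_mem[OF continuous_map_funspace[OF c] mem] 3 by simp
        fix W assume W: "openin Z W" "f (t, x) \<in> W"
        let ?Q = "{y \<in> topspace (prod_topology T (top_of_set ?E)). (case y of (t, p) \<Rightarrow> f (t, DiscPt \<alpha> p)) \<in> W}"
        have o: "openin (prod_topology T (top_of_set ?E)) ?Q"
          by (rule openin_continuous_map_preimage[OF c W(1)])
        have mQ: "(t, z) \<in> ?Q" using mem W(2) 3(1) by simp
        obtain A B where AB: "openin T A" "openin (top_of_set ?E) B" "t \<in> A" "z \<in> B"
          "A \<times> B \<subseteq> ?Q"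
          using o[unfolded openin_prod_topology_alt, rule_format, OF mQ] by blast
        obtain B' where B': "open B'" "B = ?E \<inter> B'" using AB(2) by (auto simp: openin_open)
        have eq: "DiscPt \<alpha> ` B = DiscPt \<alpha> ` (B' \<inter> cball 0 1) \<inter> S" using B' by auto
        have "openin (subtopology (pre_top g) S) (DiscPt \<alpha> ` B)"
          unfolding eq openin_subtopology using openin_pre_disc[OF 3(2) B'(1)] by blast
        moreover have "A \<times> DiscPt \<alpha> ` B \<subseteq> {y \<in> topspace (prod_topology T (subtopology (pre_top g) S)). f y \<in> W}"
          using AB(5) S by fastforce
        ultimately show "\<exists>A B. openin T A \<and> openin (subtopology (pre_top g) S) B \<and>
            t \<in> A \<and> x \<in> B \<and> A \<times> B \<subseteq> {y \<in> topspace (prod_topology T (subtopology (pre_top g) S)). f y \<in> W}"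
          using AB 3 by blast
      qed
    qed
  qed
  show ?thesis
    unfolding continuous_map_def
  proof (intro conjI allI impI)
    show "f \<in> topspace (prod_topology T (subtopology (pre_top g) S)) \<rightarrow> topspace Z"
      using loc by auto
    fix W assume W: "openin Z W"
    show "openin (prod_topology T (subtopology (pre_top g) S))
        {y \<in> topspace (prod_topology T (subtopology (pre_top g) S)). f y \<in> W}"
      unfolding openin_prod_topology_alt[of T "subtopology (pre_top g) S"]
    proof (intro allI impI)
      fix t x assume "(t, x) \<in> {y \<in> topspace (prod_topology T (subtopology (pre_top g) S)). f y \<in> W}"
      then have "t \<in> topspace T" "x \<in> S" "f (t, x) \<in> W" by auto
      from loc[OF this(1,2)] W this(3)
      show "\<exists>U V. openin T U \<and> openin (subtopology (pre_top g) S) V \<and> t \<in> U \<and> x \<in> V \<and>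
          U \<times> V \<subseteq> {y \<in> topspace (prod_topology T (subtopology (pre_top g) S)). f y \<in> W}"
        by blast
    qed
  qed
qed

text \<open>The time parameter \<open>t\<close> ranges over a locally compact Hausdorff space, so that the product
  of the quotient map with the identity is again a quotient map.\<close>

lemma continuous_map_prod_realization:
  assumes V: "openin (realization g) V" and S: "S = {x \<in> pre_carrier g. quo g x \<in> V}"
    and T: "locally_compact_space T" "Hausdorff_space T"
    and v: "\<And>v. Vert v \<in> S \<Longrightarrow> continuous_map T Z (\<lambda>t. f (t, Vert v))"
    and e: "\<And>a. a \<in> Arr g \<Longrightarrow>
      continuous_map (prod_topology T (top_of_set {p \<in> {0..1}. EdgePt a p \<in> S})) Z (\<lambda>(t, p). f (t, EdgePt a p))"
    and d: "\<And>\<alpha>. \<alpha> \<in> Cells g \<Longrightarrow>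
      continuous_map (prod_topology T (top_of_set {z \<in> cball 0 1. DiscPt \<alpha> z \<in> S})) Z (\<lambda>(t, z). f (t, DiscPt \<alpha> z))"
    and resp: "\<And>t x y. t \<in> topspace T \<Longrightarrow> (x, y) \<in> glue g \<Longrightarrow> f (t, x) = f (t, y)"
  obtains F where "continuous_map (prod_topology T (subtopology (realization g) V)) Z F"
    "\<And>t x. t \<in> topspace T \<Longrightarrow> x \<in> S \<Longrightarrow> F (t, quo g x) = f (t, x)"
proof -
  \<comment> \<open>\<open>V\<close> is open and \<open>S\<close> is its full preimage; a quotient
    map restricts to a quotient map over such a set.\<close>
  have "quotient_map (subtopology (pre_top g) S) (subtopology (realization g) V) (quo g)"
    by (rule quotient_map_restriction[OF quotient_map_quo]) (use V S in auto)
  then have Q: "quotient_map (prod_topology T (subtopology (pre_top g) S))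
      (prod_topology T (subtopology (realization g) V)) (\<lambda>(t, x). (t, quo g x))"
    using T by (intro quotient_map_prod_right) auto
  have f: "continuous_map (prod_topology T (subtopology (pre_top g) S)) Z f"
    by (rule continuous_map_prod_pre) (use S v e d in auto)
  obtain F where F: "continuous_map (prod_topology T (subtopology (realization g) V)) Z F"
    "\<And>x. x \<in> topspace (prod_topology T (subtopology (pre_top g) S)) \<Longrightarrow>
        F ((\<lambda>(t, x). (t, quo g x)) x) = f x"
  proof (rule quotient_map_lift_exists[OF Q f])
    fix x y assume "x \<in> topspace (prod_topology T (subtopology (pre_top g) S))"
      and "(\<lambda>(t, x). (t, quo g x)) x = (\<lambda>(t, x). (t, quo g x)) y"
    then obtain t x' y' where "x = (t, x')" "y = (t, y')" "quo g x' = quo g y'" "t \<in> topspace T"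
      by (cases x; cases y) auto
    then show "f x = f y" using quo_respects[of g "\<lambda>x. f (t, x)" x' y'] resp by auto
  qed blast
  show thesis
    by (rule that[OF F(1)]) (use F(2) S in force)
qed

lemma continuous_map_realization:
  assumes V: "openin (realization g) V" and S: "S = {x \<in> pre_carrier g. quo g x \<in> V}"
    and v: "\<And>v. Vert v \<in> S \<Longrightarrow> f (Vert v) \<in> topspace Z"
    and e: "\<And>a. a \<in> Arr g \<Longrightarrow>
      continuous_map (top_of_set {p \<in> {0..1}. EdgePt a p \<in> S}) Z (\<lambda>p. f (EdgePt a p))"
    and d: "\<And>\<alpha>. \<alpha> \<in> Cells g \<Longrightarrow>
      continuous_map (top_of_set {z \<in> cball 0 1. DiscPt \<alpha> z \<in> S}) Z (\<lambda>z. f (DiscPt \<alpha> z))"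
    and resp: "\<And>x y. (x, y) \<in> glue g \<Longrightarrow> f x = f y"
  obtains F where "continuous_map (subtopology (realization g) V) Z F"
    "\<And>x. x \<in> S \<Longrightarrow> F (quo g x) = f x"
proof -
  \<comment> \<open>A one-point parameter space turns the homotopy version into a statement about
    single maps.\<close>
  let ?T = "discrete_topology {()}"
  have "continuous_map (prod_topology ?T Y) Z (\<lambda>(t, p). h p)" if "continuous_map Y Z h" for Y h
    using continuous_map_compose[OF continuous_map_snd that] by (simp add: comp_def case_prod_unfold)
  note * = this
  obtain F where F: "continuous_map (prod_topology ?T (subtopology (realization g) V)) Z F"
    "\<And>t x. t \<in> topspace ?T \<Longrightarrow> x \<in> S \<Longrightarrow> F (t, quo g x) = f x"
  proof (rule continuous_map_prod_realization[OF V S, of ?T Z "\<lambda>(t, x). f x"])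
    show "locally_compact_space ?T" "Hausdorff_space ?T"
      by (simp_all add: locally_compact_space_discrete_topology Hausdorff_space_discrete_topology)
  qed (use v *[OF e] *[OF d] resp in auto)
  have "continuous_map (subtopology (realization g) V) (prod_topology ?T (subtopology (realization g) V)) (\<lambda>x. ((), x))"
    by (simp add: continuous_map_paired)
  from continuous_map_compose[OF this F(1)] F(2)
  show thesis by (intro that[of "\<lambda>x. F ((), x)"]) (auto simp: comp_def)
qed

section \<open>Word paths and the attaching maps\<close>

definition letter_pt :: "'a \<times> bool \<Rightarrow> real \<Rightarrow> ('o, 'a, 'c) precell" where
  "letter_pt l u = EdgePt (fst l) (if snd l then u else 1 - u)"

lemma quo_edge_0: "a \<in> Arr g \<Longrightarrow> quo g (EdgePt a 0) = quo g (Vert (gdom g a))"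
  by (rule quo_glue) (auto simp: glue_def)

lemma quo_edge_1: "a \<in> Arr g \<Longrightarrow> quo g (EdgePt a 1) = quo g (Vert (gcod g a))"
  by (rule quo_glue) (auto simp: glue_def)

lemma quo_letter_pt_0: "fst l \<in> Arr g \<Longrightarrow> quo g (letter_pt l 0) = quo g (Vert (letter_start g l))"
  by (simp add: letter_pt_def letter_start_def quo_edge_0 quo_edge_1)

lemma quo_letter_pt_1: "fst l \<in> Arr g \<Longrightarrow> quo g (letter_pt l 1) = quo g (Vert (letter_end g l))"
  by (simp add: letter_pt_def letter_end_def quo_edge_0 quo_edge_1)

lemma continuous_map_letter_pt:
  assumes "fst l \<in> Arr g"
  shows "continuous_map (top_of_set {0..1}) (realization g) (\<lambda>u. quo g (letter_pt l u))"
proof -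
  have "continuous_map (top_of_set {0..1::real}) (top_of_set {0..1}) (\<lambda>u. if snd l then u else 1 - u)"
    by (cases "snd l") (auto intro!: continuous_intros)
  from continuous_map_compose[OF this continuous_map_quo_edge[OF assms]]
  show ?thesis by (simp add: comp_def letter_pt_def)
qed

lemma word_path_letter:
  assumes w: "w \<noteq> []" and n: "n < length w"
    and t: "real n \<le> real (length w) * \<tau>" "real (length w) * \<tau> < real n + 1"
  shows "word_path x w \<tau> = letter_pt (w ! n) (real (length w) * \<tau> - real n)"
proof -
  have "\<lfloor>real (length w) * \<tau>\<rfloor> = int n" using t by (intro floor_unique) auto
  then have "min (nat \<lfloor>real (length w) * \<tau>\<rfloor>) (length w - 1) = n" using n by simp
  then show ?thesis using w by (simp add: word_path_def letter_pt_def Let_def)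
qed

lemma word_path_1:
  assumes w: "w \<noteq> []"
  shows "word_path x w 1 = letter_pt (last w) 1"
proof -
  have "min (nat \<lfloor>real (length w) * 1\<rfloor>) (length w - 1) = length w - 1" by simp
  moreover have "real (length w) * 1 - real (length w - 1) = 1" using w
    by (cases w) auto
  ultimately show ?thesis using w
    by (simp add: word_path_def letter_pt_def Let_def last_conv_nth)
qed

text \<open>At a junction \<open>word_path\<close> already sits at time 0 of the next letter, not at
  time 1 of the current one. These are different points of the pre-space glued to the same vertex,
  so in the quotient the formula holds on closed intervals.\<close>

lemma word_path_quo_letter:
  assumes w: "fg_mor g (x, w, y)" and n: "n < length w"
    and t: "real n \<le> real (length w) * \<tau>" "real (length w) * \<tau> \<le> real n + 1"
  shows "quo g (word_path x w \<tau>) = quo g (letter_pt (w ! n) (real (length w) * \<tau> - real n))"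
proof -
  have ne: "w \<noteq> []" using n by auto
  have arr: "fst (w ! i) \<in> Arr g" if "i < length w" for i
    using w that by (auto simp: fg_mor_def)
  consider "real (length w) * \<tau> < real n + 1" | "real (length w) * \<tau> = real n + 1" "Suc n = length w"
    | "real (length w) * \<tau> = real n + 1" "Suc n < length w"
    using t n by linarith
  then show ?thesis
  proof cases
    case 1
    then show ?thesis by (simp add: word_path_letter[OF ne n t(1)])
  next
    case 2
    have "real (length w) * \<tau> = real (length w)" using 2(1) unfolding 2(2)[symmetric] by simp
    then have "\<tau> = 1" using ne by simp
    moreover have "last w = w ! n" using ne by (simp add: last_conv_nth 2(2)[symmetric])
    moreover have "real (length w) * 1 - real n = 1" unfolding 2(2)[symmetric] by simp
    ultimately show ?thesis by (simp only: word_path_1[OF ne])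
  next
    case 3
    have "quo g (word_path x w \<tau>) = quo g (letter_pt (w ! Suc n) (real (length w) * \<tau> - real (Suc n)))"
      by (subst word_path_letter[OF ne 3(2)]) (use 3 in auto)
    then have "quo g (word_path x w \<tau>) = quo g (letter_pt (w ! Suc n) 0)"
      using 3(1) by simp
    also have "\<dots> = quo g (Vert (letter_end g (w ! n)))"
      using arr 3(2) w by (simp add: quo_letter_pt_0 fg_mor_def)
    also have "\<dots> = quo g (letter_pt (w ! n) 1)"
      using arr n by (simp add: quo_letter_pt_1)
    finally show ?thesis using 3(1) by simp
  qed
qed

lemma exists_letter_index:
  assumes "w \<noteq> []" "0 \<le> \<tau>" "\<tau> \<le> 1"
  obtains n where "n < length w" "real n \<le> real (length w) * \<tau>" "real (length w) * \<tau> \<le> real n + 1"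
proof (cases "\<tau> = 1")
  case True
  \<comment> \<open>At time 1 the rounding would give \<open>length w\<close>; the end point belongs
    to the last letter.\<close>
  then show ?thesis using that[of "length w - 1"] assms by (cases w) auto
next
  case False
  let ?n = "nat \<lfloor>real (length w) * \<tau>\<rfloor>"
  have "real (length w) * \<tau> < real (length w)" using False assms by simp
  moreover have "0 \<le> real (length w) * \<tau>" using assms by simp
  ultimately show ?thesis using that[of ?n] by linarith
qed

lemma quo_word_path_0:
  assumes w: "fg_mor g (x, w, y)"
  shows "quo g (word_path x w 0) = quo g (Vert x)"
proof (cases "w = []")
  case False
  then have "quo g (word_path x w 0) = quo g (letter_pt (w ! 0) 0)"
    using word_path_quo_letter[OF w, of 0 0] by simp
  also have "\<dots> = quo g (Vert x)"
    using False w by (subst quo_letter_pt_0) (auto simp: fg_mor_def hd_conv_nth)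
  finally show ?thesis .
qed (simp add: word_path_def)

lemma quo_word_path_1:
  assumes w: "fg_mor g (x, w, y)"
  shows "quo g (word_path x w 1) = quo g (Vert y)"
proof (cases "w = []")
  case False
  then show ?thesis
    using w by (simp add: word_path_1 quo_letter_pt_1 fg_mor_def)
next
  case True
  then show ?thesis using w by (simp add: word_path_def fg_mor_def)
qed

lemma continuous_map_word_path:
  assumes w: "fg_mor g (x, w, y)"
  shows "continuous_map (top_of_set {0..1}) (realization g) (\<lambda>\<tau>. quo g (word_path x w \<tau>))"
proof (cases "w = []")
  case True
  have "Vert x \<in> pre_carrier g" using w by (auto simp: fg_mor_def pre_carrier_def)
  then show ?thesis using True by (auto simp: word_path_def topspace_realization)
next
  case False
  let ?m = "real (length w)"
  \<comment> \<open>The closed subintervals on which single letters are traversed; the path is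
    pasted from them.\<close>
  define T where "T n = {\<tau>. real n \<le> ?m * \<tau> \<and> ?m * \<tau> \<le> real n + 1} \<inter> {0..1}" for n
  have m: "?m > 0" using False by simp
  show ?thesis
  proof (rule pasting_lemma_closed[where I = "{..<length w}" and T = T
        and f = "\<lambda>n \<tau>. quo g (letter_pt (w ! n) (?m * \<tau> - real n))"])
    fix n assume n: "n \<in> {..<length w}"
    have "closed (T n)" unfolding T_def
      by (intro closed_Int closed_Collect_conj closed_Collect_le closed_atLeastAtMost continuous_intros)
    then show "closedin (top_of_set {0..1}) (T n)"
      by (rule closed_subset[rotated]) (auto simp: T_def)
    have arr: "fst (w ! n) \<in> Arr g" using w n by (auto simp: fg_mor_def)
    have "continuous_map (top_of_set (T n)) (top_of_set {0..1}) (\<lambda>\<tau>. ?m * \<tau> - real n)"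
      by (auto simp: T_def intro!: continuous_intros)
    from continuous_map_compose[OF this continuous_map_letter_pt[OF arr]]
    have "continuous_map (top_of_set (T n)) (realization g) (\<lambda>\<tau>. quo g (letter_pt (w ! n) (?m * \<tau> - real n)))"
      by (simp add: comp_def)
    moreover have "T n \<subseteq> {0..1}" by (auto simp: T_def)
    ultimately show "continuous_map (subtopology (top_of_set {0..1}) (T n)) (realization g)
         (\<lambda>\<tau>. quo g (letter_pt (w ! n) (?m * \<tau> - real n)))"
      by (simp add: subtopology_subtopology inf.absorb2)
  next
    fix i j \<tau> assume "i \<in> {..<length w}" "j \<in> {..<length w}" "\<tau> \<in> topspace (top_of_set {0..1}) \<inter> T i \<inter> T j"
    then show "quo g (letter_pt (w ! i) (?m * \<tau> - real i)) = quo g (letter_pt (w ! j) (?m * \<tau> - real j))"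
      using word_path_quo_letter[OF w, of i \<tau>] word_path_quo_letter[OF w, of j \<tau>]
      by (simp add: T_def)
  next
    fix \<tau> :: real assume "\<tau> \<in> topspace (top_of_set {0..1})"
    then have \<tau>: "0 \<le> \<tau>" "\<tau> \<le> 1" by auto
    obtain n where n: "n < length w" "real n \<le> ?m * \<tau>" "?m * \<tau> \<le> real n + 1"
      by (rule exists_letter_index[OF False \<tau>])
    then have "\<tau> \<in> T n" using \<tau> by (auto simp: T_def)
    then show "\<exists>j. j \<in> {..<length w} \<and> \<tau> \<in> T j \<and>
        quo g (word_path x w \<tau>) = quo g (letter_pt (w ! j) (?m * \<tau> - real j))"
      using n word_path_quo_letter[OF w n] by blast
  qed simp
qed

lemma word_path_neq_disc: "word_path x w \<tau> \<noteq> DiscPt \<alpha> z"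
  by (auto simp: word_path_def Let_def)

lemma disc_notin_Field_glue: "norm z < 1 \<Longrightarrow> DiscPt \<alpha> z \<notin> Field (glue g)"
  by (auto simp: Field_def glue_def word_path_neq_disc[symmetric])

text \<open>The 1-skeleton as a computad of the same type, so that everything proved about
  \<open>quo\<close> and \<open>realization\<close> applies to it as well.\<close>

definition graph_of :: "('o, 'a, 'c) computad \<Rightarrow> ('o, 'a, 'c) computad" where
  "graph_of g = g\<lparr>Cells := {}\<rparr>"

lemma graph_of_simps [simp]:
  "Obj (graph_of g) = Obj g" "Arr (graph_of g) = Arr g" "gdom (graph_of g) = gdom g"
  "gcod (graph_of g) = gcod g" "Cells (graph_of g) = {}"
  by (simp_all add: graph_of_def)

lemma fg_mor_graph_of [simp]: "fg_mor (graph_of g) f = fg_mor g f"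
  by (simp add: fg_mor_def letter_start_def letter_end_def)

lemma groupoidal_computad_graph_of: "groupoidal_computad g \<Longrightarrow> groupoidal_computad (graph_of g)"
  by (simp add: groupoidal_computad_def)

lemma glue_graph_of: "glue (graph_of g) \<subseteq> glue g"
  by (auto simp: glue_def)

lemma pre_carrier_graph_of: "pre_carrier (graph_of g) \<subseteq> pre_carrier g"
  by (auto simp: pre_carrier_def)

lemma quo_graph_of_imp: "quo (graph_of g) x = quo (graph_of g) y \<Longrightarrow> quo g x = quo g y"
  using quo_respects[of "graph_of g" "quo g"] glue_graph_of quo_glue by blast

text \<open>A 2-cell whose boundary crosses an edge glues boundary points of its disc to interior
  points of that edge. This is why open edges are studied in the graph alone.\<close>

lemma edge_notin_Field_glue:
  assumes "Cells g = {}" "0 < p" "p < 1"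
  shows "EdgePt a p \<notin> Field (glue g)"
  using assms by (auto simp: Field_def glue_def)

text \<open>The attaching map, with values in the pre-space. The two points with
  \<open>snd z = 0\<close> on the circle are assigned to the source path, a choice without effect in
  the quotient by \<open>bdry_eq_lower\<close>.\<close>

definition bdry :: "('o, 'a, 'c) computad \<Rightarrow> 'c \<Rightarrow> real \<times> real \<Rightarrow> ('o, 'a, 'c) precell" where
  "bdry g \<alpha> z =
     (if snd z \<ge> 0 then word_path (fsrc (csrc g \<alpha>)) (fst (snd (csrc g \<alpha>))) (arccos (- fst z) / pi)
      else word_path (fsrc (ctgt g \<alpha>)) (fst (snd (ctgt g \<alpha>))) (arccos (- fst z) / pi))"

lemma abs_fst_le_1:
  fixes z :: "real \<times> real"
  assumes "norm z \<le> 1"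
  shows "-1 \<le> fst z" "fst z \<le> 1"
  using assms norm_fst_le[of "fst z" "snd z"] by auto

lemma arccos_param:
  fixes z :: "real \<times> real"
  assumes "norm z \<le> 1"
  shows "arccos (- fst z) / pi \<in> {0..1}"
  using abs_fst_le_1[OF assms] arccos_lbound[of "- fst z"] arccos_ubound[of "- fst z"] by auto

text \<open>Only the points \<open>(1, 0)\<close> and \<open>(-1, 0)\<close> are in question; there
  the path parameter is 1 or 0, and source and target are parallel, so both paths are at the same
  vertex.\<close>

lemma bdry_eq_lower:
  assumes g: "groupoidal_computad g" and \<alpha>: "\<alpha> \<in> Cells g" and z: "norm z = 1" "snd z \<le> 0"
  shows "quo (graph_of g) (bdry g \<alpha> z) =
    quo (graph_of g) (word_path (fsrc (ctgt g \<alpha>)) (fst (snd (ctgt g \<alpha>))) (arccos (- fst z) / pi))"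
proof (cases "snd z < 0")
  case True
  then show ?thesis by (simp add: bdry_def)
next
  case False
  then have sz: "snd z = 0" using z by simp
  then have "\<bar>fst z\<bar> = 1" using z(1) by (cases z) (auto simp: norm_Pair)
  then have fz: "fst z = 1 \<or> fst z = -1" by linarith
  obtain x w y where s: "csrc g \<alpha> = (x, w, y)" by (cases "csrc g \<alpha>")
  obtain x' w' y' where t: "ctgt g \<alpha> = (x', w', y')" by (cases "ctgt g \<alpha>")
  have m: "fg_mor (graph_of g) (x, w, y)" "fg_mor (graph_of g) (x', w', y')" "x' = x" "y' = y"
    using g \<alpha> s t by (auto simp: groupoidal_computad_def fsrc_def ftgt_def)
  show ?thesis
    using fz quo_word_path_0[OF m(1)] quo_word_path_0[OF m(2)] quo_word_path_1[OF m(1)] quo_word_path_1[OF m(2)]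
    by (auto simp: bdry_def sz s t m(3,4) fsrc_def)
qed

lemma continuous_map_bdry:
  assumes g: "groupoidal_computad g" and \<alpha>: "\<alpha> \<in> Cells g"
  shows "continuous_map (top_of_set (sphere 0 1)) (realization (graph_of g)) (\<lambda>z. quo (graph_of g) (bdry g \<alpha> z))"
proof -
  let ?D = "sphere (0 :: real \<times> real) 1"
  have par: "continuous_map (top_of_set ?D) (top_of_set {0..1}) (\<lambda>z. arccos (- fst z) / pi)"
  proof -
    have "-1 \<le> - fst z \<and> - fst z \<le> 1" if "z \<in> ?D" for z
      using abs_fst_le_1[of z] that by simp
    then have "continuous_on ?D (\<lambda>z. arccos (- fst z))"
      by (intro continuous_on_arccos continuous_intros) blast
    then have "continuous_on ?D (\<lambda>z. arccos (- fst z) / pi)"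
      by (intro continuous_on_divide continuous_on_const) simp_all
    moreover have "(\<lambda>z. arccos (- fst z) / pi) \<in> ?D \<rightarrow> {0..1}"
      by (rule funcsetI, rule arccos_param) simp
    ultimately show ?thesis unfolding continuous_map_subtopology_eu by blast
  qed
  \<comment> \<open>The path of \<open>f\<close> read off over the circle through the horizontal
    coordinate; the attaching map is pasted from this for source and target.\<close>
  define P where "P f z = quo (graph_of g) (word_path (fsrc f) (fst (snd f)) (arccos (- fst z) / pi))"
    for f and z :: "real \<times> real"
  have P: "continuous_map (top_of_set ?D) (realization (graph_of g)) (P f)" if "fg_mor g f" for f
  proof -
    obtain x w y where f: "f = (x, w, y)" by (cases f)
    then have "fg_mor (graph_of g) (x, w, y)" using that by simp
    from continuous_map_compose[OF par continuous_map_word_path[OF this]] show ?thesis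
      by (simp add: comp_def P_def[abs_def] f fsrc_def)
  qed
  have mor: "fg_mor g (csrc g \<alpha>)" "fg_mor g (ctgt g \<alpha>)"
    using g \<alpha> by (auto simp: groupoidal_computad_def)
  let ?f = "\<lambda>b. if b then P (csrc g \<alpha>) else P (ctgt g \<alpha>)"
  let ?T = "\<lambda>b. if b then {z \<in> ?D. snd z \<ge> 0} else {z \<in> ?D. snd z \<le> 0}"
  have eq: "quo (graph_of g) (bdry g \<alpha> z) = ?f b z" if "z \<in> ?T b" for b z
  proof (cases b)
    case True
    then show ?thesis using that by (simp add: bdry_def P_def)
  next
    case False
    then show ?thesis using that bdry_eq_lower[OF g \<alpha>, of z] by (simp add: P_def)
  qed
  show ?thesis
  proof (rule pasting_lemma_closed[where I = "UNIV :: bool set" and T = ?T and f = ?f])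
    fix b :: bool
    have "closed (?T b)"
    proof -
      have "?T b = ?D \<inter> (if b then {z. 0 \<le> snd z} else {z. snd z \<le> 0})" by auto
      moreover have "closed {z::real \<times> real. 0 \<le> snd z}" "closed {z::real \<times> real. snd z \<le> 0}"
        by (intro closed_Collect_le continuous_intros)+
      ultimately show ?thesis by auto
    qed
    then show "closedin (top_of_set ?D) (?T b)"
      by (rule closed_subset[rotated]) auto
    show "continuous_map (subtopology (top_of_set ?D) (?T b)) (realization (graph_of g)) (?f b)"
      using P[OF mor(1)] P[OF mor(2)] by (cases b) (auto intro!: continuous_map_from_subtopology)
  next
    fix i j z assume "z \<in> topspace (top_of_set ?D) \<inter> ?T i \<inter> ?T j"
    then have zi: "z \<in> ?T i" and zj: "z \<in> ?T j" by (blast, blast)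
    have "?f i z = quo (graph_of g) (bdry g \<alpha> z)" using eq[OF zi] by (rule HOL.sym)
    also have "\<dots> = ?f j z" by (rule eq[OF zj])
    finally show "?f i z = ?f j z" .
  next
    fix z assume "z \<in> topspace (top_of_set ?D)"
    then have "\<exists>b. z \<in> ?T b" by (intro exI[of _ "snd z \<ge> 0"]) auto
    then show "\<exists>j. j \<in> UNIV \<and> z \<in> ?T j \<and> quo (graph_of g) (bdry g \<alpha> z) = ?f j z"
      using eq by blast
  qed simp
qed

lemma quo_disc_bdry:
  assumes "\<alpha> \<in> Cells g" "norm z = 1"
  shows "quo g (DiscPt \<alpha> z) = quo g (bdry g \<alpha> z)"
proof (rule quo_glue, cases "snd z \<ge> 0")
  case True
  then show "(DiscPt \<alpha> z, bdry g \<alpha> z) \<in> glue g"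
    unfolding glue_def bdry_def using assms
    by (intro UnI1 UnI2 CollectI exI[of _ \<alpha>] exI[of _ "fst z"] exI[of _ "snd z"]) simp
next
  case False
  then show "(DiscPt \<alpha> z, bdry g \<alpha> z) \<in> glue g"
    unfolding glue_def bdry_def using assms
    by (intro UnI2 CollectI exI[of _ \<alpha>] exI[of _ "fst z"] exI[of _ "snd z"]) simp
qed

lemma word_path_in_carrier:
  assumes w: "fg_mor g (x, w, y)" and \<tau>: "0 \<le> \<tau>" "\<tau> \<le> 1"
  shows "word_path x w \<tau> \<in> pre_carrier (graph_of g)"
proof (cases "w = []")
  case True
  then show ?thesis using w by (auto simp: word_path_def pre_carrier_def fg_mor_def)
next
  case False
  let ?m = "length w" let ?n = "min (nat \<lfloor>real ?m * \<tau>\<rfloor>) (?m - 1)"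
  have n: "?n < ?m" using False by (cases w) auto
  have "0 \<le> real ?m * \<tau>" "real ?m * \<tau> \<le> real ?m" using \<tau> by (auto simp: mult_left_le)
  then have "real ?n \<le> real ?m * \<tau>" "real ?m * \<tau> \<le> real ?n + 1"
    using n by (auto simp: min_def of_nat_diff Suc_leI) linarith+
  moreover have "fst (w ! ?n) \<in> Arr g" using w n by (auto simp: fg_mor_def)
  ultimately show ?thesis using False by (auto simp: word_path_def Let_def pre_carrier_def)
qed

lemma bdry_in_carrier:
  assumes g: "groupoidal_computad g" and \<alpha>: "\<alpha> \<in> Cells g" and z: "norm z \<le> 1"
  shows "bdry g \<alpha> z \<in> pre_carrier (graph_of g)"
proof -
  have "word_path (fsrc f) (fst (snd f)) (arccos (- fst z) / pi) \<in> pre_carrier (graph_of g)"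
    if "fg_mor g f" for f
  proof -
    obtain x w y where "f = (x, w, y)" by (cases f)
    then show ?thesis
      using word_path_in_carrier[of g x w y "arccos (- fst z) / pi"] arccos_param[OF z] that by (auto simp: fsrc_def)
  qed
  note * = this
  have "fg_mor g (csrc g \<alpha>)" "fg_mor g (ctgt g \<alpha>)"
    using g \<alpha> by (auto simp: groupoidal_computad_def)
  from this[THEN *] show ?thesis by (simp add: bdry_def)
qed

section \<open>Deforming the complex and its graph\<close>

text \<open>Points outside the field of the gluing have singleton classes, so any set of them can be
  removed without splitting a class.\<close>

lemma saturated_compl:
  assumes "T \<inter> Field (glue g) = {}"
  shows "{x \<in> pre_carrier g. quo g x \<in> quo g ` (pre_carrier g - T)} = pre_carrier g - T"
proof -
  have "x \<notin> T" if "quo g x = quo g y" "y \<notin> T" for x y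
    using quo_inj[OF _ that(1)] that(2) assms by blast
  then show ?thesis by blast
qed

lemma saturated_cell:
  assumes "T \<inter> Field (glue g) = {}" "T \<subseteq> pre_carrier g"
  shows "{x \<in> pre_carrier g. quo g x \<in> quo g ` T} = T"
proof -
  have "x \<in> T" if "quo g x = quo g y" "y \<in> T" for x y
    using quo_inj[OF _ that(1)[symmetric]] that(2) assms(1) by blast
  then show ?thesis using assms(2) by blast
qed

lemma openin_quo_image:
  assumes "openin (pre_top g) S" "{x \<in> pre_carrier g. quo g x \<in> quo g ` S} = S"
  shows "openin (realization g) (quo g ` S)"
proof -
  have "S \<subseteq> pre_carrier g" using openin_subset[OF assms(1)] by simp
  then show ?thesis unfolding openin_realization assms(2) using assms(1) by blast
qed

lemma openin_quo_disc:
  assumes "\<alpha> \<in> Cells g" "open W" "W \<subseteq> ball 0 1"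
  shows "openin (realization g) ((\<lambda>z. quo g (DiscPt \<alpha> z)) ` W)"
proof -
  have sub: "DiscPt \<alpha> ` W \<subseteq> pre_carrier g"
    using assms(1,3) by (force simp: pre_carrier_def)
  have "W \<inter> cball 0 1 = W" using assms(3) by force
  then have o: "openin (pre_top g) (DiscPt \<alpha> ` W)" using openin_pre_disc[OF assms(1,2)] by simp
  have "DiscPt \<alpha> ` W \<inter> Field (glue g) = {}"
  proof -
    have "DiscPt \<alpha> z \<notin> Field (glue g)" if "z \<in> W" for z
      using assms(3) that by (intro disc_notin_Field_glue) auto
    then show ?thesis by blast
  qed
  from openin_quo_image[OF o saturated_cell[OF this sub]] show ?thesis by (simp add: image_image)
qed

lemma quo_disc_inj:
  assumes "quo g (DiscPt \<alpha> z) = quo g x" "norm z < 1"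
  shows "x = DiscPt \<alpha> z"
  using quo_inj[OF disc_notin_Field_glue[OF assms(2)] assms(1)] .

lemma openin_quo_edge:
  assumes "Cells g = {}" "a \<in> Arr g" "open W" "W \<subseteq> {0<..<1}"
  shows "openin (realization g) ((\<lambda>p. quo g (EdgePt a p)) ` W)"
proof -
  have sub: "EdgePt a ` W \<subseteq> pre_carrier g"
    using assms(2,4) by (force simp: pre_carrier_def)
  have "W \<inter> {0..1} = W" using assms(4) by force
  then have o: "openin (pre_top g) (EdgePt a ` W)" using openin_pre_edge[OF assms(2,3)] by simp
  have "EdgePt a ` W \<inter> Field (glue g) = {}"
  proof -
    have "EdgePt a p \<notin> Field (glue g)" if "p \<in> W" for p
      using assms(4) that by (intro edge_notin_Field_glue[OF assms(1)]) auto
    then show ?thesis by blast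
  qed
  from openin_quo_image[OF o saturated_cell[OF this sub]] show ?thesis by (simp add: image_image)
qed

lemma quo_edge_inj:
  assumes "Cells g = {}" "quo g (EdgePt a p) = quo g x" "0 < p" "p < 1"
  shows "x = EdgePt a p"
  using quo_inj[OF edge_notin_Field_glue[OF assms(1,3,4)] assms(2)] .

section \<open>Radial retraction of punctured discs onto the graph\<close>

definition uncentred :: "('o, 'a, 'c) computad \<Rightarrow> ('o, 'a, 'c) precell set" where
  "uncentred g = pre_carrier g - {DiscPt \<alpha> 0 | \<alpha>. True}"

definition unmiddled :: "('o, 'a, 'c) computad \<Rightarrow> ('o, 'a, 'c) precell set" where
  "unmiddled g = pre_carrier g - {EdgePt a (1/2) | a. True}"

lemma saturated_uncentred: "{x \<in> pre_carrier g. quo g x \<in> quo g ` uncentred g} = uncentred g"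
  unfolding uncentred_def
  by (rule saturated_compl) (use disc_notin_Field_glue[of 0 _ g] in auto)

lemma saturated_unmiddled:
  "Cells g = {} \<Longrightarrow> {x \<in> pre_carrier g. quo g x \<in> quo g ` unmiddled g} = unmiddled g"
  unfolding unmiddled_def
  by (rule saturated_compl) (auto dest: edge_notin_Field_glue[of g "1/2"])

lemma Vert_in_carrier: "Vert v \<in> pre_carrier g \<longleftrightarrow> v \<in> Obj g"
  by (auto simp: pre_carrier_def)

lemma EdgePt_in_carrier: "EdgePt a p \<in> pre_carrier g \<longleftrightarrow> a \<in> Arr g \<and> p \<in> {0..1}"
  by (auto simp: pre_carrier_def)

lemma DiscPt_in_carrier: "DiscPt \<alpha> z \<in> pre_carrier g \<longleftrightarrow> \<alpha> \<in> Cells g \<and> z \<in> cball 0 1"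
  unfolding pre_carrier_def by blast

lemmas pre_carrier_simps = Vert_in_carrier EdgePt_in_carrier DiscPt_in_carrier

lemma uncentred_simps:
  shows Vert_in_uncentred: "Vert v \<in> uncentred g \<longleftrightarrow> v \<in> Obj g"
    and EdgePt_in_uncentred: "EdgePt a p \<in> uncentred g \<longleftrightarrow> a \<in> Arr g \<and> p \<in> {0..1}"
    and DiscPt_in_uncentred: "DiscPt \<alpha> z \<in> uncentred g \<longleftrightarrow> \<alpha> \<in> Cells g \<and> z \<in> cball 0 1 - {0}"
  by (simp_all add: uncentred_def pre_carrier_simps)

lemma unmiddled_simps:
  shows Vert_in_unmiddled: "Vert v \<in> unmiddled g \<longleftrightarrow> v \<in> Obj g"
    and EdgePt_in_unmiddled: "EdgePt a p \<in> unmiddled g \<longleftrightarrow> a \<in> Arr g \<and> p \<in> {0..1} - {1/2}"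
    and DiscPt_in_unmiddled: "DiscPt \<alpha> z \<in> unmiddled g \<longleftrightarrow> \<alpha> \<in> Cells g \<and> z \<in> cball 0 1"
  by (simp_all add: unmiddled_def pre_carrier_simps conj_assoc)

lemma openin_uncentred: "openin (realization g) (quo g ` uncentred g)"
proof (rule openin_quo_image[OF _ saturated_uncentred])
  have "openin (top_of_set (cball 0 1)) (cball 0 1 - {0 :: real \<times> real})"
    by (simp add: openin_delete)
  moreover have "{z \<in> cball 0 1. DiscPt \<alpha> z \<in> uncentred g} = cball 0 1 - {0}" if "\<alpha> \<in> Cells g" for \<alpha>
    using that by (auto simp: uncentred_simps)
  moreover have "{p \<in> {0..1}. EdgePt a p \<in> uncentred g} = {0..1}" if "a \<in> Arr g" for a
    using that by (auto simp: uncentred_simps)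
  ultimately show "openin (pre_top g) (uncentred g)"
    unfolding openin_pre_top pre_open_def by (auto simp: uncentred_def simp del: atLeastAtMost_iff)
qed

lemma openin_unmiddled: 
  assumes "Cells g = {}"
  shows "openin (realization g) (quo g ` unmiddled g)"
proof (rule openin_quo_image[OF _ saturated_unmiddled[OF assms]])
  have "openin (top_of_set {0..1}) ({0..1} - {1/2 :: real})"
    by (simp add: openin_delete)
  moreover have "{p \<in> {0..1}. EdgePt a p \<in> unmiddled g} = {0..1} - {1/2}" if "a \<in> Arr g" for a
    using that by (auto simp: unmiddled_simps)
  ultimately show "openin (pre_top g) (unmiddled g)"
    unfolding openin_pre_top pre_open_def using assms by (auto simp: unmiddled_def simp del: atLeastAtMost_iff)
qed

text \<open>The straight-line homotopy from \<open>z\<close> to \<open>z / norm z\<close>, written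
  as a rescaling of \<open>z\<close>.\<close>

fun push :: "real \<Rightarrow> ('o, 'a, 'c) precell \<Rightarrow> ('o, 'a, 'c) precell" where
  "push t (DiscPt \<alpha> z) = DiscPt \<alpha> (((1 - t) + t / norm z) *\<^sub>R z)"
| "push t x = x"

text \<open>The end of the radial push, transported into the graph by the attaching map:
  \<open>sgn z\<close> is the radial projection of \<open>z\<close> to the unit circle. It is
  meaningful away from the centre, that is on \<open>uncentred g\<close>.\<close>

fun flat :: "('o, 'a, 'c) computad \<Rightarrow> ('o, 'a, 'c) precell \<Rightarrow> ('o, 'a, 'c) precell" where
  "flat g (DiscPt \<alpha> z) = bdry g \<alpha> (sgn z)"
| "flat g x = x"

lemma flat_word_path: "flat g (word_path x w \<tau>) = word_path x w \<tau>"
  by (simp add: word_path_def Let_def)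

lemma push_word_path: "push t (word_path x w \<tau>) = word_path x w \<tau>"
  by (simp add: word_path_def Let_def)

lemma glue_cases:
  assumes "(x, y) \<in> glue g"
  obtains a where "x = EdgePt a 0" "y = Vert (gdom g a)" "a \<in> Arr g"
    | a where "x = EdgePt a 1" "y = Vert (gcod g a)" "a \<in> Arr g"
    | \<alpha> z where "\<alpha> \<in> Cells g" "norm z = 1" "snd z \<ge> 0" "x = DiscPt \<alpha> z"
        "y = word_path (fsrc (csrc g \<alpha>)) (fst (snd (csrc g \<alpha>))) (arccos (- fst z) / pi)"
    | \<alpha> z where "\<alpha> \<in> Cells g" "norm z = 1" "snd z \<le> 0" "x = DiscPt \<alpha> z"
        "y = word_path (fsrc (ctgt g \<alpha>)) (fst (snd (ctgt g \<alpha>))) (arccos (- fst z) / pi)"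
  using assms unfolding glue_def by fastforce

lemma flat_glue:
  assumes g: "groupoidal_computad g" and xy: "(x, y) \<in> glue g"
  shows "quo (graph_of g) (flat g x) = quo (graph_of g) (flat g y)"
proof -
  have sg: "sgn z = z" if "norm z = 1" for z :: "real \<times> real" using that by (simp add: sgn_div_norm)
  from xy show ?thesis
  proof (cases rule: glue_cases)
    case (3 \<alpha> z)
    then show ?thesis by (simp add: flat_word_path sg bdry_def)
  next
    case (4 \<alpha> z)
    then show ?thesis using bdry_eq_lower[OF g, of \<alpha> z] by (simp add: flat_word_path sg)
  qed (simp_all add: quo_edge_0 quo_edge_1)
qed

text \<open>Glued points of a disc lie on the unit circle, where the scaling factor is 1. So the
  homotopy is stationary on all gluing pairs and descends to the quotient.\<close>

lemma push_glue:
  assumes "(x, y) \<in> glue g"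
  shows "push t x = x" "push t y = y"
proof -
  show "push t x = x" using assms by (cases rule: glue_cases) (simp_all add: push_word_path)
  show "push t y = y" using assms by (cases rule: glue_cases) (simp_all add: push_word_path)
qed

lemma flat_in_carrier:
  assumes g: "groupoidal_computad g" and x: "x \<in> uncentred g"
  shows "flat g x \<in> pre_carrier (graph_of g)"
proof (cases x)
  case (DiscPt \<alpha> z)
  then show ?thesis using x bdry_in_carrier[OF g, of \<alpha> "sgn z"] by (auto simp: uncentred_simps norm_sgn)
qed (use x in \<open>auto simp: uncentred_simps pre_carrier_def\<close>)

text \<open>The new norm is \<open>(1 - t) * norm z + t\<close>, a convex combination of
  \<open>norm z\<close> and 1.\<close>

lemma push_scale:
  fixes z :: "real \<times> real"
  assumes "t \<in> {0..1}" "z \<in> cball 0 1 - {0}"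
  shows "((1 - t) + t / norm z) *\<^sub>R z \<in> cball 0 1 - {0}"
proof -
  have nz: "norm z > 0" "norm z \<le> 1" using assms by auto
  have pos: "(1 - t) + t / norm z > 0"
  proof (cases "t = 0")
    case False
    then have "t / norm z > 0" using assms(1) nz by simp
    then show ?thesis using assms(1) by (simp add: add_nonneg_pos)
  qed simp
  have "norm (((1 - t) + t / norm z) *\<^sub>R z) = ((1 - t) + t / norm z) * norm z"
    using pos by simp
  also have "\<dots> = (1 - t) * norm z + t" using nz by (simp add: distrib_right)
  also have "\<dots> \<le> (1 - t) * 1 + t" using assms(1) nz by (intro add_right_mono mult_left_mono) auto
  finally show ?thesis using pos nz by auto
qed

lemma push_in_uncentred:
  assumes "t \<in> {0..1}" "x \<in> uncentred g"
  shows "push t x \<in> uncentred g"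
proof (cases x)
  case (DiscPt \<alpha> z)
  then show ?thesis using assms(2) push_scale[OF assms(1), of z]
    by (simp only: uncentred_simps push.simps simp_thms)
qed (use assms in \<open>auto simp: uncentred_simps\<close>)

lemma push_0: "push 0 x = x"
  by (cases x) auto

lemma quo_push_1:
  assumes "x \<in> uncentred g"
  shows "quo g (push 1 x) = quo g (flat g x)"
proof (cases x)
  case (DiscPt \<alpha> z)
  then show ?thesis using assms quo_disc_bdry[of \<alpha> g "sgn z"]
    by (simp add: uncentred_simps norm_sgn sgn_div_norm divide_inverse)
qed auto

text \<open>The target is the realization of the graph with its own topology, in which open edges
  are open.\<close>

lemma uncentred_retraction:
  assumes g: "groupoidal_computad g"
  obtains \<rho> where "continuous_map (subtopology (realization g) (quo g ` uncentred g)) (realization (graph_of g)) \<rho>"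
    "\<And>x. x \<in> uncentred g \<Longrightarrow> \<rho> (quo g x) = quo (graph_of g) (flat g x)"
proof (rule continuous_map_realization[OF openin_uncentred saturated_uncentred[symmetric],
      where Z = "realization (graph_of g)" and f = "\<lambda>x. quo (graph_of g) (flat g x)"])
  fix v assume "Vert v \<in> uncentred g"
  then show "quo (graph_of g) (flat g (Vert v)) \<in> topspace (realization (graph_of g))"
    by (auto simp: topspace_realization uncentred_simps pre_carrier_def)
next
  fix a assume a: "a \<in> Arr g"
  then have "continuous_map (top_of_set {0..1}) (realization (graph_of g)) (\<lambda>p. quo (graph_of g) (EdgePt a p))"
    by (intro continuous_map_quo_edge) simp
  moreover have "{p \<in> {0..1}. EdgePt a p \<in> uncentred g} = {0..1}" using a by (auto simp: uncentred_simps)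
  ultimately show "continuous_map (top_of_set {p \<in> {0..1}. EdgePt a p \<in> uncentred g}) (realization (graph_of g))
      (\<lambda>p. quo (graph_of g) (flat g (EdgePt a p)))" by simp
next
  fix \<alpha> assume \<alpha>: "\<alpha> \<in> Cells g"
  have "continuous_map (top_of_set (cball 0 1 - {0})) (top_of_set (sphere 0 1)) (sgn :: real \<times> real \<Rightarrow> _)"
    by (auto simp: norm_sgn intro!: continuous_intros)
  from continuous_map_compose[OF this continuous_map_bdry[OF g \<alpha>]]
  have "continuous_map (top_of_set (cball 0 1 - {0})) (realization (graph_of g)) (\<lambda>z. quo (graph_of g) (bdry g \<alpha> (sgn z)))"
    by (simp add: comp_def)
  moreover have "{z \<in> cball 0 1. DiscPt \<alpha> z \<in> uncentred g} = cball 0 1 - {0}"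
    using \<alpha> by (auto simp: uncentred_simps)
  ultimately show "continuous_map (top_of_set {z \<in> cball 0 1. DiscPt \<alpha> z \<in> uncentred g}) (realization (graph_of g))
      (\<lambda>z. quo (graph_of g) (flat g (DiscPt \<alpha> z)))" by simp
next
  fix x y assume "(x, y) \<in> glue g"
  then show "quo (graph_of g) (flat g x) = quo (graph_of g) (flat g y)" by (rule flat_glue[OF g])
qed (rule that)

text \<open>Points are equivalence classes, and a class for \<open>graph_of g\<close> is in general
  only part of a class for \<open>g\<close>, so the inclusion has to be built as a map induced on
  quotients.\<close>

lemma graph_inclusion:
  obtains \<iota> where "continuous_map (realization (graph_of g)) (realization g) \<iota>"
    "\<And>x. x \<in> pre_carrier (graph_of g) \<Longrightarrow> \<iota> (quo (graph_of g) x) = quo g x"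
proof -
  let ?\<Gamma> = "graph_of g"
  have V: "openin (realization ?\<Gamma>) (topspace (realization ?\<Gamma>))" by simp
  have S: "pre_carrier ?\<Gamma> = {x \<in> pre_carrier ?\<Gamma>. quo ?\<Gamma> x \<in> topspace (realization ?\<Gamma>)}"
    by (auto simp: topspace_realization)
  obtain \<iota> where \<iota>: "continuous_map (subtopology (realization ?\<Gamma>) (topspace (realization ?\<Gamma>))) (realization g) \<iota>"
    "\<And>x. x \<in> pre_carrier ?\<Gamma> \<Longrightarrow> \<iota> (quo ?\<Gamma> x) = quo g x"
  proof (rule continuous_map_realization[OF V S, where Z = "realization g" and f = "quo g"])
    fix v assume "Vert v \<in> pre_carrier ?\<Gamma>"
    then show "quo g (Vert v) \<in> topspace (realization g)"
      using pre_carrier_graph_of by (auto simp: topspace_realization)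
  next
    fix a assume a: "a \<in> Arr ?\<Gamma>"
    then have "{p \<in> {0..1}. EdgePt a p \<in> pre_carrier ?\<Gamma>} = {0..1}" by (auto simp: pre_carrier_def)
    then show "continuous_map (top_of_set {p \<in> {0..1}. EdgePt a p \<in> pre_carrier ?\<Gamma>}) (realization g)
        (\<lambda>p. quo g (EdgePt a p))"
      using continuous_map_quo_edge[of a g] a by simp
  next
    fix x y assume "(x, y) \<in> glue ?\<Gamma>"
    then show "quo g x = quo g y" using quo_glue[OF subsetD[OF glue_graph_of]] by blast
  next
    fix \<alpha> assume "\<alpha> \<in> Cells ?\<Gamma>"
    then show "continuous_map (top_of_set {z \<in> cball 0 1. DiscPt \<alpha> z \<in> pre_carrier ?\<Gamma>}) (realization g)
        (\<lambda>z. quo g (DiscPt \<alpha> z))" by simp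
  qed (rule that)
  show thesis
  proof (rule that)
    show "continuous_map (realization ?\<Gamma>) (realization g) \<iota>"
      using \<iota>(1) by (simp only: subtopology_topspace)
  qed (rule \<iota>(2))
qed

lemma uncentred_homotopy:
  obtains H where "continuous_map (prod_topology (top_of_set {0..1}) (subtopology (realization g) (quo g ` uncentred g)))
      (subtopology (realization g) (quo g ` uncentred g)) H"
    "\<And>t x. t \<in> {0..1} \<Longrightarrow> x \<in> uncentred g \<Longrightarrow> H (t, quo g x) = quo g (push t x)"
proof -
  let ?T = "top_of_set {0..1 :: real}" let ?U = "quo g ` uncentred g"
  have snd: "continuous_map (prod_topology ?T Y) Z (\<lambda>(t, p). h p)" if "continuous_map Y Z h" for Y Z h
    using continuous_map_compose[OF continuous_map_snd that] by (simp add: comp_def case_prod_unfold)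
  obtain H where H: "continuous_map (prod_topology ?T (subtopology (realization g) ?U)) (realization g) H"
    "\<And>t x. t \<in> topspace ?T \<Longrightarrow> x \<in> uncentred g \<Longrightarrow> H (t, quo g x) = quo g (push t x)"
  proof (rule continuous_map_prod_realization[OF openin_uncentred saturated_uncentred[symmetric],
        where T = ?T and Z = "realization g" and f = "\<lambda>(t, x). quo g (push t x)"])
    show "locally_compact_space ?T" by (simp add: compact_imp_locally_compact_space compact_space_subtopology)
    show "Hausdorff_space ?T" by (simp add: Hausdorff_space_subtopology)
  next
    fix v assume "Vert v \<in> uncentred g"
    then show "continuous_map ?T (realization g) (\<lambda>t. case (t, Vert v) of (t, x) \<Rightarrow> quo g (push t x))"
      by (auto simp: topspace_realization uncentred_simps pre_carrier_def)
  next
    fix a assume a: "a \<in> Arr g"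
    then have "{p \<in> {0..1}. EdgePt a p \<in> uncentred g} = {0..1}" by (auto simp: uncentred_simps)
    then show "continuous_map (prod_topology ?T (top_of_set {p \<in> {0..1}. EdgePt a p \<in> uncentred g})) (realization g)
        (\<lambda>(t, p). case (t, EdgePt a p) of (t, x) \<Rightarrow> quo g (push t x))"
      using snd[OF continuous_map_quo_edge[OF a]] by simp
  next
    fix \<alpha> assume \<alpha>: "\<alpha> \<in> Cells g"
    then have eq: "{z \<in> cball 0 1. DiscPt \<alpha> z \<in> uncentred g} = cball 0 1 - {0}" by (auto simp: uncentred_simps)
    have "continuous_on ({0..1} \<times> (cball 0 1 - {0 :: real \<times> real})) (\<lambda>x. ((1 - fst x) + fst x / norm (snd x)) *\<^sub>R snd x)"
      by (intro continuous_intros) auto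
    moreover have "(\<lambda>x. ((1 - fst x) + fst x / norm (snd x)) *\<^sub>R snd x) \<in>
        {0..1} \<times> (cball 0 1 - {0 :: real \<times> real}) \<rightarrow> cball 0 1"
      using push_scale by fastforce
    ultimately have "continuous_map (prod_topology ?T (top_of_set (cball 0 1 - {0 :: real \<times> real}))) (top_of_set (cball 0 1))
       (\<lambda>x. ((1 - fst x) + fst x / norm (snd x)) *\<^sub>R snd x)"
      by (simp only: prod_topology_subtopology_eu continuous_map_subtopology_eu simp_thms)
    from continuous_map_compose[OF this continuous_map_quo_disc[OF \<alpha>]]
    show "continuous_map (prod_topology ?T (top_of_set {z \<in> cball 0 1. DiscPt \<alpha> z \<in> uncentred g})) (realization g)
        (\<lambda>(t, z). case (t, DiscPt \<alpha> z) of (t, x) \<Rightarrow> quo g (push t x))"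
      unfolding eq by (simp add: comp_def case_prod_unfold)
  next
    fix t x y assume "(x, y) \<in> glue g"
    then show "(case (t, x) of (t, x) \<Rightarrow> quo g (push t x)) = (case (t, y) of (t, x) \<Rightarrow> quo g (push t x))"
      by (simp add: push_glue quo_glue)
  qed auto
  \<comment> \<open>\<open>H\<close> was built as a map into the whole complex; the push never
    reaches a centre, so the codomain can be cut down.\<close>
  have "H \<in> topspace (prod_topology ?T (subtopology (realization g) ?U)) \<rightarrow> ?U"
    using H(2) push_in_uncentred by fastforce
  then have "continuous_map (prod_topology ?T (subtopology (realization g) ?U)) (subtopology (realization g) ?U) H"
    using H(1) by (simp add: continuous_map_in_subtopology)
  with H(2) show thesis using that by simp
qed

lemma homotopic_withI:
  assumes "continuous_map (prod_topology (top_of_set {0..1::real}) X) Y H"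
    and "\<And>x. x \<in> topspace X \<Longrightarrow> H (0, x) = p x" "\<And>x. x \<in> topspace X \<Longrightarrow> H (1, x) = q x"
  shows "homotopic_with (\<lambda>_. True) X Y p q"
  using assms by (subst homotopic_with) blast+

lemma acyclic_in_uncentred:
  assumes g: "groupoidal_computad g" and n: "acyclic_in n (realization (graph_of g))"
  shows "acyclic_in n (subtopology (realization g) (quo g ` uncentred g))"
proof -
  let ?U = "quo g ` uncentred g" let ?\<Gamma> = "graph_of g"
  obtain \<rho> where \<rho>: "continuous_map (subtopology (realization g) ?U) (realization ?\<Gamma>) \<rho>"
    "\<And>x. x \<in> uncentred g \<Longrightarrow> \<rho> (quo g x) = quo ?\<Gamma> (flat g x)"
    by (rule uncentred_retraction[OF g]) blast
  obtain \<iota> where \<iota>: "continuous_map (realization ?\<Gamma>) (realization g) \<iota>"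
    "\<And>x. x \<in> pre_carrier ?\<Gamma> \<Longrightarrow> \<iota> (quo ?\<Gamma> x) = quo g x"
    by (rule graph_inclusion) blast
  obtain H where H: "continuous_map (prod_topology (top_of_set {0..1}) (subtopology (realization g) ?U))
      (subtopology (realization g) ?U) H"
    "\<And>t x. t \<in> {0..1} \<Longrightarrow> x \<in> uncentred g \<Longrightarrow> H (t, quo g x) = quo g (push t x)"
    by (rule uncentred_homotopy) blast
  have top: "topspace (subtopology (realization g) ?U) = ?U"
    using openin_subset[OF openin_uncentred[of g]] by auto
  show ?thesis
  proof (rule acyclic_in_dominated[OF \<rho>(1) _ _ n])
    have "pre_carrier ?\<Gamma> \<subseteq> uncentred g" by (auto simp: uncentred_def pre_carrier_def)
    then show "continuous_map (realization ?\<Gamma>) (subtopology (realization g) ?U) \<iota>"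
      using \<iota> by (auto simp: continuous_map_in_subtopology topspace_realization)
    show "homotopic_with (\<lambda>_. True) (subtopology (realization g) ?U) (subtopology (realization g) ?U) (\<iota> \<circ> \<rho>) id"
    proof (rule homotopic_with_symD, rule homotopic_withI[OF H(1)])
      fix x assume "x \<in> topspace (subtopology (realization g) ?U)"
      then obtain y where y: "y \<in> uncentred g" "x = quo g y" unfolding top by blast
      show "H (0, x) = id x" using H(2)[of 0 y] y by (simp add: push_0)
      show "H (1, x) = (\<iota> \<circ> \<rho>) x"
        using H(2)[of 1 y] y \<rho>(2)[of y] \<iota>(2)[OF flat_in_carrier[OF g y(1)]] quo_push_1[OF y(1)] by simp
    qed
  qed
qed

text \<open>The analogue of \<open>push\<close> one dimension down: each half of an edge moves
  linearly to its end. The midpoint, which the test sends to 1, is excluded by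
  \<open>unmiddled\<close>.\<close>

fun slide :: "real \<Rightarrow> ('o, 'a, 'c) precell \<Rightarrow> ('o, 'a, 'c) precell" where
  "slide t (EdgePt a p) = EdgePt a ((1 - t) * p + t * (if p < 1/2 then 0 else 1))"
| "slide t x = x"

text \<open>Plays the role of \<open>flat\<close> for graphs, where discs are absent and their value
  is a mere default.\<close>

fun near_vert :: "('o, 'a, 'c) computad \<Rightarrow> ('o, 'a, 'c) precell \<Rightarrow> 'o" where
  "near_vert g (Vert v) = v"
| "near_vert g (EdgePt a p) = (if p < 1/2 then gdom g a else gcod g a)"
| "near_vert g (DiscPt \<alpha> z) = undefined"

lemma near_vert_glue: "Cells g = {} \<Longrightarrow> (x, y) \<in> glue g \<Longrightarrow> near_vert g x = near_vert g y"
  by (auto simp: glue_def)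

lemma slide_glue: "Cells g = {} \<Longrightarrow> (x, y) \<in> glue g \<Longrightarrow> slide t x = x \<and> slide t y = y"
  by (auto simp: glue_def)

text \<open>The only jump is at 1/2, and that point has been removed.\<close>

lemma continuous_map_step:
  assumes "c \<in> topspace Z" "d \<in> topspace Z"
  shows "continuous_map (top_of_set ({0..1} - {1/2 :: real})) Z (\<lambda>p. if p < 1/2 then c else d)"
  unfolding continuous_map_def
proof (intro conjI allI impI)
  fix W assume "openin Z W"
  let ?E = "{0..1} - {1/2 :: real}"
  have "{p \<in> topspace (top_of_set ?E). (if p < 1/2 then c else d) \<in> W} =
      ?E \<inter> ((if c \<in> W then {..<1/2} else {}) \<union> (if d \<in> W then {1/2<..} else {}))"
    by auto
  then show "openin (top_of_set ?E) {p \<in> topspace (top_of_set ?E). (if p < 1/2 then c else d) \<in> W}"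
    by (simp only:) (intro openin_open_Int open_Un, simp_all)
qed (use assms in auto)

lemma unmiddled_retraction:
  assumes g: "groupoidal_computad g" and C: "Cells g = {}"
  obtains \<rho> where "continuous_map (subtopology (realization g) (quo g ` unmiddled g)) (discrete_topology (Obj g)) \<rho>"
    "\<And>x. x \<in> unmiddled g \<Longrightarrow> \<rho> (quo g x) = near_vert g x"
proof (rule continuous_map_realization[OF openin_unmiddled[OF C] saturated_unmiddled[OF C, symmetric],
      where Z = "discrete_topology (Obj g)" and f = "near_vert g"])
  fix a assume a: "a \<in> Arr g"
  then have "{p \<in> {0..1}. EdgePt a p \<in> unmiddled g} = {0..1} - {1/2}" by (auto simp: unmiddled_simps)
  moreover have "gdom g a \<in> Obj g" "gcod g a \<in> Obj g" using g a by (auto simp: groupoidal_computad_def)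
  ultimately show "continuous_map (top_of_set {p \<in> {0..1}. EdgePt a p \<in> unmiddled g}) (discrete_topology (Obj g))
      (\<lambda>p. near_vert g (EdgePt a p))"
    using continuous_map_step[of "gdom g a" "discrete_topology (Obj g)" "gcod g a"] by simp
next
  fix x y assume "(x, y) \<in> glue g"
  then show "near_vert g x = near_vert g y" by (rule near_vert_glue[OF C])
next
  fix v assume "Vert v \<in> unmiddled g"
  then show "near_vert g (Vert v) \<in> topspace (discrete_topology (Obj g))" by (simp add: unmiddled_simps)
next
  fix \<alpha> assume "\<alpha> \<in> Cells g"
  then show "continuous_map (top_of_set {z \<in> cball 0 1. DiscPt \<alpha> z \<in> unmiddled g}) (discrete_topology (Obj g))
      (\<lambda>z. near_vert g (DiscPt \<alpha> z))" using C by simp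
qed (rule that)

lemma slide_in_unmiddled:
  assumes "t \<in> {0..1}" "x \<in> unmiddled g"
  shows "slide t x \<in> unmiddled g"
proof (cases x)
  case (EdgePt a p)
  then have a: "a \<in> Arr g" "0 \<le> p" "p \<le> 1" "p \<noteq> 1/2" using assms by (auto simp: unmiddled_simps)
  have t: "0 \<le> t" "t \<le> 1" using assms by auto
  show ?thesis
  proof (cases "p < 1/2")
    case True
    then have "(1 - t) * p \<le> 1 * p" using a t by (intro mult_right_mono) auto
    then show ?thesis using True a t EdgePt by (simp add: unmiddled_simps)
  next
    case False
    then have p: "p > 1/2" using a by simp
    have "(1 - t) * p + t = p + t * (1 - p)" by (simp add: algebra_simps)
    moreover have "t * (1 - p) \<ge> 0" "t * (1 - p) \<le> 1 * (1 - p)" using a t by (simp, intro mult_right_mono) auto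
    ultimately have "(1 - t) * p + t > 1/2" "(1 - t) * p + t \<le> 1" using p by auto
    then show ?thesis using False a EdgePt by (simp add: unmiddled_simps)
  qed
next
  case (Vert v)
  then show ?thesis using assms(2) by simp
next
  case (DiscPt \<alpha> z)
  then show ?thesis using assms(2) by simp
qed

lemma slide_0: "slide 0 x = x"
  by (cases x) auto

lemma quo_slide_1:
  assumes "x \<in> unmiddled g" "Cells g = {}"
  shows "quo g (slide 1 x) = quo g (Vert (near_vert g x))"
  using assms by (cases x) (auto simp: unmiddled_simps quo_edge_0 quo_edge_1)

lemma near_vert_in_Obj:
  assumes "groupoidal_computad g" "x \<in> unmiddled g" "Cells g = {}"
  shows "near_vert g x \<in> Obj g"
  using assms by (cases x) (auto simp: unmiddled_simps groupoidal_computad_def)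

lemma unmiddled_homotopy:
  assumes C: "Cells g = {}"
  obtains H where "continuous_map (prod_topology (top_of_set {0..1}) (subtopology (realization g) (quo g ` unmiddled g)))
      (subtopology (realization g) (quo g ` unmiddled g)) H"
    "\<And>t x. t \<in> {0..1} \<Longrightarrow> x \<in> unmiddled g \<Longrightarrow> H (t, quo g x) = quo g (slide t x)"
proof -
  let ?T = "top_of_set {0..1 :: real}" let ?U = "quo g ` unmiddled g"
  obtain H where H: "continuous_map (prod_topology ?T (subtopology (realization g) ?U)) (realization g) H"
    "\<And>t x. t \<in> topspace ?T \<Longrightarrow> x \<in> unmiddled g \<Longrightarrow> H (t, quo g x) = quo g (slide t x)"
  proof (rule continuous_map_prod_realization[OF openin_unmiddled[OF C] saturated_unmiddled[OF C, symmetric],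
        where T = ?T and Z = "realization g" and f = "\<lambda>(t, x). quo g (slide t x)"])
    show "locally_compact_space ?T" by (simp add: compact_imp_locally_compact_space compact_space_subtopology)
    show "Hausdorff_space ?T" by (simp add: Hausdorff_space_subtopology)
  next
    fix v assume "Vert v \<in> unmiddled g"
    then show "continuous_map ?T (realization g) (\<lambda>t. case (t, Vert v) of (t, x) \<Rightarrow> quo g (slide t x))"
      by (auto simp: topspace_realization unmiddled_simps pre_carrier_def)
  next
    fix a assume a: "a \<in> Arr g"
    let ?E = "{0..1} - {1/2 :: real}"
    have eq: "{p \<in> {0..1}. EdgePt a p \<in> unmiddled g} = ?E" using a by (auto simp: unmiddled_simps)
    \<comment> \<open>The end towards which a point slides is locally constant on the punctured
      interval.\<close>
    have "continuous_on ?E (\<lambda>p. if p < 1/2 then 0 else 1 :: real)"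
      using continuous_map_step[of 0 euclideanreal 1] by simp
    then have "continuous_on ({0..1::real} \<times> ?E) (\<lambda>x. if snd x < 1/2 then 0 else 1 :: real)"
      by (rule continuous_on_compose2[where f = snd]) (auto intro: continuous_intros)
    then have "continuous_on ({0..1::real} \<times> ?E) (\<lambda>x. (1 - fst x) * snd x + fst x * (if snd x < 1/2 then 0 else 1))"
      by (intro continuous_on_add continuous_on_mult continuous_intros)
    moreover have "(\<lambda>x. (1 - fst x) * snd x + fst x * (if snd x < 1/2 then 0 else 1)) \<in> {0..1::real} \<times> ?E \<rightarrow> {0..1}"
    proof
      fix x assume "x \<in> {0..1::real} \<times> ?E"
      then show "(1 - fst x) * snd x + fst x * (if snd x < 1/2 then 0 else 1) \<in> {0..1}"
        using slide_in_unmiddled[of "fst x" "EdgePt a (snd x)" g] a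
        by (cases x) (auto simp: unmiddled_simps simp del: atLeastAtMost_iff)
    qed
    ultimately have "continuous_map (prod_topology ?T (top_of_set ?E)) (top_of_set {0..1})
       (\<lambda>x. (1 - fst x) * snd x + fst x * (if snd x < 1/2 then 0 else 1))"
      by (simp only: prod_topology_subtopology_eu continuous_map_subtopology_eu simp_thms)
    from continuous_map_compose[OF this continuous_map_quo_edge[OF a]]
    show "continuous_map (prod_topology ?T (top_of_set {p \<in> {0..1}. EdgePt a p \<in> unmiddled g})) (realization g)
        (\<lambda>(t, p). case (t, EdgePt a p) of (t, x) \<Rightarrow> quo g (slide t x))"
      unfolding eq by (simp add: comp_def case_prod_unfold)
  next
    fix t x y assume "(x, y) \<in> glue g"
    then show "(case (t, x) of (t, x) \<Rightarrow> quo g (slide t x)) = (case (t, y) of (t, x) \<Rightarrow> quo g (slide t x))"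
      by (simp add: slide_glue[OF C] quo_glue)
  qed (use C in auto)
  have "H \<in> topspace (prod_topology ?T (subtopology (realization g) ?U)) \<rightarrow> ?U"
    using H(2) slide_in_unmiddled by fastforce
  then have "continuous_map (prod_topology ?T (subtopology (realization g) ?U)) (subtopology (realization g) ?U) H"
    using H(1) by (simp add: continuous_map_in_subtopology)
  with H(2) show thesis using that by simp
qed

lemma acyclic_in_unmiddled:
  assumes g: "groupoidal_computad g" and C: "Cells g = {}" and n: "1 \<le> n"
  shows "acyclic_in n (subtopology (realization g) (quo g ` unmiddled g))"
proof -
  let ?U = "quo g ` unmiddled g" let ?D = "discrete_topology (Obj g)"
  obtain \<rho> where \<rho>: "continuous_map (subtopology (realization g) ?U) ?D \<rho>"
    "\<And>x. x \<in> unmiddled g \<Longrightarrow> \<rho> (quo g x) = near_vert g x"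
    by (rule unmiddled_retraction[OF g C]) blast
  obtain H where H: "continuous_map (prod_topology (top_of_set {0..1}) (subtopology (realization g) ?U))
      (subtopology (realization g) ?U) H"
    "\<And>t x. t \<in> {0..1} \<Longrightarrow> x \<in> unmiddled g \<Longrightarrow> H (t, quo g x) = quo g (slide t x)"
    by (rule unmiddled_homotopy[OF C]) blast
  have top: "topspace (subtopology (realization g) ?U) = ?U"
    using openin_subset[OF openin_unmiddled[OF C]] by auto
  show ?thesis
  proof (rule acyclic_in_dominated[OF \<rho>(1) _ _ acyclic_in_discrete[OF n]])
    show "continuous_map ?D (subtopology (realization g) ?U) (\<lambda>v. quo g (Vert v))"
      by (auto simp: continuous_map_from_discrete_topology top[unfolded topspace_subtopology] unmiddled_simps)
    show "homotopic_with (\<lambda>_. True) (subtopology (realization g) ?U) (subtopology (realization g) ?U)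
        ((\<lambda>v. quo g (Vert v)) \<circ> \<rho>) id"
    proof (rule homotopic_with_symD, rule homotopic_withI[OF H(1)])
      fix x assume "x \<in> topspace (subtopology (realization g) ?U)"
      then obtain y where y: "y \<in> unmiddled g" "x = quo g y" unfolding top by blast
      show "H (0, x) = id x" using H(2)[of 0 y] y by (simp add: slide_0)
      show "H (1, x) = ((\<lambda>v. quo g (Vert v)) \<circ> \<rho>) x"
        using H(2)[of 1 y] y \<rho>(2)[of y] quo_slide_1[OF y(1) C] by simp
    qed
  qed
qed

section \<open>Homology of the complex\<close>

text \<open>The bound on \<open>n\<close> comes from the intersection: the punctured open edges must
  be acyclic in degree \<open>n - 1\<close>, and disjoint unions of intervals are so only from
  degree 1 on.\<close>

lemma acyclic_in_graph:
  assumes g: "groupoidal_computad g" and C: "Cells g = {}" and n: "2 \<le> n"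
  shows "acyclic_in n (realization g)"
proof -
  let ?X = "realization g" let ?B = "quo g ` unmiddled g"
  define A where "A D = (\<Union>a\<in>Arr g. (\<lambda>p. quo g (EdgePt a p)) ` D)" for D
  have acA: "acyclic_in m (subtopology ?X (A D))"
    if "open D" "D \<subseteq> {0<..<1}" "acyclic_in m (top_of_set D)" "1 \<le> m" for D m
    unfolding A_def
  proof (rule acyclic_in_open_cells)
    fix a assume a: "a \<in> Arr g"
    have "D \<subseteq> {0..1}" using that(2) by force
    then show "continuous_map (top_of_set D) ?X (\<lambda>p. quo g (EdgePt a p))"
      using continuous_map_quo_edge[OF a] by (rule continuous_map_from_subtopology_mono[rotated])
    fix W :: "real set" assume "open W" "W \<subseteq> D"
    then show "openin ?X ((\<lambda>p. quo g (EdgePt a p)) ` W)"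
      using openin_quo_edge[OF C a] that(2) by blast
  next
    fix a b p q assume "p \<in> D" "q \<in> D" "quo g (EdgePt a p) = quo g (EdgePt b q)"
    then show "a = b \<and> p = q" using quo_edge_inj[OF C, of a p "EdgePt b q"] that(2) by auto
  qed (use that in auto)
  \<comment> \<open>Interior edge points have singleton classes, so membership in the second piece
    can be read off from the representative.\<close>
  have inter: "A {0<..<1} \<inter> ?B = A ({0<..<1} - {1/2})"
  proof (intro equalityI subsetI)
    fix x assume x: "x \<in> A {0<..<1} \<inter> ?B"
    then obtain a p y where "a \<in> Arr g" "0 < p" "p < 1" "x = quo g (EdgePt a p)" "y \<in> unmiddled g" "x = quo g y"
      by (auto simp: A_def)
    moreover from this have "y = EdgePt a p" using quo_edge_inj[OF C] by metis
    ultimately show "x \<in> A ({0<..<1} - {1/2})" unfolding A_def by (fastforce simp: unmiddled_simps)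
  next
    fix x assume "x \<in> A ({0<..<1} - {1/2})"
    then obtain a p where ap: "a \<in> Arr g" "p \<in> {0<..<1} - {1/2}" "x = quo g (EdgePt a p)"
      unfolding A_def by blast
    then have "x \<in> A {0<..<1}" unfolding A_def by (intro UN_I[of a] image_eqI[of _ _ p]) auto
    moreover have "x \<in> ?B" using ap by (intro image_eqI[of _ _ "EdgePt a p"]) (auto simp: unmiddled_simps)
    ultimately show "x \<in> A {0<..<1} \<inter> ?B" ..
  qed
  show ?thesis
  proof (rule acyclic_in_Mayer_Vietoris[of _ "A {0<..<1}" ?B])
    show "openin ?X (A {0<..<1})" unfolding A_def
      by (intro openin_Union ballI) (use openin_quo_edge[OF C] in auto)
    show "openin ?X ?B" by (rule openin_unmiddled[OF C])
    show "topspace ?X = A {0<..<1} \<union> ?B"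
    proof (intro equalityI subsetI)
      fix x assume "x \<in> topspace ?X"
      then obtain y where y: "y \<in> pre_carrier g" "x = quo g y" by (auto simp: topspace_realization)
      show "x \<in> A {0<..<1} \<union> ?B"
      proof (cases "y \<in> unmiddled g")
        case False
        then obtain a where "y = EdgePt a (1/2)" using y by (auto simp: unmiddled_def)
        moreover from this have "a \<in> Arr g" using y by (auto simp: pre_carrier_def)
        ultimately have "x \<in> A {0<..<1}" unfolding A_def y(2) by (intro UN_I[of a] image_eqI[of _ _ "1/2"]) auto
        then show ?thesis ..
      qed (use y in auto)
    next
      fix x assume "x \<in> A {0<..<1} \<union> ?B"
      then show "x \<in> topspace ?X"
        by (force simp: A_def topspace_realization unmiddled_def pre_carrier_def)
    qed
    show "acyclic_in n (subtopology ?X (A {0<..<1}))"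
      by (rule acA) (use n in \<open>auto intro!: acyclic_in_starlike convex_imp_starlike simp: greaterThanLessThan_empty_iff\<close>)
    show "acyclic_in n (subtopology ?X ?B)"
      by (rule acyclic_in_unmiddled[OF g C]) (use n in simp)
    show "acyclic_in (n - 1) (subtopology ?X (A {0<..<1} \<inter> ?B))"
      unfolding inter by (rule acA) (use n in \<open>auto intro!: acyclic_in_punctured_interval open_delete\<close>)
  qed (use n in simp)
qed

text \<open>Same scheme one dimension up; the punctured discs of the intersection are acyclic from
  degree 2 on, which gives the bound 3.\<close>

lemma acyclic_in_realization:
  assumes g: "groupoidal_computad g" and n: "3 \<le> n"
  shows "acyclic_in n (realization g)"
proof -
  let ?X = "realization g" let ?B = "quo g ` uncentred g"
  define A where "A D = (\<Union>\<alpha>\<in>Cells g. (\<lambda>z. quo g (DiscPt \<alpha> z)) ` D)" for D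
  have acA: "acyclic_in m (subtopology ?X (A D))"
    if "open D" "D \<subseteq> ball 0 1" "acyclic_in m (top_of_set D)" "1 \<le> m" for D m
    unfolding A_def
  proof (rule acyclic_in_open_cells)
    fix \<alpha> assume \<alpha>: "\<alpha> \<in> Cells g"
    have "D \<subseteq> cball 0 1" by (rule order_trans[OF that(2) ball_subset_cball])
    then show "continuous_map (top_of_set D) ?X (\<lambda>z. quo g (DiscPt \<alpha> z))"
      using continuous_map_quo_disc[OF \<alpha>] by (rule continuous_map_from_subtopology_mono[rotated])
    fix W :: "(real \<times> real) set" assume "open W" "W \<subseteq> D"
    then show "openin ?X ((\<lambda>z. quo g (DiscPt \<alpha> z)) ` W)"
      using openin_quo_disc[OF \<alpha>] that(2) by blast
  next
    fix \<alpha> \<beta> z z' assume "z \<in> D" "z' \<in> D" "quo g (DiscPt \<alpha> z) = quo g (DiscPt \<beta> z')"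
    then show "\<alpha> = \<beta> \<and> z = z'" using quo_disc_inj[of g \<alpha> z "DiscPt \<beta> z'"] that(2) by auto
  qed (use that in auto)
  have inter: "A (ball 0 1) \<inter> ?B = A (ball 0 1 - {0})"
  proof (intro equalityI subsetI)
    fix x assume x: "x \<in> A (ball 0 1) \<inter> ?B"
    then obtain \<alpha> z y where *: "\<alpha> \<in> Cells g" "z \<in> ball 0 1" "x = quo g (DiscPt \<alpha> z)" "y \<in> uncentred g" "x = quo g y"
      unfolding A_def by blast
    then have "y = DiscPt \<alpha> z" using quo_disc_inj[of g \<alpha> z y] by simp
    then have "z \<in> ball 0 1 - {0}" using * by (simp add: uncentred_simps)
    then show "x \<in> A (ball 0 1 - {0})" unfolding A_def using * by blast
  next
    fix x assume "x \<in> A (ball 0 1 - {0})"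
    then obtain \<alpha> z where az: "\<alpha> \<in> Cells g" "z \<in> ball 0 1 - {0}" "x = quo g (DiscPt \<alpha> z)"
      unfolding A_def by blast
    then have "x \<in> A (ball 0 1)" unfolding A_def by (intro UN_I[of \<alpha>] image_eqI[of _ _ z]) auto
    moreover have "x \<in> ?B" using az by (intro image_eqI[of _ _ "DiscPt \<alpha> z"]) (auto simp: uncentred_simps)
    ultimately show "x \<in> A (ball 0 1) \<inter> ?B" ..
  qed
  show ?thesis
  proof (rule acyclic_in_Mayer_Vietoris[of _ "A (ball 0 1)" ?B])
    show "openin ?X (A (ball 0 1))" unfolding A_def
      using openin_quo_disc[of _ g, OF _ open_ball order_refl] by (intro openin_Union ballI) blast
    show "openin ?X ?B" by (rule openin_uncentred)
    show "topspace ?X = A (ball 0 1) \<union> ?B"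
    proof (intro equalityI subsetI)
      fix x assume "x \<in> topspace ?X"
      then obtain y where y: "y \<in> pre_carrier g" "x = quo g y" by (auto simp: topspace_realization)
      show "x \<in> A (ball 0 1) \<union> ?B"
      proof (cases "y \<in> uncentred g")
        case False
        then obtain \<alpha> where "y = DiscPt \<alpha> 0" using y by (auto simp: uncentred_def)
        moreover from this have "\<alpha> \<in> Cells g" using y by (auto simp: pre_carrier_def)
        ultimately have "x \<in> A (ball 0 1)" unfolding A_def y(2) by (intro UN_I[of \<alpha>] image_eqI[of _ _ 0]) auto
        then show ?thesis ..
      qed (use y in auto)
    next
      fix x assume "x \<in> A (ball 0 1) \<union> ?B"
      then consider \<alpha> z where "\<alpha> \<in> Cells g" "z \<in> ball 0 1" "x = quo g (DiscPt \<alpha> z)" | "x \<in> ?B"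
        unfolding A_def by blast
      then show "x \<in> topspace ?X"
      proof cases
        case 1
        then have "DiscPt \<alpha> z \<in> pre_carrier g" by (simp add: pre_carrier_simps)
        with 1 show ?thesis by (simp add: topspace_realization)
      qed (auto simp: topspace_realization uncentred_def)
    qed
    show "acyclic_in n (subtopology ?X (A (ball 0 1)))"
      by (rule acA) (use n in \<open>auto intro!: acyclic_in_starlike convex_imp_starlike\<close>)
    show "acyclic_in n (subtopology ?X ?B)"
      using acyclic_in_graph[OF groupoidal_computad_graph_of[OF g], of n] n
      by (intro acyclic_in_uncentred[OF g]) simp
    show "acyclic_in (n - 1) (subtopology ?X (A (ball 0 1) \<inter> ?B))"
      unfolding inter by (rule acA) (use n in \<open>auto intro!: acyclic_in_punctured_disc open_delete\<close>)
  qed (use n in simp)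
qed

section \<open>Integrating a 1-cocycle along paths\<close>

text \<open>The singular 1-simplex traced by \<open>F\<close> along the straight segment from
  \<open>a\<close> to \<open>b\<close>, in barycentric coordinates; for real \<open>a\<close> and
  \<open>b\<close> it is the path \<open>F\<close> itself between these times, in either direction.
  The restriction makes it extensional, as singular simplices are.\<close>

definition seg :: "('e::real_normed_vector \<Rightarrow> 'x) \<Rightarrow> 'e \<Rightarrow> 'e \<Rightarrow> (nat \<Rightarrow> real) \<Rightarrow> 'x" where
  "seg F a b = (\<lambda>x\<in>standard_simplex 1. F (x 0 *\<^sub>R a + x 1 *\<^sub>R b))"

lemma standard_simplex_1D:
  assumes "x \<in> standard_simplex 1"
  shows "0 \<le> x 0" "0 \<le> x 1" "x 0 + x 1 = 1"
  using assms by (auto simp: standard_simplex_def)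

lemma seg_eqI:
  assumes "\<And>s t. 0 \<le> s \<Longrightarrow> 0 \<le> t \<Longrightarrow> s + t = 1 \<Longrightarrow> F (s *\<^sub>R a + t *\<^sub>R b) = G (s *\<^sub>R c + t *\<^sub>R d)"
  shows "seg F a b = seg G c d"
  unfolding seg_def
proof (rule restrict_ext)
  fix x :: "nat \<Rightarrow> real" assume "x \<in> standard_simplex 1"
  then show "F (x 0 *\<^sub>R a + x 1 *\<^sub>R b) = G (x 0 *\<^sub>R c + x 1 *\<^sub>R d)"
    using assms standard_simplex_1D by blast
qed

lemma continuous_map_barycentric:
  fixes v :: "nat \<Rightarrow> 'e::real_normed_vector"
  assumes K: "convex K" and v: "\<And>i. i \<le> p \<Longrightarrow> v i \<in> K"
  shows "continuous_map (subtopology (powertop_real UNIV) (standard_simplex p)) (top_of_set K)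
           (\<lambda>x. \<Sum>i\<le>p. x i *\<^sub>R v i)"
proof -
  have "continuous_on (standard_simplex p) (\<lambda>x. \<Sum>i\<le>p. x i *\<^sub>R v i)"
    by (intro continuous_intros continuous_on_product_coordinates[THEN continuous_on_subset]) simp
  moreover have "(\<lambda>x. \<Sum>i\<le>p. x i *\<^sub>R v i) \<in> standard_simplex p \<rightarrow> K"
  proof
    fix x :: "nat \<Rightarrow> real" assume "x \<in> standard_simplex p"
    then show "(\<Sum>i\<le>p. x i *\<^sub>R v i) \<in> K"
      by (intro convex_sum[OF _ K]) (auto simp: standard_simplex_def v)
  qed
  ultimately show ?thesis
    by (simp add: euclidean_product_topology)
qed

text \<open>The cocycle condition on the 2-simplex obtained by applying \<open>F\<close> to the
  possibly degenerate triangle \<open>a\<close>, \<open>b\<close>, \<open>c\<close>, whose faces are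
  the three segments.\<close>

lemma cocycle_triangle:
  assumes \<phi>: "\<phi> \<in> cocycles 1 X" and K: "convex K" and F: "continuous_map (top_of_set K) X F"
    and abc: "a \<in> K" "b \<in> K" "c \<in> K"
  shows "\<phi> (seg F a c) = \<phi> (seg F a b) + \<phi> (seg F b c)"
proof -
  let ?v = "\<lambda>i::nat. if i = 0 then a else if i = 1 then b else c"
  define \<sigma> where "\<sigma> = (\<lambda>x\<in>standard_simplex 2. F (x 0 *\<^sub>R a + x 1 *\<^sub>R b + x 2 *\<^sub>R c))"
  have "continuous_map (subtopology (powertop_real UNIV) (standard_simplex 2)) (top_of_set K)
      (\<lambda>x. \<Sum>i\<le>2. x i *\<^sub>R ?v i)"
    by (rule continuous_map_barycentric[OF K]) (use abc in auto)
  from continuous_map_compose[OF this F] have \<sigma>: "singular_simplex 2 X \<sigma>"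
    by (simp add: singular_simplex_def \<sigma>_def comp_def numeral_2_eq_2 add.assoc)
  have face: "singular_face 2 k \<sigma> = (\<lambda>x\<in>standard_simplex 1. F (simplical_face k x 0 *\<^sub>R a
      + simplical_face k x 1 *\<^sub>R b + simplical_face k x 2 *\<^sub>R c))" if "k \<le> 2" for k
    unfolding singular_face_def \<sigma>_def
    by (rule ext) (use simplical_face_in_standard_simplex[of 2 k] that in auto)
  have "singular_face 2 0 \<sigma> = seg F b c" "singular_face 2 1 \<sigma> = seg F a c" "singular_face 2 2 \<sigma> = seg F a b"
    by (auto simp: face seg_def simplical_face_def intro!: restrict_ext)
  moreover have "coboundary 1 X \<phi> \<sigma> = 0" using \<phi> by (simp add: cocycles_def)
  ultimately show ?thesis using \<sigma>
    by (simp add: coboundary_def numeral_2_eq_2)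
qed

text \<open>The fully degenerate triangle shows that the value equals twice itself.\<close>

lemma cocycle_seg_refl:
  assumes \<phi>: "\<phi> \<in> cocycles 1 X" and K: "convex K" and F: "continuous_map (top_of_set K) X F" and "a \<in> K"
  shows "\<phi> (seg F a a) = 0"
  using cocycle_triangle[OF assms assms(4,4)] by simp

lemma cocycle_seg_const:
  assumes \<phi>: "\<phi> \<in> cocycles 1 X" and c: "c \<in> topspace X"
    and F: "\<And>s t. 0 \<le> s \<Longrightarrow> 0 \<le> t \<Longrightarrow> s + t = 1 \<Longrightarrow> F (s *\<^sub>R a + t *\<^sub>R b) = c"
  shows "\<phi> (seg F a b) = 0"
proof -
  have "seg F a b = seg (\<lambda>_. c) (0::real) 0" by (rule seg_eqI) (use F in simp)
  moreover have "\<phi> (seg (\<lambda>_. c) (0::real) 0) = 0"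
    by (rule cocycle_seg_refl[OF \<phi> convex_UNIV]) (use c in auto)
  ultimately show ?thesis by simp
qed

lemma cocycle_seg_swap:
  assumes \<phi>: "\<phi> \<in> cocycles 1 X" and K: "convex K" and F: "continuous_map (top_of_set K) X F"
    and ab: "a \<in> K" "b \<in> K"
  shows "\<phi> (seg F b a) = - \<phi> (seg F a b)"
  using cocycle_triangle[OF \<phi> K F ab ab(1)] cocycle_seg_refl[OF \<phi> K F ab(1)] by simp

text \<open>The diagonal from \<open>(s, 0)\<close> to \<open>(t, 1)\<close> cuts the square into
  two triangles.\<close>

lemma cocycle_square:
  fixes G :: "real \<times> real \<Rightarrow> 'x"
  assumes \<phi>: "\<phi> \<in> cocycles 1 X" and J: "convex J" and G: "continuous_map (top_of_set (J \<times> {0..1})) X G"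
    and st: "s \<in> J" "t \<in> J"
  shows "\<phi> (seg (\<lambda>r. G (r, 0)) s t) + \<phi> (seg (\<lambda>u. G (t, u)) 0 1)
       = \<phi> (seg (\<lambda>u. G (s, u)) 0 1) + \<phi> (seg (\<lambda>r. G (r, 1)) s t)"
proof -
  have K: "convex (J \<times> {0..1::real})" using J by (intro convex_Times) auto
  note tri = cocycle_triangle[OF \<phi> K G, of "(s,0)" _ "(t,1)"]
  have h: "seg (\<lambda>r. G (r, u)) s t = seg G (s, u) (t, u)" for u
    by (rule seg_eqI) (simp flip: distrib_right)
  have v: "seg (\<lambda>u. G (r, u)) 0 1 = seg G (r, 0) (r, 1)" for r
    by (rule seg_eqI) (simp flip: distrib_right)
  show ?thesis unfolding h v using tri[of "(t,0)"] tri[of "(s,1)"] st by simp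
qed

text \<open>Within a convex set the integral depends on the end points only, because the curve
  contracts linearly to its starting point.\<close>

lemma cocycle_curve:
  fixes F :: "'e::real_normed_vector \<Rightarrow> 'x" and c :: "real \<Rightarrow> 'e"
  assumes \<phi>: "\<phi> \<in> cocycles 1 X" and K: "convex K" and F: "continuous_map (top_of_set K) X F"
    and J: "convex J" and c: "continuous_on J c" "c ` J \<subseteq> K" and st: "s \<in> J" "t \<in> J"
  shows "\<phi> (seg (\<lambda>r. F (c r)) s t) = \<phi> (seg F (c s) (c t))"
proof -
  \<comment> \<open>On the boundary of this square: \<open>u = 0\<close> is the curve,
    \<open>u = 1\<close> and \<open>r = s\<close> are constant, and \<open>r = t\<close> is the
    straight segment from \<open>c t\<close> back to \<open>c s\<close>.\<close>
  define G where "G = (\<lambda>(r, u). F ((1 - u) *\<^sub>R c r + u *\<^sub>R c s))"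
  have "continuous_on (J \<times> {0..1}) (\<lambda>x. (1 - snd x) *\<^sub>R c (fst x) + snd x *\<^sub>R c s)"
    by (intro continuous_intros continuous_on_compose2[OF c(1)]) auto
  moreover have "(\<lambda>x. (1 - snd x) *\<^sub>R c (fst x) + snd x *\<^sub>R c s) \<in> J \<times> {0..1} \<rightarrow> K"
    using c(2) st(1) by (auto intro!: convexD[OF K])
  ultimately have "continuous_map (top_of_set (J \<times> {0..1})) (top_of_set K)
      (\<lambda>x. (1 - snd x) *\<^sub>R c (fst x) + snd x *\<^sub>R c s)"
    by (simp only: continuous_map_subtopology_eu simp_thms)
  from continuous_map_compose[OF this F] have G: "continuous_map (top_of_set (J \<times> {0..1})) X G"
    by (simp add: G_def comp_def case_prod_unfold)
  have cs: "c s \<in> K" "c t \<in> K" using c(2) st by auto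
  have Fs: "F (c s) \<in> topspace X" using funcset_mem[OF continuous_map_funspace[OF F]] cs by simp
  have "\<phi> (seg (\<lambda>r. G (r, 1)) s t) = 0"
    by (rule cocycle_seg_const[OF \<phi> Fs]) (simp add: G_def)
  moreover have "\<phi> (seg (\<lambda>u. G (s, u)) 0 1) = 0"
    by (rule cocycle_seg_const[OF \<phi> Fs]) (simp add: G_def flip: scaleR_add_left)
  moreover have "seg (\<lambda>u. G (t, u)) 0 1 = seg F (c t) (c s)"
  proof (rule seg_eqI)
    fix a b :: real assume "a + b = 1"
    then have "a = 1 - b" by simp
    then show "G (t, a *\<^sub>R 0 + b *\<^sub>R 1) = F (a *\<^sub>R c t + b *\<^sub>R c s)" by (simp add: G_def)
  qed
  moreover have "\<phi> (seg F (c t) (c s)) = - \<phi> (seg F (c s) (c t))"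
    by (rule cocycle_seg_swap[OF \<phi> K F cs])
  moreover have "seg (\<lambda>r. G (r, 0)) s t = seg (\<lambda>r. F (c r)) s t" by (simp add: G_def)
  ultimately show ?thesis using cocycle_square[OF \<phi> J G st] by simp
qed

text \<open>\<open>\<psi>\<close> is any function on points, exactly what a 0-cochain is; the
  condition is the fundamental theorem of calculus along one path.\<close>

definition path_potential :: "'x cochain \<Rightarrow> ('x \<Rightarrow> real) \<Rightarrow> (real \<Rightarrow> 'x) \<Rightarrow> real \<Rightarrow> real \<Rightarrow> bool" where
  "path_potential \<phi> \<psi> F a b \<longleftrightarrow> \<phi> (seg F a b) = \<psi> (F b) - \<psi> (F a)"

text \<open>The property is additive under concatenation and holds on short intervals by continuity,
  so bisection gives it on the whole interval. The map \<open>\<iota>\<close> is kept separate since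
  for the graph the neighbourhoods live in its own realization while the cocycle lives on the
  complex.\<close>

lemma path_potential_local:
  assumes \<phi>: "\<phi> \<in> cocycles 1 X" and \<iota>: "continuous_map Y X \<iota>"
    and loc: "\<And>y. y \<in> topspace Y \<Longrightarrow> \<exists>N. openin Y N \<and> y \<in> N \<and>
      (\<forall>F a b. a \<le> b \<longrightarrow> continuous_map (top_of_set {a..b}) (subtopology Y N) F \<longrightarrow> path_potential \<phi> \<psi> (\<iota> \<circ> F) a b)"
    and ab: "a \<le> b" and F: "continuous_map (top_of_set {a..b}) Y F"
  shows "path_potential \<phi> \<psi> (\<iota> \<circ> F) a b"
proof -
  have \<iota>F: "continuous_map (top_of_set {a..b}) X (\<iota> \<circ> F)"
    by (rule continuous_map_compose[OF F \<iota>])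
  \<comment> \<open>The bounds guard the predicate because bisection quantifies over intervals that
    may leave \<open>{a..b}\<close>, where \<open>F\<close> is not controlled.\<close>
  have "a \<le> a \<and> b \<le> b \<longrightarrow> path_potential \<phi> \<psi> (\<iota> \<circ> F) a b"
    using ab
  proof (rule Bolzano[of a b "\<lambda>s t. a \<le> s \<and> t \<le> b \<longrightarrow> path_potential \<phi> \<psi> (\<iota> \<circ> F) s t"])
    fix r s t assume rst: "a \<le> r \<and> s \<le> b \<longrightarrow> path_potential \<phi> \<psi> (\<iota> \<circ> F) r s"
      "a \<le> s \<and> t \<le> b \<longrightarrow> path_potential \<phi> \<psi> (\<iota> \<circ> F) s t" "r \<le> s" "s \<le> t"
    show "a \<le> r \<and> t \<le> b \<longrightarrow> path_potential \<phi> \<psi> (\<iota> \<circ> F) r t"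
    proof
      assume "a \<le> r \<and> t \<le> b"
      then show "path_potential \<phi> \<psi> (\<iota> \<circ> F) r t"
        using rst cocycle_triangle[OF \<phi> _ \<iota>F, of r s t] by (auto simp: path_potential_def)
    qed
  next
    fix x assume x: "a \<le> x" "x \<le> b"
    then have "F x \<in> topspace Y" using funcset_mem[OF continuous_map_funspace[OF F]] by simp
    from loc[OF this] obtain N where N: "openin Y N" "F x \<in> N"
      "\<And>F a b. a \<le> b \<Longrightarrow> continuous_map (top_of_set {a..b}) (subtopology Y N) F \<Longrightarrow> path_potential \<phi> \<psi> (\<iota> \<circ> F) a b"
      by blast
    have o: "openin (top_of_set {a..b}) {t \<in> topspace (top_of_set {a..b}). F t \<in> N}"
      by (rule openin_continuous_map_preimage[OF F N(1)])
    have "x \<in> {t \<in> topspace (top_of_set {a..b}). F t \<in> N}" using x N(2) by simp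
    from o[unfolded openin_euclidean_subtopology_iff, THEN conjunct2, rule_format, OF this]
    obtain d where d: "d > 0" "\<And>t. t \<in> {a..b} \<Longrightarrow> dist t x < d \<Longrightarrow> F t \<in> N"
      by auto
    show "\<exists>d>0. \<forall>s t. s \<le> x \<and> x \<le> t \<and> t - s < d \<longrightarrow> a \<le> s \<and> t \<le> b \<longrightarrow> path_potential \<phi> \<psi> (\<iota> \<circ> F) s t"
    proof (intro exI[of _ d] conjI allI impI)
      fix s t assume st: "s \<le> x \<and> x \<le> t \<and> t - s < d" "a \<le> s \<and> t \<le> b"
      have "{s..t} \<subseteq> {a..b}" using st by auto
      then have "continuous_map (top_of_set {s..t}) Y F" by (rule continuous_map_from_subtopology_mono[OF F])
      moreover have "F \<in> {s..t} \<rightarrow> N" using d(2) st by (auto simp: dist_real_def)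
      ultimately have "continuous_map (top_of_set {s..t}) (subtopology Y N) F"
        by (simp add: continuous_map_in_subtopology)
      then show "path_potential \<phi> \<psi> (\<iota> \<circ> F) s t" using N(3) st by auto
    qed (use d in auto)
  qed
  then show ?thesis by simp
qed

text \<open>A path in an open cell lifts through the homeomorphism to a curve in the convex set
  \<open>D\<close>, where it may be replaced by a straight segment.\<close>

lemma path_potential_open_cell:
  fixes e :: "'e::real_normed_vector \<Rightarrow> 'y"
  assumes \<phi>: "\<phi> \<in> cocycles 1 X" and D: "convex D"
    and e: "homeomorphic_map (top_of_set D) (subtopology Y N) e"
    and \<iota>e: "continuous_map (top_of_set D) X (\<lambda>z. \<iota> (e z))"
    and pot: "\<And>z z'. z \<in> D \<Longrightarrow> z' \<in> D \<Longrightarrow> \<phi> (seg (\<lambda>z. \<iota> (e z)) z z') = \<psi> (\<iota> (e z')) - \<psi> (\<iota> (e z))"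
    and ab: "a \<le> b" and F: "continuous_map (top_of_set {a..b}) (subtopology Y N) F"
  shows "path_potential \<phi> \<psi> (\<iota> \<circ> F) a b"
proof -
  obtain k where k: "homeomorphic_maps (top_of_set D) (subtopology Y N) e k"
    using e homeomorphic_map_maps by blast
  define c where "c = k \<circ> F"
  have "continuous_map (top_of_set {a..b}) (top_of_set D) c"
    unfolding c_def using k by (intro continuous_map_compose[OF F]) (simp add: homeomorphic_maps_def)
  then have c: "continuous_on {a..b} c" "c ` {a..b} \<subseteq> D"
    unfolding continuous_map_subtopology_eu by auto
  have Fc: "F r = e (c r)" if "r \<in> {a..b}" for r
  proof -
    have "F r \<in> topspace (subtopology Y N)" using funcset_mem[OF continuous_map_funspace[OF F]] that by simp
    then show ?thesis using k by (simp add: homeomorphic_maps_def c_def)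
  qed
  have "seg (\<iota> \<circ> F) a b = seg (\<lambda>r. \<iota> (e (c r))) a b"
  proof (rule seg_eqI)
    fix s t :: real assume "0 \<le> s" "0 \<le> t" "s + t = 1"
    then have "s *\<^sub>R a + t *\<^sub>R b \<in> {a..b}" using ab by (intro convexD) auto
    then show "(\<iota> \<circ> F) (s *\<^sub>R a + t *\<^sub>R b) = \<iota> (e (c (s *\<^sub>R a + t *\<^sub>R b)))" using Fc by simp
  qed
  then have "\<phi> (seg (\<iota> \<circ> F) a b) = \<phi> (seg (\<lambda>r. \<iota> (e (c r))) a b)" by simp
  also have "\<dots> = \<phi> (seg (\<lambda>z. \<iota> (e z)) (c a) (c b))"
    by (rule cocycle_curve[OF \<phi> D \<iota>e _ c]) (use ab in auto)
  also have "\<dots> = \<psi> (\<iota> (e (c b))) - \<psi> (\<iota> (e (c a)))"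
    by (rule pot) (use c(2) ab in auto)
  finally show ?thesis using Fc[of a] Fc[of b] ab by (simp add: path_potential_def)
qed

text \<open>Apply the square rule to the homotopy along the path: if the potential is right on the
  deformed path and on the tracks of both end points, it is right on the fourth side.\<close>

lemma path_potential_homotopy:
  assumes \<phi>: "\<phi> \<in> cocycles 1 X" and H: "continuous_map (prod_topology (top_of_set {0..1::real}) Y) X H"
    and ab: "a \<le> b" and F: "continuous_map (top_of_set {a..b}) Y F"
    and track: "\<And>y. y \<in> topspace Y \<Longrightarrow> path_potential \<phi> \<psi> (\<lambda>u. H (u, y)) 0 1"
    and top: "path_potential \<phi> \<psi> (\<lambda>s. H (1, F s)) a b"
  shows "path_potential \<phi> \<psi> (\<lambda>s. H (0, F s)) a b"
proof -
  have "continuous_map (prod_topology (top_of_set {a..b}) (top_of_set {0..1::real}))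
      (prod_topology (top_of_set {0..1}) Y) (\<lambda>x. (snd x, F (fst x)))"
    using continuous_map_compose[OF continuous_map_fst F, unfolded comp_def]
    by (intro continuous_map_pairedI continuous_map_snd)
  from continuous_map_compose[OF this H]
  have G: "continuous_map (top_of_set ({a..b} \<times> {0..1})) X (\<lambda>x. H (snd x, F (fst x)))"
    by (simp add: comp_def)
  have Fin: "F s \<in> topspace Y" if "s \<in> {a..b}" for s
    using funcset_mem[OF continuous_map_funspace[OF F]] that by simp
  show ?thesis
    using cocycle_square[OF \<phi> _ G, of a b] ab top track[OF Fin, of a] track[OF Fin, of b]
    by (simp add: path_potential_def)
qed

lemma cocycle_exact_if_potential:
  assumes \<phi>: "\<phi> \<in> cocycles 1 X"
    and pot: "\<And>F. continuous_map (top_of_set {0..1}) X F \<Longrightarrow> path_potential \<phi> \<psi> F 0 1"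
  shows "\<phi> \<in> coboundaries 1 X"
proof -
  \<comment> \<open>The \<open>k\<close>-th vertex of a standard simplex; \<open>e 0\<close> is also
    the only point of the 0-simplex.\<close>
  define e where "e k = (\<lambda>j. if j = k then 1 else 0 :: real)" for k :: nat
  define \<eta> where "\<eta> \<sigma> = (if singular_simplex 0 X \<sigma> then \<psi> (\<sigma> (e 0)) else 0)" for \<sigma> :: "(nat \<Rightarrow> real) \<Rightarrow> 'a"
  have "coboundary 0 X \<eta> \<sigma> = \<phi> \<sigma>" for \<sigma>
  proof (cases "singular_simplex 1 X \<sigma>")
    case True
    define pt where "pt = (\<lambda>(t::real) (i::nat). if i = 0 then 1 - t else if i = 1 then t else 0)"
    define F where "F t = \<sigma> (pt t)" for t
    have "continuous_map (top_of_set {0..1}) (subtopology (powertop_real UNIV) (standard_simplex 1)) pt"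
      unfolding pt_def continuous_map_in_subtopology continuous_map_componentwise
    proof (intro conjI ballI)
      fix k :: nat
      show "continuous_map (top_of_set {0..1::real}) euclideanreal (\<lambda>t. if k = 0 then 1 - t else if k = 1 then t else 0)"
        by (cases "k = 0"; cases "k = 1") (auto intro!: continuous_intros)
    qed (auto simp: standard_simplex_def)
    then have "continuous_map (top_of_set {0..1}) X F"
      using True continuous_map_compose unfolding singular_simplex_def F_def[abs_def] by (fastforce simp: comp_def)
    then have 1: "\<phi> (seg F 0 1) = \<psi> (F 1) - \<psi> (F 0)" using pot by (simp add: path_potential_def)
    have "seg F 0 1 = \<sigma>"
    proof
      fix x show "seg F 0 1 x = \<sigma> x"
      proof (cases "x \<in> standard_simplex 1")
        case x: True
        have "pt (x 1) = x"
          using standard_simplex_1D[OF x] x by (auto simp: standard_simplex_def fun_eq_iff pt_def)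
        then show ?thesis using x by (simp add: seg_def F_def)
      next
        case False
        then show ?thesis using True by (simp add: seg_def singular_simplex_def extensional_def)
      qed
    qed
    moreover have "F 0 = \<sigma> (e 0)" "F 1 = \<sigma> (e 1)"
      unfolding F_def e_def pt_def by (auto intro!: arg_cong[of _ _ \<sigma>])
    \<comment> \<open>Face \<open>k\<close> omits vertex \<open>k\<close>, so face 0 is the end of
      the path and enters with the plus sign.\<close>
    moreover have "singular_face 1 0 \<sigma> (e 0) = \<sigma> (e 1)" "singular_face 1 1 \<sigma> (e 0) = \<sigma> (e 0)"
      by (auto simp: singular_face_def simplical_face_def e_def standard_simplex_0 intro!: arg_cong[of _ _ \<sigma>])
    moreover have "singular_simplex 0 X (singular_face 1 k \<sigma>)" if "k \<le> 1" for k
      using singular_simplex_singular_face[OF True _ that] by simp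
    ultimately show ?thesis using 1 True by (simp add: coboundary_def \<eta>_def)
  next
    case False
    then show ?thesis using \<phi> by (simp add: coboundary_def cocycles_def cochains_def)
  qed
  then have "coboundary 0 X \<eta> = \<phi>" by blast
  moreover have "\<eta> \<in> cochains 0 X" by (simp add: cochains_def \<eta>_def)
  ultimately show ?thesis by (auto simp: coboundaries_def)
qed

section \<open>Words and the congruence\<close>

text \<open>Composable words in a recursive form suited to induction, reduced or not; by
  \<open>fg_mor_iff_walk\<close> the morphisms of the free groupoid are the reduced ones between
  objects.\<close>

fun walk :: "('o, 'a, 'c) computad \<Rightarrow> 'o \<Rightarrow> ('a \<times> bool) list \<Rightarrow> 'o \<Rightarrow> bool" where
  "walk g x [] y \<longleftrightarrow> x = y"
| "walk g x (l # w) y \<longleftrightarrow> fst l \<in> Arr g \<and> letter_start g l = x \<and> walk g (letter_end g l) w y"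

lemma walk_append: "walk g x (u @ w) y \<longleftrightarrow> (\<exists>z. walk g x u z \<and> walk g z w y)"
  by (induction u arbitrary: x) auto

lemma walk_letters: "walk g x w y \<Longrightarrow> \<forall>l\<in>set w. fst l \<in> Arr g"
  by (induction w arbitrary: x) auto

lemma walk_linv: "letter_start g (linv l) = letter_end g l" "letter_end g (linv l) = letter_start g l"
  by (auto simp: letter_start_def letter_end_def linv_def)

lemma all_nat_iff: "(\<forall>i. P i) \<longleftrightarrow> P 0 \<and> (\<forall>i. P (Suc i))"
  by (metis not0_implies_Suc)

lemma reduced_word_Cons:
  "reduced_word (l # l' # w) \<longleftrightarrow> l' \<noteq> linv l \<and> reduced_word (l' # w)"
  unfolding reduced_word_def
  by (subst all_nat_iff) simp

lemma reduced_word_tl: "reduced_word (l # w) \<Longrightarrow> reduced_word w"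
  by (cases w) (simp_all add: reduced_word_Cons, simp add: reduced_word_def)

lemma reduced_word_reduce: "reduced_word (reduce w)"
proof (induction w)
  case Nil
  then show ?case by (simp add: reduced_word_def)
next
  case (Cons l w)
  then show ?case
    by (auto split: list.split simp: reduced_word_Cons dest: reduced_word_tl) (simp add: reduced_word_def)
qed

lemma set_reduce: "set (reduce w) \<subseteq> set w"
  by (induction w) (auto split: list.split)

lemma walk_reduce: "walk g x w y \<Longrightarrow> walk g x (reduce w) y"
proof (induction w arbitrary: x)
  case (Cons l w)
  then have IH: "walk g (letter_end g l) (reduce w) y" and l: "fst l \<in> Arr g" "letter_start g l = x" by auto
  show ?case
  proof (cases "reduce w")
    case Nil
    then show ?thesis using IH l by simp
  next
    case (Cons l' w')
    then show ?thesis using IH l by (auto simp: walk_linv)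
  qed
qed simp

lemma walk_iff:
  "walk g x w y \<longleftrightarrow> (\<forall>l\<in>set w. fst l \<in> Arr g) \<and> (w = [] \<longrightarrow> x = y) \<and>
      (w \<noteq> [] \<longrightarrow> letter_start g (hd w) = x \<and> letter_end g (last w) = y) \<and>
      (\<forall>i. Suc i < length w \<longrightarrow> letter_end g (w ! i) = letter_start g (w ! Suc i))"
proof (induction w arbitrary: x)
  case (Cons l w)
  note IH = Cons.IH[of "letter_end g l"]
  show ?case
  proof (cases w)
    case Nil
    then show ?thesis by auto
  next
    case w: (Cons l' w')
    have "(\<forall>i. Suc i < length (l # w) \<longrightarrow> letter_end g ((l # w) ! i) = letter_start g ((l # w) ! Suc i)) \<longleftrightarrow>
        letter_end g l = letter_start g l' \<and>
        (\<forall>i. Suc i < length w \<longrightarrow> letter_end g (w ! i) = letter_start g (w ! Suc i))"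
      by (subst all_nat_iff) (simp add: w)
    moreover have "walk g x (l # w) y \<longleftrightarrow> fst l \<in> Arr g \<and> letter_start g l = x \<and> walk g (letter_end g l) w y"
      by simp
    moreover have "hd w = l'" "last (l # w) = last w" "w \<noteq> []" by (simp_all add: w)
    ultimately show ?thesis unfolding IH by (simp only: list.set ball_simps list.sel list.distinct simp_thms) metis
  qed
qed simp

lemma fg_mor_iff_walk:
  "fg_mor g (x, w, y) \<longleftrightarrow> x \<in> Obj g \<and> y \<in> Obj g \<and> walk g x w y \<and> reduced_word w"
  unfolding walk_iff by (simp add: fg_mor_def)

text \<open>A zigzag of arrows spells a walk, letter by letter, and reduction keeps its end
  points.\<close>

lemma connected_imp_mor:
  assumes g: "groupoidal_computad g" and c: "connected_computad g" and xy: "x \<in> Obj g" "y \<in> Obj g"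
  obtains w where "fg_mor g (x, w, y)"
proof -
  let ?E = "{(gdom g a, gcod g a) | a. a \<in> Arr g}"
  have "(x, y) \<in> (?E \<union> ?E\<inverse>)\<^sup>*" using c xy by (simp add: connected_computad_def Let_def)
  then have "\<exists>w. walk g x w y"
  proof (induction rule: rtrancl_induct)
    case base
    show ?case by (intro exI[of _ "[]"]) simp
  next
    case (step y z)
    then obtain w where w: "walk g x w y" by blast
    from step(2) consider a where "a \<in> Arr g" "y = gdom g a" "z = gcod g a"
      | a where "a \<in> Arr g" "y = gcod g a" "z = gdom g a" by auto
    then obtain l where "fst l \<in> Arr g" "letter_start g l = y" "letter_end g l = z"
    proof cases
      case (1 a)
      then show ?thesis using that[of "(a, True)"] by (simp add: letter_start_def letter_end_def)
    next
      case (2 a)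
      then show ?thesis using that[of "(a, False)"] by (simp add: letter_start_def letter_end_def)
    qed
    then have "walk g x (w @ [l]) z" using w by (auto simp: walk_append)
    then show ?case by blast
  qed
  then obtain w where "walk g x w y" by blast
  then have "fg_mor g (x, reduce w, y)"
    using xy by (simp add: fg_mor_iff_walk walk_reduce reduced_word_reduce)
  then show thesis using that by blast
qed

section \<open>Integrals of letters and words\<close>

definition letter_int :: "('o, 'a, 'c) computad \<Rightarrow> ('o, 'a, 'c) precell set cochain \<Rightarrow> 'a \<times> bool \<Rightarrow> real" where
  "letter_int g \<phi> l = \<phi> (seg (\<lambda>u. quo g (letter_pt l u)) (0::real) 1)"

definition word_int :: "('o, 'a, 'c) computad \<Rightarrow> ('o, 'a, 'c) precell set cochain \<Rightarrow> ('a \<times> bool) list \<Rightarrow> real" where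
  "word_int g \<phi> w = sum_list (map (letter_int g \<phi>) w)"

lemma word_int_simps [simp]:
  "word_int g \<phi> [] = 0" "word_int g \<phi> (l # w) = letter_int g \<phi> l + word_int g \<phi> w"
  "word_int g \<phi> (u @ w) = word_int g \<phi> u + word_int g \<phi> w"
  by (simp_all add: word_int_def)

lemma letter_int_linv:
  assumes \<phi>: "\<phi> \<in> cocycles 1 (realization g)" and l: "fst l \<in> Arr g"
  shows "letter_int g \<phi> (linv l) = - letter_int g \<phi> l"
proof -
  have "seg (\<lambda>u. quo g (letter_pt (linv l) u)) (0::real) 1 = seg (\<lambda>u. quo g (letter_pt l u)) 1 0"
  proof (rule seg_eqI)
    fix s t :: real assume "s + t = 1"
    then have "s = 1 - t" by simp
    then show "quo g (letter_pt (linv l) (s *\<^sub>R 0 + t *\<^sub>R 1)) = quo g (letter_pt l (s *\<^sub>R 1 + t *\<^sub>R 0))"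
      by (simp add: letter_pt_def linv_def)
  qed
  then show ?thesis
    using cocycle_seg_swap[OF \<phi> _ continuous_map_letter_pt[OF l], of 0 1] by (simp add: letter_int_def)
qed

text \<open>Cancelled pairs contribute opposite integrals, since a formal inverse runs the same
  segment backwards.\<close>

lemma word_int_reduce:
  assumes \<phi>: "\<phi> \<in> cocycles 1 (realization g)" and w: "\<forall>l\<in>set w. fst l \<in> Arr g"
  shows "word_int g \<phi> (reduce w) = word_int g \<phi> w"
  using w
proof (induction w)
  case (Cons l w)
  then have IH: "word_int g \<phi> (reduce w) = word_int g \<phi> w" and l: "fst l \<in> Arr g" by auto
  show ?case
  proof (cases "reduce w")
    case Nil
    then show ?thesis using IH by simp
  next
    case (Cons l' w')
    then show ?thesis using IH letter_int_linv[OF \<phi> l] by auto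
  qed
qed simp

text \<open>On one subinterval the path is the letter up to an affine change of parameter, which
  \<open>seg\<close> absorbs: the two singular simplices are equal, not merely homologous.\<close>

lemma word_path_seg_letter:
  assumes w: "fg_mor g (x, w, y)" and n: "n < length w"
    and t: "real n \<le> real (length w) * \<tau>" "real (length w) * \<tau> \<le> real n + 1"
  shows "seg (\<lambda>r. quo g (word_path x w r)) (real n / real (length w)) \<tau> =
    seg (\<lambda>u. quo g (letter_pt (w ! n) u)) 0 (real (length w) * \<tau> - real n)"
proof (rule seg_eqI)
  fix s u :: real assume su: "0 \<le> s" "0 \<le> u" "s + u = 1"
  let ?m = "real (length w)"
  have m: "?m > 0" using n by linarith
  have s: "s = 1 - u" using su by simp
  define r where "r = s *\<^sub>R (real n / ?m) + u *\<^sub>R \<tau>"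
  have mr: "?m * r = real n + u * (?m * \<tau> - real n)"
    unfolding r_def s using m by (simp add: field_simps)
  have "0 \<le> u * (?m * \<tau> - real n)" using su t by simp
  moreover have "u * (?m * \<tau> - real n) \<le> 1 * 1" using su t by (intro mult_mono) auto
  ultimately have "quo g (word_path x w r) = quo g (letter_pt (w ! n) (?m * r - real n))"
    by (intro word_path_quo_letter[OF w n]) (simp_all add: mr)
  then show "quo g (word_path x w (s *\<^sub>R (real n / ?m) + u *\<^sub>R \<tau>)) =
      quo g (letter_pt (w ! n) (s *\<^sub>R 0 + u *\<^sub>R (?m * \<tau> - real n)))"
    unfolding r_def[symmetric] by (simp add: mr)
qed

lemma word_path_int_prefix:
  assumes \<phi>: "\<phi> \<in> cocycles 1 (realization g)" and w: "fg_mor g (x, w, y)" and n: "n \<le> length w"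
  shows "\<phi> (seg (\<lambda>r. quo g (word_path x w r)) 0 (real n / real (length w))) = word_int g \<phi> (take n w)"
  using n
proof (induction n)
  case 0
  show ?case
    using cocycle_seg_refl[OF \<phi> _ continuous_map_word_path[OF w], of 0] by simp
next
  case (Suc n)
  let ?m = "real (length w)"
  have m: "?m > 0" "real n \<le> ?m" "real (Suc n) \<le> ?m" using Suc.prems by linarith+
  have "seg (\<lambda>r. quo g (word_path x w r)) (real n / ?m) (real (Suc n) / ?m) =
      seg (\<lambda>u. quo g (letter_pt (w ! n) u)) 0 (?m * (real (Suc n) / ?m) - real n)"
    by (rule word_path_seg_letter[OF w]) (use Suc.prems m in auto)
  then have "\<phi> (seg (\<lambda>r. quo g (word_path x w r)) (real n / ?m) (real (Suc n) / ?m)) = letter_int g \<phi> (w ! n)"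
    using m by (simp add: letter_int_def)
  moreover have "\<phi> (seg (\<lambda>r. quo g (word_path x w r)) 0 (real (Suc n) / ?m)) =
      \<phi> (seg (\<lambda>r. quo g (word_path x w r)) 0 (real n / ?m)) +
      \<phi> (seg (\<lambda>r. quo g (word_path x w r)) (real n / ?m) (real (Suc n) / ?m))"
    by (rule cocycle_triangle[OF \<phi> _ continuous_map_word_path[OF w]]) (use m in \<open>simp_all del: of_nat_Suc\<close>)
  ultimately show ?case
    using Suc by (simp add: take_Suc_conv_app_nth)
qed

text \<open>Splits the integral at the last junction \<open>n / length w\<close> before
  \<open>\<tau>\<close> into complete letters and a partial one.\<close>

lemma word_path_int:
  assumes \<phi>: "\<phi> \<in> cocycles 1 (realization g)" and w: "fg_mor g (x, w, y)" and n: "n < length w"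
    and t: "real n \<le> real (length w) * \<tau>" "real (length w) * \<tau> \<le> real n + 1"
  shows "\<phi> (seg (\<lambda>r. quo g (word_path x w r)) 0 \<tau>) =
    word_int g \<phi> (take n w) + \<phi> (seg (\<lambda>u. quo g (letter_pt (w ! n) u)) 0 (real (length w) * \<tau> - real n))"
proof -
  let ?m = "real (length w)"
  have m: "?m > 0" "real n + 1 \<le> ?m" using n by linarith+
  have "0 \<le> ?m * \<tau>" "?m * \<tau> \<le> ?m * 1" using t m by linarith+
  then have \<tau>: "0 \<le> \<tau>" "\<tau> \<le> 1" using m by (simp_all add: zero_le_mult_iff)
  have "\<phi> (seg (\<lambda>r. quo g (word_path x w r)) 0 \<tau>) =
      \<phi> (seg (\<lambda>r. quo g (word_path x w r)) 0 (real n / ?m)) + \<phi> (seg (\<lambda>r. quo g (word_path x w r)) (real n / ?m) \<tau>)"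
    by (rule cocycle_triangle[OF \<phi> _ continuous_map_word_path[OF w]]) (use m \<tau> in auto)
  then show ?thesis
    using word_path_seg_letter[OF w n t] word_path_int_prefix[OF \<phi> w, of n] n by simp
qed

lemma word_path_int_full:
  assumes \<phi>: "\<phi> \<in> cocycles 1 (realization g)" and w: "fg_mor g (x, w, y)"
  shows "\<phi> (seg (\<lambda>r. quo g (word_path x w r)) 0 1) = word_int g \<phi> w"
proof (cases "w = []")
  case True
  have "quo g (Vert x) \<in> topspace (realization g)"
    using w by (auto simp: topspace_realization fg_mor_def pre_carrier_simps)
  then have "\<phi> (seg (\<lambda>r. quo g (word_path x w r)) (0::real) 1) = 0"
    by (rule cocycle_seg_const[OF \<phi>]) (simp add: True word_path_def)
  then show ?thesis using True by simp
next
  case False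
  then show ?thesis using word_path_int_prefix[OF \<phi> w, of "length w"] by simp
qed

text \<open>The closed disc is convex, so the integral along the chord from \<open>(-1, 0)\<close>
  equals that along the boundary arc, and the arc is glued to the word path. The sign
  \<open>sg\<close> selects the upper or the lower semicircle.\<close>

lemma disc_arc:
  assumes \<phi>: "\<phi> \<in> cocycles 1 (realization g)" and \<alpha>: "\<alpha> \<in> Cells g" and z: "norm z = 1" "sg * snd z \<ge> 0"
    and f: "sg = 1 \<and> f = csrc g \<alpha> \<or> sg = -1 \<and> f = ctgt g \<alpha>"
  shows "\<phi> (seg (\<lambda>z. quo g (DiscPt \<alpha> z)) (-1, 0) z) =
    \<phi> (seg (\<lambda>r. quo g (word_path (fsrc f) (fst (snd f)) r)) 0 (arccos (- fst z) / pi))"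
proof -
  \<comment> \<open>Inverse of the gluing parameter: horizontal coordinate
    \<open>- cos (pi * r)\<close>, on the semicircle of sign \<open>sg\<close>.\<close>
  define c where "c r = (- cos (pi * r), sg * sin (pi * r))" for r :: real
  let ?\<tau> = "arccos (- fst z) / pi"
  have sg: "sg * sg = 1" using f by auto
  have nz: "(fst z)\<^sup>2 + (snd z)\<^sup>2 = 1" using z(1) by (cases z) (simp add: norm_Pair)
  have fz: "-1 \<le> - fst z" "- fst z \<le> 1" using abs_fst_le_1[of z] z(1) by auto
  have \<tau>: "?\<tau> \<in> {0..1}" by (rule arccos_param) (use z in simp)
  have c0: "c 0 = (-1, 0)" by (simp add: c_def)
  have "sqrt (1 - (fst z)\<^sup>2) = sg * snd z"
  proof (rule real_sqrt_unique)
    show "(sg * snd z)\<^sup>2 = 1 - (fst z)\<^sup>2" using nz f by (auto simp: power_mult_distrib)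
  qed (rule z(2))
  then have "sg * sin (arccos (- fst z)) = snd z"
    using sin_arccos[OF fz] sg by (simp flip: mult.assoc)
  then have c1: "c ?\<tau> = z" using fz by (simp add: c_def prod_eq_iff cos_arccos)
  have nc: "norm (c r) = 1" for r
    using f by (auto simp: c_def norm_Pair)
  have eq: "quo g (DiscPt \<alpha> (c r)) = quo g (word_path (fsrc f) (fst (snd f)) r)" if r: "0 \<le> r" "r \<le> 1" for r
  proof (rule quo_glue)
    have "sin (pi * r) \<ge> 0" using r by (intro sin_ge_zero) (auto simp: mult_left_le)
    moreover have "arccos (cos (pi * r)) = pi * r" using r by (intro arccos_cos) (auto simp: mult_left_le)
    then have "r = arccos (- fst (c r)) / pi" by (simp add: c_def)
    ultimately show "(DiscPt \<alpha> (c r), word_path (fsrc f) (fst (snd f)) r) \<in> glue g"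
      using f \<alpha> nc[of r] unfolding glue_def c_def by auto
  qed
  have "continuous_on {0..1} c" unfolding c_def by (intro continuous_intros)
  then have "\<phi> (seg (\<lambda>r. quo g (DiscPt \<alpha> (c r))) 0 ?\<tau>) = \<phi> (seg (\<lambda>z. quo g (DiscPt \<alpha> z)) (c 0) (c ?\<tau>))"
    by (intro cocycle_curve[OF \<phi> convex_cball continuous_map_quo_disc[OF \<alpha>]]) (use nc \<tau> in auto)
  moreover have "seg (\<lambda>r. quo g (DiscPt \<alpha> (c r))) 0 ?\<tau> = seg (\<lambda>r. quo g (word_path (fsrc f) (fst (snd f)) r)) 0 ?\<tau>"
  proof (rule seg_eqI)
    fix s t :: real assume "0 \<le> s" "0 \<le> t" "s + t = 1"
    then have "s *\<^sub>R 0 + t *\<^sub>R ?\<tau> \<in> {0..1}" using \<tau> by (intro convexD) auto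
    then show "quo g (DiscPt \<alpha> (c (s *\<^sub>R 0 + t *\<^sub>R ?\<tau>))) =
        quo g (word_path (fsrc f) (fst (snd f)) (s *\<^sub>R 0 + t *\<^sub>R ?\<tau>))"
      by (intro eq) auto
  qed
  ultimately show ?thesis unfolding c0 c1 by simp
qed

text \<open>Both words integrate to the value of \<open>\<phi>\<close> on the diameter from
  \<open>(-1, 0)\<close> to \<open>(1, 0)\<close>.\<close>

lemma word_int_cell:
  assumes g: "groupoidal_computad g" and \<phi>: "\<phi> \<in> cocycles 1 (realization g)" and \<alpha>: "\<alpha> \<in> Cells g"
  shows "word_int g \<phi> (fst (snd (csrc g \<alpha>))) = word_int g \<phi> (fst (snd (ctgt g \<alpha>)))"
proof -
  have *: "\<phi> (seg (\<lambda>z. quo g (DiscPt \<alpha> z)) (-1, 0) (1, 0)) = word_int g \<phi> (fst (snd f))"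
    if f: "sg = 1 \<and> f = csrc g \<alpha> \<or> sg = -1 \<and> f = ctgt g \<alpha>" for f and sg :: real
  proof -
    obtain x w y where xwy: "f = (x, w, y)" by (cases f)
    have "fg_mor g f" using f g \<alpha> by (auto simp: groupoidal_computad_def)
    then have "fg_mor g (x, w, y)" by (simp add: xwy)
    from word_path_int_full[OF \<phi> this]
    show ?thesis using disc_arc[OF \<phi> \<alpha> _ _ f, of "(1, 0)"] by (simp add: xwy fsrc_def norm_Pair)
  qed
  show ?thesis using *[of 1 "csrc g \<alpha>"] *[of "-1" "ctgt g \<alpha>"] by simp
qed

text \<open>That all letters are arrows is carried through the induction because
  \<open>word_int_reduce\<close>, used for composites, asks for it.\<close>

lemma pcong_word_int:
  assumes g: "groupoidal_computad g" and \<phi>: "\<phi> \<in> cocycles 1 (realization g)" and p: "pcong g f f'"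
  shows "(\<forall>l\<in>set (fst (snd f)). fst l \<in> Arr g) \<and> (\<forall>l\<in>set (fst (snd f')). fst l \<in> Arr g) \<and>
    word_int g \<phi> (fst (snd f)) = word_int g \<phi> (fst (snd f'))"
  using p
proof (induction rule: pcong.induct)
  case (gen \<alpha>)
  then have "fg_mor g (csrc g \<alpha>)" "fg_mor g (ctgt g \<alpha>)" using g by (auto simp: groupoidal_computad_def)
  then show ?case using word_int_cell[OF g \<phi> gen] by (auto simp: fg_mor_def split: prod.splits)
next
  case (refl f)
  then show ?case by (auto simp: fg_mor_def split: prod.splits)
next
  case (postcomp f f' h)
  then have "\<forall>l\<in>set (fst (snd h)). fst l \<in> Arr g" by (auto simp: fg_mor_def split: prod.splits)
  then show ?case using postcomp.IH set_reduce[of "fst (snd f) @ fst (snd h)"] set_reduce[of "fst (snd f') @ fst (snd h)"]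
      word_int_reduce[OF \<phi>, of "fst (snd f) @ fst (snd h)"] word_int_reduce[OF \<phi>, of "fst (snd f') @ fst (snd h)"]
    unfolding fg_comp_def by fastforce
next
  case (precomp f f' h)
  then have "\<forall>l\<in>set (fst (snd h)). fst l \<in> Arr g" by (auto simp: fg_mor_def split: prod.splits)
  then show ?case using precomp.IH set_reduce[of "fst (snd h) @ fst (snd f)"] set_reduce[of "fst (snd h) @ fst (snd f')"]
      word_int_reduce[OF \<phi>, of "fst (snd h) @ fst (snd f)"] word_int_reduce[OF \<phi>, of "fst (snd h) @ fst (snd f')"]
    unfolding fg_comp_def by fastforce
qed auto

text \<open>\<open>p\<close> integrates along a chosen morphism from a base object. Following the
  one to the start of \<open>l\<close> by \<open>l\<close> gives a morphism parallel to the one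
  chosen for its end, so thinness makes their integrals agree.\<close>

lemma thin_vertex_potential:
  assumes g: "groupoidal_computad g" and c: "connected_computad g" and thin: "presented_groupoid_thin g"
    and \<phi>: "\<phi> \<in> cocycles 1 (realization g)"
  obtains p where "\<And>l. fst l \<in> Arr g \<Longrightarrow> letter_int g \<phi> l = p (letter_end g l) - p (letter_start g l)"
proof -
  obtain x0 where x0: "x0 \<in> Obj g" using c by (auto simp: connected_computad_def)
  have "\<exists>w. fg_mor g (x0, w, y)" if "y \<in> Obj g" for y
    using connected_imp_mor[OF g c x0 that] by blast
  then obtain k where k: "\<And>y. y \<in> Obj g \<Longrightarrow> fg_mor g (x0, k y, y)" by metis
  define p where "p y = word_int g \<phi> (k y)" for y
  have "letter_int g \<phi> l = p (letter_end g l) - p (letter_start g l)" if l: "fst l \<in> Arr g" for l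
  proof -
    have o: "letter_start g l \<in> Obj g" "letter_end g l \<in> Obj g"
      using g l by (auto simp: groupoidal_computad_def letter_start_def letter_end_def)
    let ?u = "k (letter_start g l) @ [l]"
    have u: "walk g x0 ?u (letter_end g l)"
      using k[OF o(1)] l by (auto simp: fg_mor_iff_walk walk_append)
    then have "fg_mor g (x0, reduce ?u, letter_end g l)"
      using x0 o by (simp add: fg_mor_iff_walk walk_reduce reduced_word_reduce)
    then have "pcong g (x0, reduce ?u, letter_end g l) (x0, k (letter_end g l), letter_end g l)"
      using thin k[OF o(2)] by (simp add: presented_groupoid_thin_def fsrc_def ftgt_def)
    from pcong_word_int[OF g \<phi> this]
    have "word_int g \<phi> (reduce ?u) = word_int g \<phi> (k (letter_end g l))" by simp
    then show ?thesis
      using word_int_reduce[OF \<phi> walk_letters[OF u]] by (simp add: p_def)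
  qed
  then show thesis using that by blast
qed

section \<open>Potentials on the complex\<close>

text \<open>Integration from a base point of each cell: the start of the edge, and the point
  \<open>(-1, 0)\<close> of the disc, where source and target paths both begin. It lives on the
  pre-space and descends only after \<open>cell_pot_glue\<close>.\<close>

fun cell_pot :: "('o, 'a, 'c) computad \<Rightarrow> ('o, 'a, 'c) precell set cochain \<Rightarrow> ('o \<Rightarrow> real) \<Rightarrow> ('o, 'a, 'c) precell \<Rightarrow> real"
where
  "cell_pot g \<phi> p (Vert v) = p v"
| "cell_pot g \<phi> p (EdgePt a r) = p (gdom g a) + \<phi> (seg (\<lambda>r. quo g (EdgePt a r)) 0 r)"
| "cell_pot g \<phi> p (DiscPt \<alpha> z) = p (fsrc (csrc g \<alpha>)) + \<phi> (seg (\<lambda>z. quo g (DiscPt \<alpha> z)) (-1, 0) z)"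

definition vertex_pot :: "('o, 'a, 'c) computad \<Rightarrow> ('o, 'a, 'c) precell set cochain \<Rightarrow> ('o \<Rightarrow> real) \<Rightarrow> bool" where
  "vertex_pot g \<phi> p \<longleftrightarrow> (\<forall>l. fst l \<in> Arr g \<longrightarrow> letter_int g \<phi> l = p (letter_end g l) - p (letter_start g l))"

text \<open>For an inverse letter the base point of the edge is its far end;
  \<open>vertex_pot\<close>, applied to the whole edge, accounts for the difference.\<close>

lemma cell_pot_letter:
  assumes \<phi>: "\<phi> \<in> cocycles 1 (realization g)" and p: "vertex_pot g \<phi> p" and l: "fst l \<in> Arr g"
    and u: "0 \<le> u" "u \<le> 1"
  shows "cell_pot g \<phi> p (letter_pt l u) = p (letter_start g l) + \<phi> (seg (\<lambda>r. quo g (letter_pt l r)) 0 u)"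
proof (cases "snd l")
  case True
  then show ?thesis by (simp add: letter_pt_def letter_start_def)
next
  case False
  let ?E = "\<lambda>r. quo g (EdgePt (fst l) r)"
  note E = continuous_map_quo_edge[OF l]
  have "seg (\<lambda>r. quo g (letter_pt l r)) 0 u = seg ?E 1 (1 - u)"
  proof (rule seg_eqI)
    fix s t :: real assume "s + t = 1"
    then have "s = 1 - t" by simp
    then have "1 - (s *\<^sub>R 0 + t *\<^sub>R u) = s *\<^sub>R 1 + t *\<^sub>R (1 - u)" by (simp add: algebra_simps)
    then show "quo g (letter_pt l (s *\<^sub>R 0 + t *\<^sub>R u)) = ?E (s *\<^sub>R 1 + t *\<^sub>R (1 - u))"
      using False by (simp add: letter_pt_def)
  qed
  moreover have "\<phi> (seg ?E 0 (1 - u)) = \<phi> (seg ?E 0 1) + \<phi> (seg ?E 1 (1 - u))"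
    by (rule cocycle_triangle[OF \<phi> _ E]) (use u in auto)
  moreover have "\<phi> (seg ?E 0 1) = p (gcod g (fst l)) - p (gdom g (fst l))"
    using p[unfolded vertex_pot_def, rule_format, of "(fst l, True)"] l
    by (simp add: letter_int_def letter_pt_def letter_start_def letter_end_def)
  ultimately show ?thesis using False by (simp add: letter_pt_def letter_start_def)
qed

lemma walk_pot:
  assumes p: "vertex_pot g \<phi> p" and w: "walk g x w y"
  shows "word_int g \<phi> w = p y - p x"
  using w
proof (induction w arbitrary: x)
  case (Cons l w)
  then show ?case using p[unfolded vertex_pot_def, rule_format, of l] by auto
qed simp

lemma cell_pot_word_path:
  assumes \<phi>: "\<phi> \<in> cocycles 1 (realization g)" and p: "vertex_pot g \<phi> p" and w: "fg_mor g (x, w, y)"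
    and \<tau>: "0 \<le> \<tau>" "\<tau> \<le> 1"
  shows "cell_pot g \<phi> p (word_path x w \<tau>) = p x + \<phi> (seg (\<lambda>r. quo g (word_path x w r)) 0 \<tau>)"
proof (cases "w = []")
  case True
  have "quo g (Vert x) \<in> topspace (realization g)"
    using w by (auto simp: topspace_realization fg_mor_def pre_carrier_simps)
  then have "\<phi> (seg (\<lambda>r. quo g (word_path x w r)) 0 \<tau>) = 0"
    by (rule cocycle_seg_const[OF \<phi>]) (simp add: True word_path_def)
  then show ?thesis by (simp add: True word_path_def)
next
  case False
  let ?m = "real (length w)"
  have m: "?m > 0" using False by simp
  \<comment> \<open>The letter that \<open>word_path\<close> itself selects. Equality of
    representatives is needed here, since \<open>cell_pot\<close> is not yet known to respect the
    gluing.\<close>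
  define n where "n = (if \<tau> = 1 then length w - 1 else nat \<lfloor>?m * \<tau>\<rfloor>)"
  have n: "n < length w" "real n \<le> ?m * \<tau>" "?m * \<tau> \<le> real n + 1"
    and eq: "cell_pot g \<phi> p (word_path x w \<tau>) = cell_pot g \<phi> p (letter_pt (w ! n) (?m * \<tau> - real n))"
  proof -
    have "n < length w \<and> real n \<le> ?m * \<tau> \<and> ?m * \<tau> \<le> real n + 1 \<and>
        cell_pot g \<phi> p (word_path x w \<tau>) = cell_pot g \<phi> p (letter_pt (w ! n) (?m * \<tau> - real n))"
    proof (cases "\<tau> = 1")
      case True
      obtain k where "length w = Suc k" using False by (cases w) auto
      then show ?thesis using True False by (simp add: n_def word_path_1 last_conv_nth)
    next
      case t: False
      have "?m * \<tau> < ?m" "0 \<le> ?m * \<tau>" using \<tau> t m by auto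
      moreover have "n = nat \<lfloor>?m * \<tau>\<rfloor>" using t by (simp add: n_def)
      ultimately have b: "n < length w" "real n \<le> ?m * \<tau>" "?m * \<tau> < real n + 1" by linarith+
      then show ?thesis by (simp add: word_path_letter[OF False])
    qed
    then show "n < length w" "real n \<le> ?m * \<tau>" "?m * \<tau> \<le> real n + 1"
      "cell_pot g \<phi> p (word_path x w \<tau>) = cell_pot g \<phi> p (letter_pt (w ! n) (?m * \<tau> - real n))" by auto
  qed
  have wk: "walk g x w y" using w by (simp add: fg_mor_iff_walk)
  moreover have "w = take n w @ (w ! n) # drop (Suc n) w" using n(1) by (rule id_take_nth_drop)
  ultimately obtain z where z: "walk g x (take n w) z" "walk g z ((w ! n) # drop (Suc n) w) y"
    by (metis walk_append)
  then have l: "fst (w ! n) \<in> Arr g" "letter_start g (w ! n) = z" by auto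
  show ?thesis
    unfolding eq word_path_int[OF \<phi> w n]
    using cell_pot_letter[OF \<phi> p l(1), of "?m * \<tau> - real n"] walk_pot[OF p z(1)] n l(2) by simp
qed

text \<open>At the far end of an edge this is \<open>vertex_pot\<close>. On a disc boundary both
  sides are integrals from the common starting vertex of source and target, compared by
  \<open>disc_arc\<close>.\<close>

lemma cell_pot_glue:
  assumes g: "groupoidal_computad g" and \<phi>: "\<phi> \<in> cocycles 1 (realization g)" and p: "vertex_pot g \<phi> p"
    and xy: "(x, y) \<in> glue g"
  shows "cell_pot g \<phi> p x = cell_pot g \<phi> p y"
proof -
  have disc: "cell_pot g \<phi> p (DiscPt \<alpha> z) =
      cell_pot g \<phi> p (word_path (fsrc f) (fst (snd f)) (arccos (- fst z) / pi))"
    if \<alpha>: "\<alpha> \<in> Cells g" and z: "norm z = 1" "sg * snd z \<ge> 0"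
      and f: "sg = 1 \<and> f = csrc g \<alpha> \<or> sg = -1 \<and> f = ctgt g \<alpha>" for \<alpha> z f and sg :: real
  proof -
    obtain x w y where xwy: "f = (x, w, y)" by (cases f)
    have "fg_mor g f" "fsrc f = fsrc (csrc g \<alpha>)" using f g \<alpha> by (auto simp: groupoidal_computad_def)
    then have w: "fg_mor g (x, w, y)" "fsrc (csrc g \<alpha>) = x" by (simp_all add: xwy fsrc_def)
    have "arccos (- fst z) / pi \<in> {0..1}" by (rule arccos_param) (use z in simp)
    then show ?thesis
      using cell_pot_word_path[OF \<phi> p w(1), of "arccos (- fst z) / pi"] disc_arc[OF \<phi> \<alpha> z f]
      by (simp add: w(2)) (simp add: xwy fsrc_def)
  qed
  from xy show ?thesis
  proof (cases rule: glue_cases)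
    case (1 a)
    have "\<phi> (seg (\<lambda>r. quo g (EdgePt a r)) 0 0) = 0"
      by (rule cocycle_seg_refl[OF \<phi> _ continuous_map_quo_edge[OF 1(3)]]) auto
    then show ?thesis by (simp add: 1)
  next
    case (2 a)
    then show ?thesis
      using p[unfolded vertex_pot_def, rule_format, of "(a, True)"]
      by (simp add: letter_int_def letter_pt_def letter_start_def letter_end_def)
  next
    case (3 \<alpha> z)
    then show ?thesis using disc[of \<alpha> z 1 "csrc g \<alpha>"] by simp
  next
    case (4 \<alpha> z)
    then show ?thesis using disc[of \<alpha> z "-1" "ctgt g \<alpha>"] by simp
  qed
qed

lemma cell_pot_edge:
  assumes \<phi>: "\<phi> \<in> cocycles 1 (realization g)" and a: "a \<in> Arr g" and rs: "r \<in> {0..1}" "s \<in> {0..1}"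
  shows "\<phi> (seg (\<lambda>r. quo g (EdgePt a r)) r s) = cell_pot g \<phi> p (EdgePt a s) - cell_pot g \<phi> p (EdgePt a r)"
  using cocycle_triangle[OF \<phi> _ continuous_map_quo_edge[OF a], of 0 r s] rs by simp

lemma cell_pot_disc:
  assumes \<phi>: "\<phi> \<in> cocycles 1 (realization g)" and \<alpha>: "\<alpha> \<in> Cells g" and z: "z \<in> cball 0 1" "z' \<in> cball 0 1"
  shows "\<phi> (seg (\<lambda>z. quo g (DiscPt \<alpha> z)) z z') = cell_pot g \<phi> p (DiscPt \<alpha> z') - cell_pot g \<phi> p (DiscPt \<alpha> z)"
  using cocycle_triangle[OF \<phi> convex_cball continuous_map_quo_disc[OF \<alpha>], of "(-1, 0)" z z'] z
  by (simp add: norm_Pair)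

lemma seg_cong:
  assumes "convex D" "a \<in> D" "b \<in> D" "\<And>z. z \<in> D \<Longrightarrow> F z = G z"
  shows "seg F a b = seg G a b"
  by (rule seg_eqI) (use assms in \<open>auto intro!: convexD\<close>)

lemma path_potential_cong:
  assumes "a \<le> b" "\<And>s. s \<in> {a..b} \<Longrightarrow> F s = G s"
  shows "path_potential \<phi> \<psi> F a b = path_potential \<phi> \<psi> G a b"
  using seg_cong[of "{a..b}" a b F G] assms by (simp add: path_potential_def)

text \<open>A sliding point runs along a straight segment of its edge, where \<open>cell_pot\<close>
  is an integral.\<close>

lemma slide_track:
  assumes \<phi>: "\<phi> \<in> cocycles 1 (realization g)" and \<psi>: "\<And>x. \<psi> (quo g x) = cell_pot g \<phi> p x"
    and x: "x \<in> unmiddled (graph_of g)"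
  shows "path_potential \<phi> \<psi> (\<lambda>u. quo g (slide u x)) 0 1"
proof (cases x)
  case (Vert v)
  then have "quo g x \<in> topspace (realization g)"
    using x by (auto simp: topspace_realization unmiddled_simps pre_carrier_simps)
  then have "\<phi> (seg (\<lambda>u. quo g (slide u x)) (0::real) 1) = 0"
    by (rule cocycle_seg_const[OF \<phi>]) (simp add: Vert)
  then show ?thesis by (simp add: path_potential_def Vert)
next
  case (EdgePt a r)
  then have a: "a \<in> Arr g" "r \<in> {0..1}" using x by (auto simp: unmiddled_simps)
  let ?r = "if r < 1/2 then 0 else 1 :: real"
  have "seg (\<lambda>u. quo g (slide u x)) 0 1 = seg (\<lambda>r. quo g (EdgePt a r)) r ?r"
  proof (rule seg_eqI)
    fix s t :: real assume "s + t = 1"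
    then have "s = 1 - t" by simp
    then show "quo g (slide (s *\<^sub>R 0 + t *\<^sub>R 1) x) = quo g (EdgePt a (s *\<^sub>R r + t *\<^sub>R ?r))"
      by (simp add: EdgePt)
  qed
  then show ?thesis
    using cell_pot_edge[OF \<phi> a(1,2), of ?r p] by (simp add: path_potential_def \<psi> EdgePt)
next
  case (DiscPt \<alpha> z)
  then show ?thesis using x by (simp add: unmiddled_simps)
qed

text \<open>Likewise for the radial segment from \<open>z\<close> to \<open>sgn z\<close> inside the
  disc.\<close>

lemma push_track:
  assumes \<phi>: "\<phi> \<in> cocycles 1 (realization g)" and \<psi>: "\<And>x. \<psi> (quo g x) = cell_pot g \<phi> p x"
    and x: "x \<in> uncentred g"
  shows "path_potential \<phi> \<psi> (\<lambda>u. quo g (push u x)) 0 1"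
proof (cases "\<exists>\<alpha> z. x = DiscPt \<alpha> z")
  case False
  then have px: "push u x = x" for u by (cases x) auto
  have "quo g x \<in> topspace (realization g)"
    using x by (auto simp: topspace_realization uncentred_def)
  then have "\<phi> (seg (\<lambda>u. quo g (push u x)) (0::real) 1) = 0"
    by (rule cocycle_seg_const[OF \<phi>]) (simp add: px)
  then show ?thesis by (simp add: path_potential_def px)
next
  case True
  then obtain \<alpha> z where xz: "x = DiscPt \<alpha> z" by blast
  then have z: "\<alpha> \<in> Cells g" "z \<in> cball 0 1" "z \<noteq> 0" using x by (auto simp: uncentred_simps)
  have "seg (\<lambda>u. quo g (push u x)) 0 1 = seg (\<lambda>z. quo g (DiscPt \<alpha> z)) z (sgn z)"
  proof (rule seg_eqI)
    fix s t :: real assume "s + t = 1"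
    then have "s = 1 - t" by simp
    then show "quo g (push (s *\<^sub>R 0 + t *\<^sub>R 1) x) = quo g (DiscPt \<alpha> (s *\<^sub>R z + t *\<^sub>R sgn z))"
      by (simp add: xz sgn_div_norm scaleR_add_left divide_inverse)
  qed
  moreover have "sgn z \<in> cball 0 1" using z by (simp add: norm_sgn)
  moreover have "push 1 x = DiscPt \<alpha> (sgn z)" "push 0 x = DiscPt \<alpha> z"
    by (simp_all add: xz sgn_div_norm divide_inverse)
  ultimately show ?thesis
    using cell_pot_disc[OF \<phi> z(1,2), of "sgn z" p] by (simp add: path_potential_def \<psi>)
qed

text \<open>An edge midpoint has the open edge as neighbourhood, and there the path is a curve in an
  interval. Any other point has a neighbourhood that slides to a single vertex, where the deformed
  path has integral 0.\<close>

lemma path_potential_graph: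
  assumes g: "groupoidal_computad g" and \<phi>: "\<phi> \<in> cocycles 1 (realization g)"
    and \<psi>: "\<And>x. \<psi> (quo g x) = cell_pot g \<phi> p x"
    and \<iota>: "continuous_map (realization (graph_of g)) (realization g) \<iota>"
      "\<And>x. x \<in> pre_carrier (graph_of g) \<Longrightarrow> \<iota> (quo (graph_of g) x) = quo g x"
    and ab: "a \<le> b" and F: "continuous_map (top_of_set {a..b}) (realization (graph_of g)) F"
  shows "path_potential \<phi> \<psi> (\<iota> \<circ> F) a b"
proof (rule path_potential_local[OF \<phi> \<iota>(1) _ ab F])
  let ?\<Gamma> = "graph_of g" let ?Y = "realization (graph_of g)" let ?U = "quo (graph_of g) ` unmiddled (graph_of g)"
  have C: "Cells ?\<Gamma> = {}" by simp
  have g\<Gamma>: "groupoidal_computad ?\<Gamma>" by (rule groupoidal_computad_graph_of[OF g])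
  fix y assume "y \<in> topspace ?Y"
  then obtain x where x: "x \<in> pre_carrier ?\<Gamma>" "y = quo ?\<Gamma> x" by (auto simp: topspace_realization)
  show "\<exists>N. openin ?Y N \<and> y \<in> N \<and> (\<forall>F a b. a \<le> b \<longrightarrow>
      continuous_map (top_of_set {a..b}) (subtopology ?Y N) F \<longrightarrow> path_potential \<phi> \<psi> (\<iota> \<circ> F) a b)"
  proof (cases "x \<in> unmiddled ?\<Gamma>")
    case False
    then obtain c where xc: "x = EdgePt c (1/2)" using x by (auto simp: unmiddled_def)
    then have c: "c \<in> Arr g" using x by (simp add: pre_carrier_simps)
    let ?e = "\<lambda>r. quo ?\<Gamma> (EdgePt c r)" let ?D = "{0<..<1::real}"
    have sub: "?D \<subseteq> {0..1}" by auto
    have \<iota>e: "\<iota> (?e r) = quo g (EdgePt c r)" if "r \<in> ?D" for r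
      using \<iota>(2)[of "EdgePt c r"] that c by (simp add: pre_carrier_simps)
    have e: "continuous_map (top_of_set ?D) ?Y ?e"
      using continuous_map_from_subtopology_mono[OF continuous_map_quo_edge[of c ?\<Gamma>] sub] c by simp
    have op: "openin ?Y (?e ` W)" if "open W" "W \<subseteq> ?D" for W
      using openin_quo_edge[OF C _ that, of c] c by simp
    have inj: "inj_on ?e ?D"
    proof (rule inj_onI)
      fix r s assume "r \<in> ?D" "s \<in> ?D" "?e r = ?e s"
      then show "r = s" using quo_edge_inj[OF C, of c r "EdgePt c s"] by simp
    qed
    have hom: "homeomorphic_map (top_of_set ?D) (subtopology ?Y (?e ` ?D)) ?e"
      by (rule homeomorphic_map_open_cell[OF e inj _ op]) auto
    show ?thesis
    proof (intro exI[of _ "?e ` ?D"] conjI allI impI)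
      show "openin ?Y (?e ` ?D)" by (rule op) auto
      show "y \<in> ?e ` ?D" unfolding x(2) xc by (rule image_eqI[of _ _ "1/2"]) auto
      fix F a b assume ab: "a \<le> (b::real)" and F: "continuous_map (top_of_set {a..b}) (subtopology ?Y (?e ` ?D)) F"
      show "path_potential \<phi> \<psi> (\<iota> \<circ> F) a b"
      proof (rule path_potential_open_cell[OF \<phi> _ hom _ _ ab F])
        show "continuous_map (top_of_set ?D) (realization g) (\<lambda>r. \<iota> (?e r))"
          using continuous_map_compose[OF e \<iota>(1)] by (simp add: comp_def)
        fix r s assume rs: "r \<in> ?D" "s \<in> ?D"
        have "seg (\<lambda>r. \<iota> (?e r)) r s = seg (\<lambda>r. quo g (EdgePt c r)) r s"
          by (rule seg_cong[of ?D]) (use rs \<iota>e in auto)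
        then show "\<phi> (seg (\<lambda>r. \<iota> (?e r)) r s) = \<psi> (\<iota> (?e s)) - \<psi> (\<iota> (?e r))"
          using cell_pot_edge[OF \<phi> c, of r s p] rs \<iota>e by (simp add: \<psi>)
      qed simp
    qed
  next
    case True
    let ?v = "near_vert ?\<Gamma> x"
    have top: "topspace (subtopology ?Y ?U) = ?U" using openin_subset[OF openin_unmiddled[OF C]] by auto
    obtain \<rho> where \<rho>: "continuous_map (subtopology ?Y ?U) (discrete_topology (Obj ?\<Gamma>)) \<rho>"
      "\<And>x. x \<in> unmiddled ?\<Gamma> \<Longrightarrow> \<rho> (quo ?\<Gamma> x) = near_vert ?\<Gamma> x"
      by (rule unmiddled_retraction[OF g\<Gamma> C]) blast
    obtain H where H: "continuous_map (prod_topology (top_of_set {0..1}) (subtopology ?Y ?U)) (subtopology ?Y ?U) H"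
      "\<And>t x. t \<in> {0..1} \<Longrightarrow> x \<in> unmiddled ?\<Gamma> \<Longrightarrow> H (t, quo ?\<Gamma> x) = quo ?\<Gamma> (slide t x)"
      by (rule unmiddled_homotopy[OF C]) blast
    \<comment> \<open>The fibre of the retraction over one vertex, open because the vertices are
      discrete: the star of half-edges around it.\<close>
    define N where "N = {\<xi> \<in> topspace (subtopology ?Y ?U). \<rho> \<xi> \<in> {?v}}"
    have v: "?v \<in> Obj g" using near_vert_in_Obj[OF g\<Gamma> True C] by simp
    have "openin (subtopology ?Y ?U) N" unfolding N_def
      by (rule openin_continuous_map_preimage[OF \<rho>(1)]) (use v in simp)
    then have N: "openin ?Y N" using openin_trans_full openin_unmiddled[OF C] by blast
    have "continuous_map (subtopology ?Y ?U) (realization g) \<iota>"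
      by (rule continuous_map_from_subtopology[OF \<iota>(1)])
    from continuous_map_compose[OF H(1) this]
    have \<iota>H: "continuous_map (prod_topology (top_of_set {0..1}) (subtopology ?Y ?U)) (realization g) (\<lambda>z. \<iota> (H z))"
      by (simp add: comp_def)
    have \<iota>Hq: "\<iota> (H (t, quo ?\<Gamma> x)) = quo g (slide t x)" if "t \<in> {0..1}" "x \<in> unmiddled ?\<Gamma>" for t x
    proof -
      have "slide t x \<in> pre_carrier ?\<Gamma>" using slide_in_unmiddled[OF that] by (simp add: unmiddled_def)
      then show ?thesis using H(2)[OF that] \<iota>(2) by simp
    qed
    show ?thesis
    proof (intro exI[of _ N] conjI allI impI N)
      show "y \<in> N" unfolding N_def top using True \<rho>(2)[OF True] x by simp
      fix F a b assume ab: "a \<le> (b::real)" and F: "continuous_map (top_of_set {a..b}) (subtopology ?Y N) F"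
      have FN: "F s \<in> N" if "s \<in> {a..b}" for s
        using funcset_mem[OF continuous_map_funspace[OF F]] that by simp
      have rep: "\<exists>x'\<in>unmiddled ?\<Gamma>. F s = quo ?\<Gamma> x' \<and> near_vert ?\<Gamma> x' = ?v" if s: "s \<in> {a..b}" for s
        using FN[OF s] \<rho>(2) unfolding N_def top by auto
      have FU: "continuous_map (top_of_set {a..b}) (subtopology ?Y ?U) F"
      proof -
        have "N \<subseteq> ?U" unfolding N_def top by blast
        then show ?thesis using F FN by (auto simp: continuous_map_in_subtopology)
      qed
      have "path_potential \<phi> \<psi> (\<lambda>s. \<iota> (H (0, F s))) a b"
      proof (rule path_potential_homotopy[OF \<phi> \<iota>H ab FU])
        fix y assume "y \<in> topspace (subtopology ?Y ?U)"
        then obtain x' where x': "x' \<in> unmiddled ?\<Gamma>" "y = quo ?\<Gamma> x'" unfolding top by blast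
        have "path_potential \<phi> \<psi> (\<lambda>u. \<iota> (H (u, y))) 0 1 = path_potential \<phi> \<psi> (\<lambda>u. quo g (slide u x')) 0 1"
          by (rule path_potential_cong) (use \<iota>Hq x' in auto)
        then show "path_potential \<phi> \<psi> (\<lambda>u. \<iota> (H (u, y))) 0 1" using slide_track[OF \<phi> \<psi> x'(1)] by simp
      next
        \<comment> \<open>All of \<open>N\<close> slides to the same vertex, so the end of the
          homotopy is a constant path.\<close>
        have const: "\<iota> (H (1, F s)) = quo g (Vert ?v)" if s: "s \<in> {a..b}" for s
        proof -
          obtain x' where x': "x' \<in> unmiddled ?\<Gamma>" "F s = quo ?\<Gamma> x'" "near_vert ?\<Gamma> x' = ?v" using rep[OF s] by blast
          have "quo ?\<Gamma> (slide 1 x') = quo ?\<Gamma> (Vert ?v)" using quo_slide_1[OF x'(1) C] x'(3) by simp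
          then show ?thesis using \<iota>Hq[of 1, OF _ x'(1)] x'(2) quo_graph_of_imp by simp
        qed
        have "path_potential \<phi> \<psi> (\<lambda>s. \<iota> (H (1, F s))) a b = path_potential \<phi> \<psi> (\<lambda>_. quo g (Vert ?v)) a b"
          by (rule path_potential_cong[OF ab const])
        moreover have "quo g (Vert ?v) \<in> topspace (realization g)"
          using v by (auto simp: topspace_realization pre_carrier_simps)
        then have "\<phi> (seg (\<lambda>_. quo g (Vert ?v)) a b) = 0" by (rule cocycle_seg_const[OF \<phi>]) simp
        ultimately show "path_potential \<phi> \<psi> (\<lambda>s. \<iota> (H (1, F s))) a b" by (simp add: path_potential_def)
      qed
      moreover have "path_potential \<phi> \<psi> (\<lambda>s. \<iota> (H (0, F s))) a b = path_potential \<phi> \<psi> (\<iota> \<circ> F) a b"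
      proof (rule path_potential_cong[OF ab])
        fix s assume "s \<in> {a..b}"
        from rep[OF this] obtain x' where x': "x' \<in> unmiddled ?\<Gamma>" "F s = quo ?\<Gamma> x'" by blast
        then show "\<iota> (H (0, F s)) = (\<iota> \<circ> F) s" using H(2)[of 0 x'] by (simp add: slide_0)
      qed
      ultimately show "path_potential \<phi> \<psi> (\<iota> \<circ> F) a b" by simp
    qed
  qed
qed

text \<open>Near a disc centre the open disc is used. Elsewhere the complement of all centres is one
  neighbourhood, and pushing outwards turns the path into one coming from the graph.\<close>

lemma path_potential_realization:
  assumes g: "groupoidal_computad g" and \<phi>: "\<phi> \<in> cocycles 1 (realization g)"
    and \<psi>: "\<And>x. \<psi> (quo g x) = cell_pot g \<phi> p x"
    and ab: "a \<le> b" and F: "continuous_map (top_of_set {a..b}) (realization g) F"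
  shows "path_potential \<phi> \<psi> F a b"
proof -
  let ?X = "realization g" let ?U = "quo g ` uncentred g" let ?\<Gamma> = "graph_of g"
  have "path_potential \<phi> \<psi> (id \<circ> F) a b"
  proof (rule path_potential_local[OF \<phi> continuous_map_id _ ab F])
    fix y assume "y \<in> topspace ?X"
    then obtain x where x: "x \<in> pre_carrier g" "y = quo g x" by (auto simp: topspace_realization)
    show "\<exists>N. openin ?X N \<and> y \<in> N \<and> (\<forall>F a b. a \<le> b \<longrightarrow>
        continuous_map (top_of_set {a..b}) (subtopology ?X N) F \<longrightarrow> path_potential \<phi> \<psi> (id \<circ> F) a b)"
    proof (cases "x \<in> uncentred g")
      case False
      then obtain \<alpha> where x0: "x = DiscPt \<alpha> 0" using x by (auto simp: uncentred_def)
      then have \<alpha>: "\<alpha> \<in> Cells g" using x by (simp add: pre_carrier_simps)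
      let ?e = "\<lambda>z. quo g (DiscPt \<alpha> z)" let ?D = "ball (0::real\<times>real) 1"
      have e: "continuous_map (top_of_set ?D) ?X ?e"
        by (rule continuous_map_from_subtopology_mono[OF continuous_map_quo_disc[OF \<alpha>] ball_subset_cball])
      have inj: "inj_on ?e ?D"
      proof (rule inj_onI)
        fix z z' assume "z \<in> ?D" "z' \<in> ?D" "?e z = ?e z'"
        then show "z = z'" using quo_disc_inj[of g \<alpha> z "DiscPt \<alpha> z'"] by simp
      qed
      have hom: "homeomorphic_map (top_of_set ?D) (subtopology ?X (?e ` ?D)) ?e"
        by (rule homeomorphic_map_open_cell[OF e inj open_ball openin_quo_disc[OF \<alpha>]])
      show ?thesis
      proof (intro exI[of _ "?e ` ?D"] conjI allI impI)
        show "openin ?X (?e ` ?D)" by (rule openin_quo_disc[OF \<alpha>]) auto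
        show "y \<in> ?e ` ?D" unfolding x(2) x0 by (rule image_eqI[of _ _ 0]) auto
        fix F a b assume ab: "a \<le> (b::real)" and F: "continuous_map (top_of_set {a..b}) (subtopology ?X (?e ` ?D)) F"
        show "path_potential \<phi> \<psi> (id \<circ> F) a b"
        proof (rule path_potential_open_cell[OF \<phi> convex_ball hom _ _ ab F])
          show "continuous_map (top_of_set ?D) ?X (\<lambda>z. id (?e z))" using e by simp
          fix z z' assume "z \<in> ?D" "z' \<in> ?D"
          then show "\<phi> (seg (\<lambda>z. id (?e z)) z z') = \<psi> (id (?e z')) - \<psi> (id (?e z))"
            using cell_pot_disc[OF \<phi> \<alpha>, of z z' p] by (simp add: \<psi>)
        qed
      qed
    next
      case True
      have top: "topspace (subtopology ?X ?U) = ?U" using openin_subset[OF openin_uncentred[of g]] by auto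
      obtain \<rho> where \<rho>: "continuous_map (subtopology ?X ?U) (realization ?\<Gamma>) \<rho>"
        "\<And>x. x \<in> uncentred g \<Longrightarrow> \<rho> (quo g x) = quo ?\<Gamma> (flat g x)"
        by (rule uncentred_retraction[OF g]) blast
      obtain \<iota> where \<iota>: "continuous_map (realization ?\<Gamma>) ?X \<iota>"
        "\<And>x. x \<in> pre_carrier ?\<Gamma> \<Longrightarrow> \<iota> (quo ?\<Gamma> x) = quo g x"
        by (rule graph_inclusion) blast
      obtain H where H: "continuous_map (prod_topology (top_of_set {0..1}) (subtopology ?X ?U)) (subtopology ?X ?U) H"
        "\<And>t x. t \<in> {0..1} \<Longrightarrow> x \<in> uncentred g \<Longrightarrow> H (t, quo g x) = quo g (push t x)"
        by (rule uncentred_homotopy) blast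
      have HX: "continuous_map (prod_topology (top_of_set {0..1}) (subtopology ?X ?U)) ?X H"
        using H(1) by (simp add: continuous_map_in_subtopology)
      show ?thesis
      proof (intro exI[of _ ?U] conjI allI impI openin_uncentred)
        show "y \<in> ?U" using True x by blast
        fix F a b assume ab: "a \<le> (b::real)" and F: "continuous_map (top_of_set {a..b}) (subtopology ?X ?U) F"
        have rep: "\<exists>x'\<in>uncentred g. F s = quo g x'" if "s \<in> {a..b}" for s
          using funcset_mem[OF continuous_map_funspace[OF F]] that unfolding top by auto
        have "path_potential \<phi> \<psi> (\<lambda>s. H (0, F s)) a b"
        proof (rule path_potential_homotopy[OF \<phi> HX ab F])
          fix y assume "y \<in> topspace (subtopology ?X ?U)"
          then obtain x' where x': "x' \<in> uncentred g" "y = quo g x'" unfolding top by blast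
          have "path_potential \<phi> \<psi> (\<lambda>u. H (u, y)) 0 1 = path_potential \<phi> \<psi> (\<lambda>u. quo g (push u x')) 0 1"
            by (rule path_potential_cong) (use H(2) x' in auto)
          then show "path_potential \<phi> \<psi> (\<lambda>u. H (u, y)) 0 1" using push_track[OF \<phi> \<psi> x'(1)] by simp
        next
          have "path_potential \<phi> \<psi> (\<lambda>s. H (1, F s)) a b = path_potential \<phi> \<psi> (\<iota> \<circ> (\<rho> \<circ> F)) a b"
          proof (rule path_potential_cong[OF ab])
            fix s assume "s \<in> {a..b}"
            from rep[OF this] obtain x' where x': "x' \<in> uncentred g" "F s = quo g x'" by blast
            then show "H (1, F s) = (\<iota> \<circ> (\<rho> \<circ> F)) s"
              using H(2)[of 1 x'] \<rho>(2)[OF x'(1)] \<iota>(2)[OF flat_in_carrier[OF g x'(1)]] quo_push_1[OF x'(1)] by simp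
          qed
          moreover have "path_potential \<phi> \<psi> (\<iota> \<circ> (\<rho> \<circ> F)) a b"
            by (rule path_potential_graph[OF g \<phi> \<psi> \<iota> ab continuous_map_compose[OF F \<rho>(1)]])
          ultimately show "path_potential \<phi> \<psi> (\<lambda>s. H (1, F s)) a b" by simp
        qed
        moreover have "path_potential \<phi> \<psi> (\<lambda>s. H (0, F s)) a b = path_potential \<phi> \<psi> (id \<circ> F) a b"
        proof (rule path_potential_cong[OF ab])
          fix s assume "s \<in> {a..b}"
          from rep[OF this] obtain x' where x': "x' \<in> uncentred g" "F s = quo g x'" by blast
          then show "H (0, F s) = (id \<circ> F) s" using H(2)[of 0 x'] by (simp add: push_0)
        qed
        ultimately show "path_potential \<phi> \<psi> (id \<circ> F) a b" by simp
      qed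
    qed
  qed
  then show ?thesis by simp
qed

lemma thin_imp_cocycle_coboundary:
  assumes g: "groupoidal_computad g" and c: "connected_computad g" and thin: "presented_groupoid_thin g"
    and \<phi>: "\<phi> \<in> cocycles 1 (realization g)"
  shows "\<phi> \<in> coboundaries 1 (realization g)"
proof -
  obtain p where "\<And>l. fst l \<in> Arr g \<Longrightarrow> letter_int g \<phi> l = p (letter_end g l) - p (letter_start g l)"
    by (rule thin_vertex_potential[OF g c thin \<phi>]) blast
  then have p: "vertex_pot g \<phi> p" by (simp add: vertex_pot_def)
  \<comment> \<open>An arbitrary representative of the class; \<open>cell_pot_glue\<close> makes the
    choice immaterial.\<close>
  define \<psi> where "\<psi> \<xi> = cell_pot g \<phi> p (SOME x. quo g x = \<xi>)" for \<xi>
  have \<psi>: "\<psi> (quo g x) = cell_pot g \<phi> p x" for x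
    unfolding \<psi>_def
  proof (rule quo_respects[OF cell_pot_glue[OF g \<phi> p]])
    show "quo g (SOME y. quo g y = quo g x) = quo g x" by (rule someI) simp
  qed
  show ?thesis
    by (rule cocycle_exact_if_potential[OF \<phi> path_potential_realization[OF g \<phi> \<psi>]]) simp
qed

theorem mainTheorem10:
  fixes g :: "('o, 'a, 'c) computad"
  assumes "groupoidal_computad g"
    and "connected_computad g"
    and "\<exists>c. euler_char (realization g) c \<and> c < 1"
  shows "\<not> presented_groupoid_thin g"
proof
  assume thin: "presented_groupoid_thin g"
  obtain c where c: "euler_char (realization g) c" "c < 1" using assms(3) by blast
  \<comment> \<open>Connectedness includes the existence of an object, which is what makes
    \<open>H^0\<close> nonzero.\<close>
  have "Obj g \<noteq> {}" using assms(2) by (simp add: connected_computad_def)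
  then have "topspace (realization g) \<noteq> {}" by (auto simp: topspace_realization pre_carrier_def)
  moreover have "cocycles p (realization g) \<subseteq> coboundaries p (realization g)" if "odd p" for p
  proof (cases "p = 1")
    case True
    then show ?thesis using thin_imp_cocycle_coboundary[OF assms(1,2) thin] by blast
  next
    case False
    then have "3 \<le> p" using \<open>odd p\<close> by presburger
    then show ?thesis
      using acyclic_imp_cocycle_coboundary[OF acyclic_in_realization[OF assms(1)]] by auto
  qed
  ultimately have "c \<ge> 1" using euler_char_ge_1[OF c(1)] by blast
  with c(2) show False by simp
qed

end
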